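(* Let $G$ be a discrete group. Then there is a homotopy equivalence $E_{\mathrm{com}}G\simeq|\mathrm{AfCom}(G)|$.
   Context: $B_{\mathrm{com}}G$ is the geometric realization of the simplicial subset of the nerve $NG$ ($G$ viewed as a one-object category) whose $n$-simplices are the $n$-tuples $(g_1,\dots,g_n)\in G^n$ of pairwise commuting elements. $E_{\mathrm{com}}G$ denotes the homotopy fiber of the canonical map $B_{\mathrm{com}}G\to BG$ induced by the inclusion. A finite non-empty subset $S$ of $G$ is affinely commutative if it is contained in a single left coset $gA$ of some abelian subgroup $A$ of $G$; equivalently, writing $S=\{s_0,\dots,s_n\}$, the consecutive quotients $s_0^{-1}s_1,\dots,s_{n-1}^{-1}s_n$ pairwise commute. $\mathrm{AfCom}(G)$ is the (abstract) simplicial complex whose vertices are the elements of $G$ and whose simplices are the affinely commutative subsets of $G$. *)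

theory Defs
  imports "HOL-Homology.Homology" "HOL-Algebra.Coset"
begin

subsection \<open>Quotient spaces, path spaces, homotopy fibres\<close>

definition quotient_space :: "'a topology \<Rightarrow> ('a \<times> 'a) set \<Rightarrow> 'a set topology" where
  "quotient_space X r = topology (\<lambda>\<U>. \<U> \<subseteq> topspace X // r \<and> openin X {x \<in> topspace X. r `` {x} \<in> \<U>})"

lemma istopology_quotient_space:
  "istopology (\<lambda>\<U>. \<U> \<subseteq> topspace X // r \<and> openin X {x \<in> topspace X. r `` {x} \<in> \<U>})"
proof -
  have "openin X {x \<in> topspace X. r `` {x} \<in> S \<inter> T}"
    if "openin X {x \<in> topspace X. r `` {x} \<in> S}" "openin X {x \<in> topspace X. r `` {x} \<in> T}" for S T
  proof -
    have "{x \<in> topspace X. r `` {x} \<in> S \<inter> T}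
        = {x \<in> topspace X. r `` {x} \<in> S} \<inter> {x \<in> topspace X. r `` {x} \<in> T}" by auto
    then show ?thesis using that by auto
  qed
  moreover have "openin X {x \<in> topspace X. r `` {x} \<in> \<Union>\<K>}"
    if "\<And>S. S \<in> \<K> \<Longrightarrow> openin X {x \<in> topspace X. r `` {x} \<in> S}" for \<K>
  proof -
    have "{x \<in> topspace X. r `` {x} \<in> \<Union>\<K>} = (\<Union>S\<in>\<K>. {x \<in> topspace X. r `` {x} \<in> S})" by auto
    then show ?thesis using that by auto
  qed
  ultimately show ?thesis
    unfolding istopology_def by blast
qed

lemma openin_quotient_space:
  "openin (quotient_space X r) \<U>
    \<longleftrightarrow> \<U> \<subseteq> topspace X // r \<and> openin X {x \<in> topspace X. r `` {x} \<in> \<U>}"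
  by (simp only: quotient_space_def topology_inverse'[OF istopology_quotient_space])

lemma topspace_quotient_space [simp]: "topspace (quotient_space X r) = topspace X // r"
proof
  show "topspace (quotient_space X r) \<subseteq> topspace X // r"
    using openin_quotient_space openin_topspace by blast
  have "{x \<in> topspace X. r `` {x} \<in> topspace X // r} = topspace X"
    by (auto simp: quotient_def)
  then show "topspace X // r \<subseteq> topspace (quotient_space X r)"
    by (simp add: openin_quotient_space openin_subset)
qed

lemma quotient_map_quotient_space: "quotient_map X (quotient_space X r) (\<lambda>x. r `` {x})"
  by (auto simp: quotient_map_def openin_quotient_space quotient_def)

text \<open>The space of continuous maps with the compact-open topology. Maps are normalised to be
  \<open>undefined\<close> outside the domain, so that they are determined by their values on it.\<close>

definition mapping_space :: "'a topology \<Rightarrow> 'b topology \<Rightarrow> ('a \<Rightarrow> 'b) topology" where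
  "mapping_space X Y = topology_generated_by
     {{f \<in> extensional (topspace X). continuous_map X Y f \<and> f ` K \<subseteq> U} | K U. compactin X K \<and> openin Y U}"

lemma topspace_mapping_space [simp]:
  "topspace (mapping_space X Y) = {f \<in> extensional (topspace X). continuous_map X Y f}"
proof -
  have "compactin X {} \<and> openin Y {}" by simp
  then have "{f \<in> extensional (topspace X). continuous_map X Y f}
      \<in> {{f \<in> extensional (topspace X). continuous_map X Y f \<and> f ` K \<subseteq> U} | K U. compactin X K \<and> openin Y U}"
    by (intro CollectI exI[of _ "{}"]) simp
  then show ?thesis
    unfolding mapping_space_def topology_generated_by_topspace by blast
qed

definition homotopy_fiber ::
    "'a topology \<Rightarrow> 'b topology \<Rightarrow> ('a \<Rightarrow> 'b) \<Rightarrow> 'b \<Rightarrow> ('a \<times> (real \<Rightarrow> 'b)) topology" where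
  "homotopy_fiber X Y f b =
     subtopology (prod_topology X (mapping_space (top_of_set {0..1}) Y))
       {(x, \<gamma>). \<gamma> 0 = f x \<and> \<gamma> 1 = b}"

subsection \<open>Simplicial sets and their geometric realization\<close>

text \<open>The monotone maps \<open>[m] \<rightarrow> [n]\<close>, where \<open>[n] = {0, \<dots>, n}\<close>; values outside \<open>[m]\<close> are irrelevant.\<close>

definition monotone_maps :: "nat \<Rightarrow> nat \<Rightarrow> (nat \<Rightarrow> nat) set" where
  "monotone_maps m n = {\<theta>. mono_on {..m} \<theta> \<and> \<theta> ` {..m} \<subseteq> {..n}}"

lemma monotone_maps_le:
  "\<theta> \<in> monotone_maps m n \<Longrightarrow> i \<le> j \<Longrightarrow> j \<le> m \<Longrightarrow> \<theta> i \<le> \<theta> j"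
  unfolding monotone_maps_def using mono_onD[of "{..m}" \<theta> i j] by simp

lemma monotone_maps_bound: "\<theta> \<in> monotone_maps m n \<Longrightarrow> i \<le> m \<Longrightarrow> \<theta> i \<le> n"
  by (auto simp: monotone_maps_def)

text \<open>\<open>act X m n \<theta>\<close> is the structure map \<open>X\<^sub>n \<rightarrow> X\<^sub>m\<close> induced by \<open>\<theta> : [m] \<rightarrow> [n]\<close>.\<close>

record 'a sset =
  simps :: "nat \<Rightarrow> 'a set"
  act :: "nat \<Rightarrow> nat \<Rightarrow> (nat \<Rightarrow> nat) \<Rightarrow> 'a \<Rightarrow> 'a"

definition simplicial_set :: "'a sset \<Rightarrow> bool" where
  "simplicial_set X \<longleftrightarrow>
     (\<forall>m n \<theta> x. \<theta> \<in> monotone_maps m n \<longrightarrow> x \<in> simps X n \<longrightarrow> act X m n \<theta> x \<in> simps X m) \<and>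
     (\<forall>m n \<theta> \<theta>' x. \<theta> \<in> monotone_maps m n \<longrightarrow> (\<forall>i\<le>m. \<theta> i = \<theta>' i) \<longrightarrow> x \<in> simps X n \<longrightarrow>
        act X m n \<theta> x = act X m n \<theta>' x) \<and>
     (\<forall>n x. x \<in> simps X n \<longrightarrow> act X n n id x = x) \<and>
     (\<forall>l m n \<phi> \<theta> x. \<phi> \<in> monotone_maps l m \<longrightarrow> \<theta> \<in> monotone_maps m n \<longrightarrow> x \<in> simps X n \<longrightarrow>
        act X l m \<phi> (act X m n \<theta> x) = act X l n (\<theta> \<circ> \<phi>) x)"

text \<open>The affine map \<open>\<Delta>\<^sup>m \<rightarrow> \<Delta>\<^sup>n\<close> sending vertex \<open>i\<close> to vertex \<open>\<theta> i\<close>.\<close>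

definition simplex_push :: "nat \<Rightarrow> (nat \<Rightarrow> nat) \<Rightarrow> (nat \<Rightarrow> real) \<Rightarrow> (nat \<Rightarrow> real)" where
  "simplex_push m \<theta> t = (\<lambda>j. \<Sum>i | i \<le> m \<and> \<theta> i = j. t i)"

text \<open>The coproduct of copies of \<open>\<Delta>\<^sup>n\<close>, one for each \<open>n\<close>-simplex; points are \<open>((n, x), t)\<close>.\<close>

definition simplex_coproduct :: "'a sset \<Rightarrow> ((nat \<times> 'a) \<times> (nat \<Rightarrow> real)) topology" where
  "simplex_coproduct X =
     sum_topology (\<lambda>(n, x). subtopology (powertop_real UNIV) (standard_simplex n))
       (Sigma UNIV (simps X))"

definition glue :: "'a sset \<Rightarrow> (((nat \<times> 'a) \<times> (nat \<Rightarrow> real)) \<times> ((nat \<times> 'a) \<times> (nat \<Rightarrow> real))) set" where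
  "glue X = {(((m, act X m n \<theta> x), t), ((n, x), simplex_push m \<theta> t)) | m n \<theta> x t.
     \<theta> \<in> monotone_maps m n \<and> x \<in> simps X n \<and> t \<in> standard_simplex m}"

definition glue_equiv :: "'a sset \<Rightarrow> (((nat \<times> 'a) \<times> (nat \<Rightarrow> real)) \<times> ((nat \<times> 'a) \<times> (nat \<Rightarrow> real))) set" where
  "glue_equiv X = (glue X \<union> (glue X)\<inverse>)\<^sup>*"

type_synonym 'a realization_point = "((nat \<times> 'a) \<times> (nat \<Rightarrow> real)) set"

definition sset_realization :: "'a sset \<Rightarrow> 'a realization_point topology" where
  "sset_realization X = quotient_space (simplex_coproduct X) (glue_equiv X)"

definition realization_point :: "'a sset \<Rightarrow> nat \<Rightarrow> 'a \<Rightarrow> (nat \<Rightarrow> real) \<Rightarrow> 'a realization_point" where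
  "realization_point X n x t = glue_equiv X `` {((n, x), t)}"

text \<open>For a simplicial subset \<open>X\<close> of \<open>Y\<close>, the map \<open>|X| \<rightarrow> |Y|\<close> induced by the inclusion: all
  representatives of a point \<open>c\<close> of \<open>|X|\<close> lie in the same class of \<open>|Y|\<close>, which the union returns.\<close>

definition realization_inclusion :: "'a sset \<Rightarrow> 'a realization_point \<Rightarrow> 'a realization_point" where
  "realization_inclusion Y c = (\<Union>((n, x), t)\<in>c. realization_point Y n x t)"

subsection \<open>The nerve of a group and its commuting part\<close>

definition nerve_act :: "('a, 'b) monoid_scheme \<Rightarrow> nat \<Rightarrow> (nat \<Rightarrow> nat) \<Rightarrow> 'a list \<Rightarrow> 'a list" where
  "nerve_act G m \<theta> gs =
     map (\<lambda>i. foldr (mult G) (map ((!) gs) [\<theta> i..<\<theta> (Suc i)]) \<one>\<^bsub>G\<^esub>) [0..<m]"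

text \<open>The \<open>n\<close>-simplex \<open>[g\<^sub>1, \<dots>, g\<^sub>n]\<close> is the string \<open>0 \<rightarrow> 1 \<rightarrow> \<dots> \<rightarrow> n\<close> of arrows
  \<open>g\<^sub>1, \<dots>, g\<^sub>n\<close>; the composite arrow \<open>a \<rightarrow> b\<close> is \<open>g\<^bsub>a+1\<^esub> \<dots> g\<^sub>b\<close>. Inner faces
  multiply adjacent entries, outer faces drop an entry, degeneracies insert \<open>\<one>\<close>.\<close>

definition nerve :: "('a, 'b) monoid_scheme \<Rightarrow> 'a list sset" where
  "nerve G = \<lparr>simps = (\<lambda>n. {gs. length gs = n \<and> set gs \<subseteq> carrier G}),
              act = (\<lambda>m n. nerve_act G m)\<rparr>"

definition commuting_nerve :: "('a, 'b) monoid_scheme \<Rightarrow> 'a list sset" where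
  "commuting_nerve G =
     \<lparr>simps = (\<lambda>n. {gs \<in> simps (nerve G) n. \<forall>g\<in>set gs. \<forall>h\<in>set gs. g \<otimes>\<^bsub>G\<^esub> h = h \<otimes>\<^bsub>G\<^esub> g}),
      act = act (nerve G)\<rparr>"

lemma (in group) foldr_mult_closed:
  "set xs \<subseteq> carrier G \<Longrightarrow> foldr (\<otimes>) xs \<one> \<in> carrier G"
  by (induction xs) auto

lemma (in group) foldr_mult_append:
  "set xs \<subseteq> carrier G \<Longrightarrow> set ys \<subseteq> carrier G \<Longrightarrow>
    foldr (\<otimes>) (xs @ ys) \<one> = foldr (\<otimes>) xs \<one> \<otimes> foldr (\<otimes>) ys \<one>"
proof (induction xs)
  case Nil
  then show ?case by (simp add: foldr_mult_closed)
next
  case (Cons x xs)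
  then show ?case by (simp add: foldr_mult_closed m_assoc del: foldr_append)
qed

lemma (in group) nerve_act_in:
  assumes "\<theta> \<in> monotone_maps m n" "length gs = n" "set gs \<subseteq> carrier G"
  shows "length (nerve_act G m \<theta> gs) = m \<and> set (nerve_act G m \<theta> gs) \<subseteq> carrier G"
proof -
  have "foldr (\<otimes>) (map ((!) gs) [\<theta> i..<\<theta> (Suc i)]) \<one> \<in> carrier G" if "i < m" for i
  proof (rule foldr_mult_closed)
    have "\<theta> (Suc i) \<le> n" using assms(1) that by (auto intro: monotone_maps_bound)
    then show "set (map ((!) gs) [\<theta> i..<\<theta> (Suc i)]) \<subseteq> carrier G"
      using assms(2,3) nth_mem by fastforce
  qed
  then show ?thesis by (auto simp: nerve_act_def)
qed

lemma simplicial_set_nerve: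
  fixes G (structure)
  assumes "group G"
  shows "simplicial_set (nerve G)"
proof -
  interpret group G by fact
  show ?thesis
    unfolding simplicial_set_def
  proof (intro conjI allI impI)
    fix m n \<theta> gs
    assume "\<theta> \<in> monotone_maps m n" "gs \<in> simps (nerve G) n"
    then show "act (nerve G) m n \<theta> gs \<in> simps (nerve G) m"
      by (simp add: nerve_def nerve_act_in)
  next
    fix m n and \<theta> \<theta>' :: "nat \<Rightarrow> nat" and gs :: "'a list"
    assume "\<forall>i\<le>m. \<theta> i = \<theta>' i"
    then show "act (nerve G) m n \<theta> gs = act (nerve G) m n \<theta>' gs"
      by (simp add: nerve_def nerve_act_def)
  next
    fix n gs
    assume "gs \<in> simps (nerve G) n"
    then have gs: "length gs = n" "set gs \<subseteq> carrier G" by (auto simp: nerve_def)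
    then have "gs ! i \<in> carrier G" if "i < n" for i
      using that nth_mem by blast
    then show "act (nerve G) n n id gs = gs"
      using gs by (auto simp: nerve_def nerve_act_def intro!: nth_equalityI)
  next
    fix l m n \<phi> \<theta> gs
    assume \<phi>: "\<phi> \<in> monotone_maps l m" and \<theta>: "\<theta> \<in> monotone_maps m n"
      and "gs \<in> simps (nerve G) n"
    then have gs: "length gs = n" "set gs \<subseteq> carrier G" by (auto simp: nerve_def)
    let ?P = "\<lambda>a b. foldr (\<otimes>) (map ((!) gs) [a..<b]) \<one>"
    have split: "?P a b \<otimes> ?P b c = ?P a c" if "a \<le> b" "b \<le> c" "c \<le> n" for a b c
    proof -
      have *: "set (map ((!) gs) [i..<j]) \<subseteq> carrier G" if "j \<le> n" for i j
        using that gs nth_mem by fastforce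
      have "[a..<c] = [a..<b] @ [b..<c]" using that upt_add_eq_append[of a b "c - b"] by simp
      then have "?P a c = foldr (\<otimes>) (map ((!) gs) [a..<b] @ map ((!) gs) [b..<c]) \<one>"
        by (metis map_append)
      also have "\<dots> = ?P a b \<otimes> ?P b c"
        using that by (intro foldr_mult_append *) auto
      finally show ?thesis by simp
    qed
    have mono: "\<theta> i \<le> \<theta> j \<and> \<theta> j \<le> n" if "i \<le> j" "j \<le> m" for i j
      using \<theta> that by (auto intro: monotone_maps_le monotone_maps_bound)
    have tele: "foldr (\<otimes>) (map (\<lambda>j. ?P (\<theta> j) (\<theta> (Suc j))) [a..<a + k]) \<one> = ?P (\<theta> a) (\<theta> (a + k))"
      if "a + k \<le> m" for a k
      using that
    proof (induction k arbitrary: a)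
      case (Suc k)
      have "[a..<a + Suc k] = a # [Suc a..<Suc a + k]" by (subst upt_conv_Cons) auto
      then have "foldr (\<otimes>) (map (\<lambda>j. ?P (\<theta> j) (\<theta> (Suc j))) [a..<a + Suc k]) \<one>
          = ?P (\<theta> a) (\<theta> (Suc a)) \<otimes> ?P (\<theta> (Suc a)) (\<theta> (Suc a + k))"
        using Suc.IH[of "Suc a"] Suc.prems by (simp del: upt_Suc)
      also have "\<dots> = ?P (\<theta> a) (\<theta> (Suc a + k))"
        using Suc.prems mono[of a "Suc a"] mono[of "Suc a" "Suc a + k"] by (intro split) auto
      finally show ?case by simp
    qed simp
    have comp: "foldr (\<otimes>) (map ((!) (nerve_act G m \<theta> gs)) [\<phi> i..<\<phi> (Suc i)]) \<one> = ?P (\<theta> (\<phi> i)) (\<theta> (\<phi> (Suc i)))"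
      if "i < l" for i
    proof -
      have le: "\<phi> i \<le> \<phi> (Suc i)" "\<phi> (Suc i) \<le> m"
        using \<phi> that by (auto intro: monotone_maps_le monotone_maps_bound)
      have eq: "map ((!) (nerve_act G m \<theta> gs)) [\<phi> i..<\<phi> (Suc i)]
          = map (\<lambda>j. ?P (\<theta> j) (\<theta> (Suc j))) [\<phi> i..<\<phi> (Suc i)]"
      proof (rule map_cong[OF refl])
        fix j assume "j \<in> set [\<phi> i..<\<phi> (Suc i)]"
        then have "j < m" using le by auto
        then show "nerve_act G m \<theta> gs ! j = ?P (\<theta> j) (\<theta> (Suc j))" by (simp add: nerve_act_def)
      qed
      have "\<phi> i + (\<phi> (Suc i) - \<phi> i) = \<phi> (Suc i)" using le by simp
      then show ?thesis using tele[of "\<phi> i" "\<phi> (Suc i) - \<phi> i"] le(2) by (simp only: eq)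
    qed
    have "nerve_act G l \<phi> (nerve_act G m \<theta> gs) = nerve_act G l (\<theta> \<circ> \<phi>) gs"
      unfolding nerve_act_def[of G l]
    proof (rule map_cong[OF refl])
      fix i assume "i \<in> set [0..<l]"
      then have "i < l" by simp
      then show "foldr (\<otimes>) (map ((!) (nerve_act G m \<theta> gs)) [\<phi> i..<\<phi> (Suc i)]) \<one>
          = ?P ((\<theta> \<circ> \<phi>) i) ((\<theta> \<circ> \<phi>) (Suc i))"
        unfolding o_apply by (rule comp)
    qed
    then show "act (nerve G) l m \<phi> (act (nerve G) m n \<theta> gs) = act (nerve G) l n (\<theta> \<circ> \<phi>) gs"
      by (simp add: nerve_def)
  qed
qed

lemma simplicial_set_commuting_nerve:
  fixes G (structure)
  assumes "group G"
  shows "simplicial_set (commuting_nerve G)"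
proof -
  interpret group G by fact
  have "nerve_act G m \<theta> gs \<in> simps (commuting_nerve G) m"
    if \<theta>: "\<theta> \<in> monotone_maps m n" and gs: "gs \<in> simps (commuting_nerve G) n" for m n \<theta> gs
  proof -
    have len: "length gs = n" and carr: "set gs \<subseteq> carrier G"
      and comm: "\<And>g h. g \<in> set gs \<Longrightarrow> h \<in> set gs \<Longrightarrow> g \<otimes> h = h \<otimes> g"
      using gs by (auto simp: commuting_nerve_def nerve_def)
    have word: "\<exists>xs. set xs \<subseteq> set gs \<and> g = foldr (\<otimes>) xs \<one>" if g: "g \<in> set (nerve_act G m \<theta> gs)" for g
    proof -
      obtain i where i: "i < m" "g = foldr (\<otimes>) (map ((!) gs) [\<theta> i..<\<theta> (Suc i)]) \<one>"
        using g by (auto simp: nerve_act_def)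
      have "\<theta> (Suc i) \<le> n" using \<theta> i by (auto intro: monotone_maps_bound)
      then have "set (map ((!) gs) [\<theta> i..<\<theta> (Suc i)]) \<subseteq> set gs" using len by auto
      then show ?thesis using i by blast
    qed
    have word_closed: "foldr (\<otimes>) xs \<one> \<in> carrier G" if "set xs \<subseteq> set gs" for xs
      using foldr_mult_closed that carr by blast
    have word_comm: "h \<otimes> foldr (\<otimes>) xs \<one> = foldr (\<otimes>) xs \<one> \<otimes> h"
      if xs: "set xs \<subseteq> set gs" and h: "h \<in> carrier G"
        and hg: "\<And>g. g \<in> set gs \<Longrightarrow> h \<otimes> g = g \<otimes> h" for h xs
      using xs
    proof (induction xs)
      case Nil
      then show ?case using h by simp
    next
      case (Cons x xs)
      have "x \<in> set gs" and xs: "set xs \<subseteq> set gs" using Cons.prems by auto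
      then have x: "x \<in> carrier G" "h \<otimes> x = x \<otimes> h" using carr hg by blast+
      note w = word_closed[OF xs] and IH = Cons.IH[OF xs]
      have "h \<otimes> (x \<otimes> foldr (\<otimes>) xs \<one>) = h \<otimes> x \<otimes> foldr (\<otimes>) xs \<one>"
        using m_assoc[OF h x(1) w] by (rule sym)
      also have "\<dots> = x \<otimes> h \<otimes> foldr (\<otimes>) xs \<one>"
        by (simp only: x(2))
      also have "\<dots> = x \<otimes> (h \<otimes> foldr (\<otimes>) xs \<one>)"
        by (rule m_assoc[OF x(1) h w])
      also have "\<dots> = x \<otimes> (foldr (\<otimes>) xs \<one> \<otimes> h)"
        by (simp only: IH)
      also have "\<dots> = x \<otimes> foldr (\<otimes>) xs \<one> \<otimes> h"
        using m_assoc[OF x(1) w h] by (rule sym)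
      finally show ?case by simp
    qed
    have "g \<otimes> h = h \<otimes> g"
      if gh: "g \<in> set (nerve_act G m \<theta> gs)" "h \<in> set (nerve_act G m \<theta> gs)" for g h
    proof -
      obtain xs where xs: "set xs \<subseteq> set gs" "g = foldr (\<otimes>) xs \<one>" using word[OF gh(1)] by blast
      obtain ys where ys: "set ys \<subseteq> set gs" "h = foldr (\<otimes>) ys \<one>" using word[OF gh(2)] by blast
      have "x \<otimes> h = h \<otimes> x" if "x \<in> set gs" for x
        unfolding ys(2) by (rule word_comm[OF ys(1)]) (use that carr comm in blast)+
      then have "h \<otimes> g = g \<otimes> h"
        unfolding xs(2) by (intro word_comm xs(1)) (simp_all add: ys word_closed)
      then show ?thesis by (rule sym)
    qed
    moreover have "nerve_act G m \<theta> gs \<in> simps (nerve G) m"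
      using nerve_act_in[OF \<theta> len carr] by (simp add: nerve_def)
    ultimately show ?thesis unfolding commuting_nerve_def by simp
  qed
  moreover have "act (commuting_nerve G) = act (nerve G)" "act (nerve G) = (\<lambda>m n. nerve_act G m)"
    by (simp_all add: commuting_nerve_def nerve_def)
  moreover have "x \<in> simps (nerve G) n" if "x \<in> simps (commuting_nerve G) n" for x n
    using that by (simp add: commuting_nerve_def)
  ultimately have *: "act (commuting_nerve G) = act (nerve G)"
    "\<And>x n. x \<in> simps (commuting_nerve G) n \<Longrightarrow> x \<in> simps (nerve G) n"
    "\<And>m n \<theta> x. \<theta> \<in> monotone_maps m n \<Longrightarrow> x \<in> simps (commuting_nerve G) n \<Longrightarrow>
      act (nerve G) m n \<theta> x \<in> simps (commuting_nerve G) m"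
    by simp_all
  note nerve = simplicial_set_nerve[OF assms, unfolded simplicial_set_def]
  show ?thesis
    unfolding simplicial_set_def *(1)
  proof (intro conjI allI impI)
    fix m n \<theta> gs
    assume "\<theta> \<in> monotone_maps m n" "gs \<in> simps (commuting_nerve G) n"
    then show "act (nerve G) m n \<theta> gs \<in> simps (commuting_nerve G) m" by (rule *(3))
  next
    fix m n and \<theta> \<theta>' :: "nat \<Rightarrow> nat" and gs :: "'a list"
    assume "\<theta> \<in> monotone_maps m n" "\<forall>i\<le>m. \<theta> i = \<theta>' i" "gs \<in> simps (commuting_nerve G) n"
    then show "act (nerve G) m n \<theta> gs = act (nerve G) m n \<theta>' gs"
      by (intro nerve[THEN conjunct2, THEN conjunct1, rule_format] *(2)) auto
  next
    fix n gs
    assume "gs \<in> simps (commuting_nerve G) n"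
    then show "act (nerve G) n n id gs = gs"
      by (intro nerve[THEN conjunct2, THEN conjunct2, THEN conjunct1, rule_format] *(2))
  next
    fix l m n \<phi> \<theta> gs
    assume "\<phi> \<in> monotone_maps l m" "\<theta> \<in> monotone_maps m n" "gs \<in> simps (commuting_nerve G) n"
    then show "act (nerve G) l m \<phi> (act (nerve G) m n \<theta> gs) = act (nerve G) l n (\<theta> \<circ> \<phi>) gs"
      by (intro nerve[THEN conjunct2, THEN conjunct2, THEN conjunct2, rule_format] *(2))
  qed
qed

definition classifying_space :: "('a, 'b) monoid_scheme \<Rightarrow> 'a list realization_point topology" where
  "classifying_space G = sset_realization (nerve G)"

definition B_com :: "('a, 'b) monoid_scheme \<Rightarrow> 'a list realization_point topology" where
  "B_com G = sset_realization (commuting_nerve G)"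

definition B_com_inclusion :: "('a, 'b) monoid_scheme \<Rightarrow> 'a list realization_point \<Rightarrow> 'a list realization_point" where
  "B_com_inclusion G = realization_inclusion (nerve G)"

text \<open>The base point of \<open>BG\<close> is its unique vertex.\<close>

definition classifying_base :: "('a, 'b) monoid_scheme \<Rightarrow> 'a list realization_point" where
  "classifying_base G = realization_point (nerve G) 0 [] (\<lambda>i. if i = 0 then 1 else 0)"

definition E_com ::
    "('a, 'b) monoid_scheme \<Rightarrow> ('a list realization_point \<times> (real \<Rightarrow> 'a list realization_point)) topology" where
  "E_com G = homotopy_fiber (B_com G) (classifying_space G) (B_com_inclusion G) (classifying_base G)"

subsection \<open>Abstract simplicial complexes and affinely commutative sets\<close>

text \<open>An abstract simplicial complex is given by its set of simplices; its vertices are the elements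
  of their union.\<close>

definition abstract_simplicial_complex :: "'a set set \<Rightarrow> bool" where
  "abstract_simplicial_complex K \<longleftrightarrow>
     (\<forall>S\<in>K. finite S \<and> S \<noteq> {}) \<and> (\<forall>S\<in>K. \<forall>T\<subseteq>S. T \<noteq> {} \<longrightarrow> T \<in> K)"

definition geometric_simplex :: "'a set \<Rightarrow> ('a \<Rightarrow> real) set" where
  "geometric_simplex S = {t. (\<forall>v. 0 \<le> t v) \<and> (\<forall>v. v \<notin> S \<longrightarrow> t v = 0) \<and> sum t S = 1}"

text \<open>The realization carries the weak topology: a set is open iff its intersection with every closed
  simplex is open in the Euclidean topology of that simplex.\<close>

definition complex_realization :: "'a set set \<Rightarrow> ('a \<Rightarrow> real) topology" where
  "complex_realization K = topology (\<lambda>U. U \<subseteq> (\<Union>S\<in>K. geometric_simplex S) \<and>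
     (\<forall>S\<in>K. openin (subtopology (powertop_real UNIV) (geometric_simplex S)) (U \<inter> geometric_simplex S)))"

lemma openin_complex_realization:
  fixes K :: "'a set set"
  shows "openin (complex_realization K) U \<longleftrightarrow> U \<subseteq> (\<Union>S\<in>K. geometric_simplex S) \<and>
     (\<forall>S\<in>K. openin (subtopology (powertop_real UNIV) (geometric_simplex S)) (U \<inter> geometric_simplex S))"
proof -
  let ?op = "\<lambda>S :: 'a set. openin (subtopology (powertop_real UNIV) (geometric_simplex S))"
  let ?P = "\<lambda>U. U \<subseteq> (\<Union>S\<in>K. geometric_simplex S) \<and> (\<forall>S\<in>K. ?op S (U \<inter> geometric_simplex S))"
  have "istopology ?P"
    unfolding istopology_def
  proof (intro conjI allI impI ballI)
    fix U V S assume UV: "?P U" "?P V" and S: "S \<in> K"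
    have "U \<inter> V \<inter> geometric_simplex S = (U \<inter> geometric_simplex S) \<inter> (V \<inter> geometric_simplex S)"
      by blast
    then show "?op S (U \<inter> V \<inter> geometric_simplex S)"
      using openin_Int[OF UV(1)[THEN conjunct2, rule_format, OF S] UV(2)[THEN conjunct2, rule_format, OF S]]
      by (simp only:)
  next
    fix \<U> S assume \<U>: "\<forall>U\<in>\<U>. ?P U" and S: "S \<in> K"
    have "\<Union>\<U> \<inter> geometric_simplex S = \<Union>((\<lambda>U. U \<inter> geometric_simplex S) ` \<U>)" by blast
    moreover have "?op S (\<Union>((\<lambda>U. U \<inter> geometric_simplex S) ` \<U>))"
      by (rule openin_Union) (use \<U> S in blast)
    ultimately show "?op S (\<Union>\<U> \<inter> geometric_simplex S)" by (simp only:)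
  qed blast+
  then show ?thesis by (simp only: complex_realization_def topology_inverse')
qed

lemma topspace_complex_realization [simp]:
  "topspace (complex_realization K) = (\<Union>S\<in>K. geometric_simplex S)"
proof
  show "topspace (complex_realization K) \<subseteq> (\<Union>S\<in>K. geometric_simplex S)"
    using openin_topspace[of "complex_realization K"] unfolding openin_complex_realization by (rule conjunct1)
  have "openin (subtopology (powertop_real UNIV) (geometric_simplex T))
      ((\<Union>S\<in>K. geometric_simplex S) \<inter> geometric_simplex T)" if "T \<in> K" for T
  proof -
    have "(\<Union>S\<in>K. geometric_simplex S) \<inter> geometric_simplex T
        = topspace (subtopology (powertop_real UNIV) (geometric_simplex T))"
      using that by (simp only: topspace_subtopology topspace_product_topology) fastforce
    then show ?thesis by (simp only: openin_topspace)
  qed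
  then have "openin (complex_realization K) (\<Union>S\<in>K. geometric_simplex S)"
    unfolding openin_complex_realization by blast
  then show "(\<Union>S\<in>K. geometric_simplex S) \<subseteq> topspace (complex_realization K)"
    by (rule openin_subset)
qed

definition affinely_commutative :: "('a, 'b) monoid_scheme \<Rightarrow> 'a set \<Rightarrow> bool" where
  "affinely_commutative G S \<longleftrightarrow> finite S \<and> S \<noteq> {} \<and>
     (\<exists>A g. subgroup A G \<and> comm_group (G\<lparr>carrier := A\<rparr>) \<and> g \<in> carrier G \<and> S \<subseteq> g <#\<^bsub>G\<^esub> A)"

definition AfCom :: "('a, 'b) monoid_scheme \<Rightarrow> 'a set set" where
  "AfCom G = {S. affinely_commutative G S}"

lemma abstract_simplicial_complex_AfCom: "abstract_simplicial_complex (AfCom G)"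
proof -
  have "affinely_commutative G T" if S: "affinely_commutative G S" "T \<subseteq> S" "T \<noteq> {}" for S T
  proof -
    obtain A g where "subgroup A G" "comm_group (G\<lparr>carrier := A\<rparr>)" "g \<in> carrier G" "S \<subseteq> g <#\<^bsub>G\<^esub> A"
      using S unfolding affinely_commutative_def by blast
    then show ?thesis
      unfolding affinely_commutative_def using S
      by (intro conjI exI[of _ A] exI[of _ g]) (auto simp: affinely_commutative_def intro: finite_subset)
  qed
  moreover have "finite S \<and> S \<noteq> {}" if "affinely_commutative G S" for S
    using that by (simp add: affinely_commutative_def)
  ultimately show ?thesis
    unfolding abstract_simplicial_complex_def AfCom_def by blast
qed

lemma Union_AfCom:
  fixes G (structure)
  assumes "group G"
  shows "\<Union>(AfCom G) = carrier G"
proof -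
  interpret group G by fact
  have "affinely_commutative G {g}" if "g \<in> carrier G" for g
  proof -
    have sub: "subgroup {\<one>\<^bsub>G\<^esub>} G" by (rule triv_subgroup)
    have "group (G\<lparr>carrier := {\<one>\<^bsub>G\<^esub>}\<rparr>)" using sub by (rule subgroup_imp_group)
    then have "comm_group (G\<lparr>carrier := {\<one>\<^bsub>G\<^esub>}\<rparr>)" by (rule group.group_comm_groupI) simp
    moreover have "{g} \<subseteq> g <#\<^bsub>G\<^esub> {\<one>\<^bsub>G\<^esub>}" using that by (auto simp: l_coset_def)
    ultimately show ?thesis unfolding affinely_commutative_def using sub that
      by (intro conjI exI[of _ "{\<one>\<^bsub>G\<^esub>}"] exI[of _ g]) simp_all
  qed
  moreover have "S \<subseteq> carrier G" if S: "affinely_commutative G S" for S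
  proof -
    obtain A g where "subgroup A G" "g \<in> carrier G" "S \<subseteq> g <#\<^bsub>G\<^esub> A"
      using S unfolding affinely_commutative_def by blast
    then show ?thesis using l_coset_subset_G[of A g] subgroup.subset[of A G] by simp
  qed
  ultimately show ?thesis by (auto simp: AfCom_def)
qed

end

theory Submission
  imports Defs "HOL-Analysis.Analysis"
begin

text \<open>For a translation-invariant complex \<open>K\<close> on \<open>G\<close>, let \<open>T K\<close> be the simplicial set of tuples
  \<open>(g\<^sub>0, \<dots>, g\<^sub>n)\<close> with \<open>{g\<^sub>0, \<dots>, g\<^sub>n} \<in> K\<close>. Taking consecutive quotients \<open>g\<^sub>i\<inverse>g\<^sub>i\<^sub>+\<^sub>1\<close> identifies
  \<open>T K / G\<close> with the nerve of \<open>G\<close> if \<open>K\<close> consists of all finite sets, so that \<open>|T K| = EG\<close>, and with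
  its commuting part if \<open>K = AfCom(G)\<close>. Both maps \<open>|T K| \<rightarrow> |T K / G|\<close> are coverings with group \<open>G\<close>, so a
  point of the homotopy fibre, a point \<open>x\<close> of \<open>B\<^sub>c\<^sub>o\<^sub>mG\<close> with a path in \<open>BG\<close> to the base point, determines by
  path lifting a point of \<open>|T AfCom(G)|\<close> over \<open>x\<close>. The cone contraction of \<open>EG\<close> provides the homotopy
  inverse. Finally \<open>|T K| \<simeq> |K|\<close> for every complex \<open>K\<close>: a total order of the vertices gives a section of
  \<open>|T K| \<rightarrow> |K|\<close>, and the tuple \<open>(g\<^sub>0, \<dots>, g\<^sub>n)\<close> is joined to the ordered list of its entries inside \<open>T K\<close>.\<close>

text \<open>Ordered tuples are needed because \<open>G\<close> need not act freely on
  \<open>|K|\<close>: an element of finite order fixes the barycentre of the cyclic subgroup that it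
  generates, and this subgroup is a simplex of \<open>AfCom G\<close>. On tuples, translation by a
  non-identity element changes every entry. Evenly covered neighbourhoods are never constructed.
  Three facts replace them: \<open>proj\<close> is open, its fibres are \<open>G\<close>-orbits, and
  there is a distance with open balls for which distinct points of a fibre are exactly 1 apart. This
  distance need not induce the weak topology, so it controls only which sheet a point lies on;
  continuity within a sheet comes from openness of \<open>proj\<close>. The inclusion of
  \<open>|T AfCom(G)|\<close> into \<open>EG\<close> commutes with \<open>G\<close> and preserves
  the distance. This exhibits \<open>|T AfCom(G)|\<close>, as far as the proof requires, as the
  pullback of \<open>EG\<close> along the map from the commuting part to \<open>BG\<close>. Since
  the paths in the homotopy fibre end at the base point, lifts are fixed at parameter 1 and it is
  their value at 0 that is read off.\<close>

abbreviation simplex_topology :: "nat \<Rightarrow> (nat \<Rightarrow> real) topology" where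
  "simplex_topology n \<equiv> subtopology (powertop_real UNIV) (standard_simplex n)"

abbreviation unit_interval :: "real topology" where
  "unit_interval \<equiv> top_of_set {0..1}"

subsection \<open>Maps out of a geometric realization\<close>

lemma equiv_glue_equiv: "equiv UNIV (glue_equiv X)"
  unfolding glue_equiv_def
  by (intro equivI refl_rtrancl trans_rtrancl sym_rtrancl) (auto simp: sym_def)

lemma realization_point_eq_iff:
  "realization_point X n x t = realization_point X n' x' t' \<longleftrightarrow> (((n, x), t), ((n', x'), t')) \<in> glue_equiv X"
  unfolding realization_point_def by (rule eq_equiv_class_iff[OF equiv_glue_equiv]) auto

lemma realization_point_act:
  assumes "\<theta> \<in> monotone_maps m n" "x \<in> simps X n" "t \<in> standard_simplex m"
  shows "realization_point X m (act X m n \<theta> x) t = realization_point X n x (simplex_push m \<theta> t)"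
proof -
  have "(((m, act X m n \<theta> x), t), ((n, x), simplex_push m \<theta> t)) \<in> glue X"
    unfolding glue_def using assms by blast
  then show ?thesis
    unfolding realization_point_eq_iff glue_equiv_def by blast
qed

definition glue_invariant :: "'x sset \<Rightarrow> (nat \<Rightarrow> 'x \<Rightarrow> (nat \<Rightarrow> real) \<Rightarrow> 'b) \<Rightarrow> bool" where
  "glue_invariant X f \<longleftrightarrow> (\<forall>m n \<theta> x t. \<theta> \<in> monotone_maps m n \<longrightarrow> x \<in> simps X n \<longrightarrow>
     t \<in> standard_simplex m \<longrightarrow> f m (act X m n \<theta> x) t = f n x (simplex_push m \<theta> t))"

lemma glue_invariantI:
  assumes "\<And>m n \<theta> x t. \<theta> \<in> monotone_maps m n \<Longrightarrow> x \<in> simps X n \<Longrightarrow>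
     t \<in> standard_simplex m \<Longrightarrow> f m (act X m n \<theta> x) t = f n x (simplex_push m \<theta> t)"
  shows "glue_invariant X f"
  using assms unfolding glue_invariant_def by blast

text \<open>Equal points are joined by a finite zigzag of elementary gluings, so induction along the
  zigzag reduces well-definedness to the generators.\<close>

lemma glue_invariantD:
  assumes inv: "glue_invariant X f"
    and eq: "realization_point X n x t = realization_point X n' x' t'"
  shows "f n x t = f n' x' t'"
proof -
  have "(((n, x), t), ((n', x'), t')) \<in> (glue X \<union> (glue X)\<inverse>)\<^sup>*"
    using eq unfolding realization_point_eq_iff glue_equiv_def .
  then have "(case ((n, x), t) of ((n, x), t) \<Rightarrow> f n x t) = (case ((n', x'), t') of ((n, x), t) \<Rightarrow> f n x t)"
  proof (induction rule: rtrancl_induct)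
    case (step y z)
    then show ?case
      using inv unfolding glue_invariant_def glue_def by fastforce
  qed simp
  then show ?thesis by simp
qed

lemma in_topspace_realization:
  "c \<in> topspace (sset_realization X) \<longleftrightarrow>
     (\<exists>n x t. x \<in> simps X n \<and> t \<in> standard_simplex n \<and> c = realization_point X n x t)"
  unfolding sset_realization_def topspace_quotient_space simplex_coproduct_def realization_point_def quotient_def
  by (auto simp: o_def; force)

lemma realization_point_in [simp]:
  "x \<in> simps X n \<Longrightarrow> t \<in> standard_simplex n \<Longrightarrow> realization_point X n x t \<in> topspace (sset_realization X)"
  unfolding in_topspace_realization by blast

text \<open>The quotient and the coproduct topology are unfolded together, leaving only the
  characteristic maps of single simplices. Openness and continuity out of the realization can then
  be tested one simplex at a time.\<close>

lemma openin_realization: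
  "openin (sset_realization X) U \<longleftrightarrow> U \<subseteq> topspace (sset_realization X) \<and>
     (\<forall>n. \<forall>x\<in>simps X n. openin (simplex_topology n) {t \<in> standard_simplex n. realization_point X n x t \<in> U})"
proof -
  have eq: "{t. ((n, x), t) \<in> {z \<in> topspace (simplex_coproduct X). glue_equiv X `` {z} \<in> U}}
      = {t \<in> standard_simplex n. realization_point X n x t \<in> U}" if "x \<in> simps X n" for n x
    using that by (auto simp: simplex_coproduct_def realization_point_def)
  have "openin (simplex_coproduct X) {z \<in> topspace (simplex_coproduct X). glue_equiv X `` {z} \<in> U} \<longleftrightarrow>
     (\<forall>n. \<forall>x\<in>simps X n. openin (simplex_topology n) {t \<in> standard_simplex n. realization_point X n x t \<in> U})"
    (is "openin _ ?S \<longleftrightarrow> _")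
  proof -
    have "?S \<subseteq> Sigma (Sigma UNIV (simps X)) (topspace \<circ> (\<lambda>(n, x). simplex_topology n))"
      by (auto simp: simplex_coproduct_def)
    then have "openin (simplex_coproduct X) ?S \<longleftrightarrow> (\<forall>i\<in>Sigma UNIV (simps X). 
       openin (case i of (n, x) \<Rightarrow> simplex_topology n) {t. (i, t) \<in> ?S})"
      unfolding simplex_coproduct_def openin_sum_topology by blast
    also have "\<dots> \<longleftrightarrow> (\<forall>n. \<forall>x\<in>simps X n. openin (simplex_topology n) {t. ((n, x), t) \<in> ?S})"
      by auto
    also have "\<dots> \<longleftrightarrow> (\<forall>n. \<forall>x\<in>simps X n. openin (simplex_topology n)
        {t \<in> standard_simplex n. realization_point X n x t \<in> U})"
      using eq by simp
    finally show ?thesis .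
  qed
  then show ?thesis
    unfolding sset_realization_def openin_quotient_space topspace_quotient_space by simp
qed

lemma continuous_map_realization_point:
  assumes "x \<in> simps X n"
  shows "continuous_map (simplex_topology n) (sset_realization X) (realization_point X n x)"
  unfolding continuous_map_def
  using assms by (auto simp: openin_realization)

lemma continuous_map_realization:
  assumes "\<And>n x. x \<in> simps X n \<Longrightarrow> continuous_map (simplex_topology n) Y (\<lambda>t. F (realization_point X n x t))"
  shows "continuous_map (sset_realization X) Y F"
  unfolding continuous_map_def
proof (intro conjI allI impI)
  show "F \<in> topspace (sset_realization X) \<rightarrow> topspace Y"
    using assms unfolding continuous_map_def by (force simp: in_topspace_realization Pi_iff)
  fix U assume U: "openin Y U"
  have "{t \<in> standard_simplex n. realization_point X n x t \<in> {c \<in> topspace (sset_realization X). F c \<in> U}}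
      = {t \<in> topspace (simplex_topology n). F (realization_point X n x t) \<in> U}" if "x \<in> simps X n" for n x
    using that by auto
  then show "openin (sset_realization X) {c \<in> topspace (sset_realization X). F c \<in> U}"
    using assms U by (auto simp: openin_realization continuous_map_def)
qed

text \<open>Each summand is open in the disjoint union, so a box neighbourhood found in
  \<open>prod_topology Z (A i)\<close> is still one in the whole product.\<close>

lemma continuous_map_prod_sum_topology:
  assumes "\<And>i. i \<in> I \<Longrightarrow> continuous_map (prod_topology Z (A i)) Y (\<lambda>(z, a). F (z, (i, a)))"
  shows "continuous_map (prod_topology Z (sum_topology A I)) Y F"
  unfolding continuous_map_def
proof (intro conjI allI impI)
  show "F \<in> topspace (prod_topology Z (sum_topology A I)) \<rightarrow> topspace Y"
    using assms unfolding continuous_map_def by (fastforce simp: Pi_iff)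
  fix U assume U: "openin Y U"
  show "openin (prod_topology Z (sum_topology A I)) {x \<in> topspace (prod_topology Z (sum_topology A I)). F x \<in> U}"
    unfolding openin_prod_topology_alt
  proof (intro allI impI)
    fix z w assume "(z, w) \<in> {x \<in> topspace (prod_topology Z (sum_topology A I)). F x \<in> U}"
    moreover obtain i a where w: "w = (i, a)" by force
    ultimately have *: "z \<in> topspace Z" "i \<in> I" "a \<in> topspace (A i)" "F (z, (i, a)) \<in> U" by auto
    have "openin (prod_topology Z (A i)) {x \<in> topspace (prod_topology Z (A i)). (\<lambda>(z, a). F (z, (i, a))) x \<in> U}"
      using assms[OF \<open>i \<in> I\<close>] U by (auto simp: continuous_map_def)
    then obtain V W where VW: "openin Z V" "openin (A i) W" "z \<in> V" "a \<in> W"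
        "V \<times> W \<subseteq> {x \<in> topspace (prod_topology Z (A i)). (\<lambda>(z, a). F (z, (i, a))) x \<in> U}"
      unfolding openin_prod_topology_alt using *
      by (smt (verit, best) SigmaI case_prod_conv mem_Collect_eq topspace_prod_topology)
    have "{a. (j, a) \<in> {i} \<times> W} = (if j = i then W else {})" for j by auto
    then have "openin (sum_topology A I) ({i} \<times> W)"
      using VW openin_subset[OF VW(2)] \<open>i \<in> I\<close> by (auto simp: openin_sum_topology)
    then show "\<exists>V W. openin Z V \<and> openin (sum_topology A I) W \<and> z \<in> V \<and> w \<in> W \<and>
        V \<times> W \<subseteq> {x \<in> topspace (prod_topology Z (sum_topology A I)). F x \<in> U}"
      using VW \<open>i \<in> I\<close> w by (intro exI[of _ V] exI[of _ "{i} \<times> W"]) force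
  qed
qed

text \<open>A quotient map stays a quotient map after taking the product with a locally compact
  Hausdorff space. For the unit interval this allows homotopies to be checked simplex by
  simplex.\<close>

lemma continuous_map_prod_realization:
  assumes Z: "locally_compact_space Z" "Hausdorff_space Z"
    and cont: "\<And>n x. x \<in> simps X n \<Longrightarrow>
      continuous_map (prod_topology Z (simplex_topology n)) Y (\<lambda>(z, t). F (z, realization_point X n x t))"
  shows "continuous_map (prod_topology Z (sset_realization X)) Y F"
proof -
  let ?q = "\<lambda>(z, w). (z, glue_equiv X `` {w})"
  have q: "quotient_map (prod_topology Z (simplex_coproduct X)) (prod_topology Z (sset_realization X)) ?q"
    unfolding sset_realization_def
    by (intro quotient_map_prod_right quotient_map_quotient_space) (use Z in auto)
  have "continuous_map (prod_topology Z (simplex_coproduct X)) Y (F \<circ> ?q)"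
    unfolding simplex_coproduct_def
    by (rule continuous_map_prod_sum_topology) (use cont in \<open>auto simp: realization_point_def\<close>)
  then show ?thesis
    using continuous_compose_quotient_map[OF q] by blast
qed

lemma continuous_map_unit_interval_prod_realization:
  assumes "\<And>n x. x \<in> simps X n \<Longrightarrow>
      continuous_map (prod_topology unit_interval (simplex_topology n)) Y (\<lambda>(z, t). F (z, realization_point X n x t))"
  shows "continuous_map (prod_topology unit_interval (sset_realization X)) Y F"
proof (rule continuous_map_prod_realization[OF _ _ assms])
  have "compact_space unit_interval" by (simp add: compact_space_subtopology)
  then show "locally_compact_space unit_interval" by (rule compact_imp_locally_compact_space)
  show "Hausdorff_space unit_interval" by (simp add: Hausdorff_space_subtopology)
qed

text \<open>Evaluation on an arbitrarily chosen representative; the value is independent of the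
  choice once \<open>f\<close> is \<open>glue_invariant\<close>.\<close>

definition realization_rec :: "'x sset \<Rightarrow> (nat \<Rightarrow> 'x \<Rightarrow> (nat \<Rightarrow> real) \<Rightarrow> 'b) \<Rightarrow> 'x realization_point \<Rightarrow> 'b" where
  "realization_rec X f c = (SOME v. \<exists>n x t. x \<in> simps X n \<and> t \<in> standard_simplex n \<and>
     c = realization_point X n x t \<and> v = f n x t)"

lemma realization_rec_point:
  assumes "glue_invariant X f" "x \<in> simps X n" "t \<in> standard_simplex n"
  shows "realization_rec X f (realization_point X n x t) = f n x t"
  unfolding realization_rec_def
  by (rule some_equality) (use assms glue_invariantD[OF assms(1)] in blast)+

subsection \<open>Standard simplices\<close>

text \<open>Taking \<open>J\<close> to be all indices gives the total mass, a fibre of a tuple gives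
  vertex weights, and an initial segment gives the partial sums behind step functions.\<close>

lemma sum_simplex_push:
  assumes "\<theta> ` {..m} \<subseteq> {..n}" "J \<subseteq> {..n}"
  shows "sum (simplex_push m \<theta> t) J = (\<Sum>i | i \<le> m \<and> \<theta> i \<in> J. t i)"
proof -
  have fin: "finite J" using assms(2) finite_subset by blast
  have "sum (simplex_push m \<theta> t) J = (\<Sum>j\<in>J. \<Sum>i | i \<in> {i. i \<le> m \<and> \<theta> i \<in> J} \<and> \<theta> i = j. t i)"
    unfolding simplex_push_def by (intro sum.cong refl) (auto intro: arg_cong[where f = "sum t"])
  also have "\<dots> = (\<Sum>i | i \<le> m \<and> \<theta> i \<in> J. t i)"
    by (rule sum.group) (use fin in auto)
  finally show ?thesis .
qed

lemma simplex_push_in_simplex: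
  assumes "\<theta> ` {..m} \<subseteq> {..n}" "t \<in> standard_simplex m"
  shows "simplex_push m \<theta> t \<in> standard_simplex n"
proof -
  have nn: "0 \<le> simplex_push m \<theta> t j" for j
    using assms(2) unfolding simplex_push_def standard_simplex_def by (auto intro: sum_nonneg)
  have tot: "sum (simplex_push m \<theta> t) {..n} = 1"
  proof -
    have "{i. i \<le> m \<and> \<theta> i \<in> {..n}} = {..m}" using assms(1) by auto
    then show ?thesis
      using sum_simplex_push[OF assms(1), of "{..n}" t] assms(2) by (simp add: standard_simplex_def)
  qed
  have zero: "simplex_push m \<theta> t j = 0" if "j > n" for j
  proof -
    have "{i. i \<le> m \<and> \<theta> i = j} = {}" using assms(1) that by force
    then show ?thesis unfolding simplex_push_def by (simp only: sum.empty)
  qed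
  have "simplex_push m \<theta> t j \<le> 1" for j
  proof (cases "j \<le> n")
    case True
    then have "simplex_push m \<theta> t j \<le> sum (simplex_push m \<theta> t) {..n}"
      using nn by (intro member_le_sum) auto
    then show ?thesis using tot by simp
  qed (simp add: zero)
  then show ?thesis unfolding standard_simplex_def using nn tot zero by auto
qed

lemma monotone_maps_image: "\<theta> \<in> monotone_maps m n \<Longrightarrow> \<theta> ` {..m} \<subseteq> {..n}"
  by (simp add: monotone_maps_def)

lemma monotone_mapsI:
  "(\<And>i j. i \<le> j \<Longrightarrow> j \<le> m \<Longrightarrow> \<theta> i \<le> \<theta> j) \<Longrightarrow> (\<And>i. i \<le> m \<Longrightarrow> \<theta> i \<le> n) \<Longrightarrow> \<theta> \<in> monotone_maps m n"
  by (auto simp: monotone_maps_def intro!: mono_onI)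

lemma continuous_map_simplex_coordinate:
  "continuous_map (simplex_topology n) euclideanreal (\<lambda>t. t i)"
  by (intro continuous_map_from_subtopology continuous_map_product_projection) auto

lemma continuous_map_into_simplex:
  assumes "\<And>x i. x \<in> topspace W \<Longrightarrow> f x \<in> standard_simplex n"
    and "\<And>i. continuous_map W euclideanreal (\<lambda>x. f x i)"
  shows "continuous_map W (simplex_topology n) f"
  using assms by (auto simp: continuous_map_in_subtopology continuous_map_componentwise_UNIV)

subsection \<open>Simplicial sets of tuples\<close>

text \<open>Tuples are extensional functions, so equality of tuples is equality of functions. Only
  the set of entries has to be a simplex: repetitions are allowed in any position.\<close>

definition tuple_sset :: "'a set set \<Rightarrow> (nat \<Rightarrow> 'a) sset" where
  "tuple_sset K = \<lparr>simps = (\<lambda>n. {g \<in> extensional {..n}. g ` {..n} \<in> K}),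
     act = (\<lambda>m n \<theta> g. restrict (g \<circ> \<theta>) {..m})\<rparr>"

lemma simps_tuple: "g \<in> simps (tuple_sset K) n \<longleftrightarrow> g \<in> extensional {..n} \<and> g ` {..n} \<in> K"
  by (simp add: tuple_sset_def)

lemma act_tuple [simp]: "act (tuple_sset K) m n \<theta> g = restrict (g \<circ> \<theta>) {..m}"
  by (simp add: tuple_sset_def)

lemma act_tuple_in:
  assumes "abstract_simplicial_complex K" "\<theta> ` {..m} \<subseteq> {..n}" "g \<in> simps (tuple_sset K) n"
  shows "restrict (g \<circ> \<theta>) {..m} \<in> simps (tuple_sset K) m"
proof -
  have "restrict (g \<circ> \<theta>) {..m} ` {..m} \<subseteq> g ` {..n}" using assms(2) by force
  moreover have "restrict (g \<circ> \<theta>) {..m} ` {..m} \<noteq> {}" by auto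
  ultimately show ?thesis
    using assms unfolding abstract_simplicial_complex_def simps_tuple by (meson restrict_extensional)
qed

lemmas tuple_point_act = realization_point_act[of _ _ _ _ "tuple_sset K" for K, unfolded act_tuple]

section \<open>Joins of tuples and of barycentric coordinates\<close>

definition tuple_join :: "nat \<Rightarrow> nat \<Rightarrow> (nat \<Rightarrow> 'a) \<Rightarrow> (nat \<Rightarrow> 'a) \<Rightarrow> nat \<Rightarrow> 'a" where
  "tuple_join m n g h = restrict (\<lambda>i. if i \<le> m then g i else h (i - Suc m)) {..Suc (m + n)}"

text \<open>The point at time \<open>u\<close> on the segment from \<open>t\<close> on the front
  face to \<open>t'\<close> on the back face. The blocks have \<open>m + 1\<close> and
  \<open>n + 1\<close> vertices, so the second starts at \<open>Suc m\<close> and the joined simplex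
  has dimension \<open>Suc (m + n)\<close>.\<close>

definition simplex_join :: "nat \<Rightarrow> real \<Rightarrow> (nat \<Rightarrow> real) \<Rightarrow> (nat \<Rightarrow> real) \<Rightarrow> nat \<Rightarrow> real" where
  "simplex_join m u t t' = (\<lambda>i. if i \<le> m then (1 - u) * t i else u * t' (i - Suc m))"

lemma tuple_join_image: "tuple_join m n g h ` {..Suc (m + n)} = g ` {..m} \<union> h ` {..n}"
proof -
  have "h i = tuple_join m n g h (Suc (m + i))" "Suc (m + i) \<in> {..Suc (m + n)}" if "i \<le> n" for i
    using that by (auto simp: tuple_join_def)
  moreover have "g i = tuple_join m n g h i" "i \<in> {..Suc (m + n)}" if "i \<le> m" for i
    using that by (auto simp: tuple_join_def)
  ultimately have "g ` {..m} \<union> h ` {..n} \<subseteq> tuple_join m n g h ` {..Suc (m + n)}" by fast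
  moreover have "tuple_join m n g h i \<in> g ` {..m} \<union> h ` {..n}" if "i \<le> Suc (m + n)" for i
    using that by (auto simp: tuple_join_def)
  ultimately show ?thesis by auto
qed

lemma simps_tuple_join:
  "g ` {..m} \<union> h ` {..n} \<in> K \<Longrightarrow> tuple_join m n g h \<in> simps (tuple_sset K) (Suc (m + n))"
  unfolding simps_tuple tuple_join_image by (simp add: tuple_join_def)

lemma sum_atMost_join: "sum f {..Suc (m + n)} = sum f {..m} + (\<Sum>i\<le>n. f (Suc (m + i)))"
  for f :: "nat \<Rightarrow> real"
  by (induction n) auto

lemma simplex_push_alt: "simplex_push m \<theta> t j = (\<Sum>i\<le>m. if \<theta> i = j then t i else 0)"
proof -
  have "{i. i \<le> m \<and> \<theta> i = j} = {i \<in> {..m}. \<theta> i = j}" by auto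
  then show ?thesis unfolding simplex_push_def by (simp only: sum.inter_filter finite_atMost)
qed

lemma standard_simplexI:
  assumes "\<And>i. 0 \<le> t i" "\<And>i. i > n \<Longrightarrow> t i = 0" "sum t {..n} = 1"
  shows "t \<in> standard_simplex n"
proof -
  have "t i \<le> 1" for i
  proof (cases "i \<le> n")
    case True
    then show ?thesis using member_le_sum[of i "{..n}" t] assms by auto
  qed (use assms(2) in simp)
  then show ?thesis using assms by (simp add: standard_simplex_def)
qed

lemma simplex_join_in_simplex:
  assumes "t \<in> standard_simplex m" "t' \<in> standard_simplex n" "0 \<le> u" "u \<le> 1"
  shows "simplex_join m u t t' \<in> standard_simplex (Suc (m + n))"
proof (rule standard_simplexI)
  show "sum (simplex_join m u t t') {..Suc (m + n)} = 1"
    using assms unfolding sum_atMost_join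
    by (simp add: simplex_join_def standard_simplex_def flip: sum_distrib_left)
qed (use assms in \<open>auto simp: simplex_join_def standard_simplex_def\<close>)

text \<open>The operator \<open>\<kappa>\<close> acts blockwise: the bound on
  \<open>\<theta>\<close> keeps the first block below \<open>Suc p\<close>, and the second block is
  shifted past it, so weights of the two blocks never mix.\<close>

lemma simplex_push_join:
  fixes \<theta> \<iota> :: "nat \<Rightarrow> nat"
  assumes \<theta>: "\<theta> ` {..m} \<subseteq> {..p}"
  defines "\<kappa> \<equiv> \<lambda>i. if i \<le> m then \<theta> i else Suc (p + \<iota> (i - Suc m))"
  shows "simplex_push (Suc (m + n)) \<kappa> (simplex_join m u t t')
    = simplex_join p u (simplex_push m \<theta> t) (simplex_push n \<iota> t')"
proof
  fix j
  have "simplex_push (Suc (m + n)) \<kappa> (simplex_join m u t t') j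
     = (\<Sum>i\<le>m. if \<theta> i = j then (1 - u) * t i else 0) +
       (\<Sum>i\<le>n. if Suc (p + \<iota> i) = j then u * t' i else 0)"
    unfolding simplex_push_alt sum_atMost_join
    by (intro arg_cong2[where f = "(+)"] sum.cong) (auto simp: \<kappa>_def simplex_join_def)
  also have "\<dots> = simplex_join p u (simplex_push m \<theta> t) (simplex_push n \<iota> t') j"
  proof (cases "j \<le> p")
    case True
    then have "(if Suc (p + \<iota> i) = j then u * t' i else 0) = 0" for i by auto
    moreover have "(if \<theta> i = j then (1 - u) * t i else 0) = (1 - u) * (if \<theta> i = j then t i else 0)" for i
      by simp
    ultimately show ?thesis using True
      by (simp only: simplex_join_def simplex_push_alt sum_distrib_left) simp
  next
    case False
    then have "(if \<theta> i = j then (1 - u) * t i else 0) = 0" if "i \<in> {..m}" for i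
      using \<theta> that by auto
    moreover have "(if Suc (p + \<iota> i) = j then u * t' i else 0) = u * (if \<iota> i = j - Suc p then t' i else 0)" for i
      using False by auto
    ultimately show ?thesis using False
      by (simp only: simplex_join_def simplex_push_alt sum_distrib_left sum.neutral) simp
  qed
  finally show "simplex_push (Suc (m + n)) \<kappa> (simplex_join m u t t') j
    = simplex_join p u (simplex_push m \<theta> t) (simplex_push n \<iota> t') j" .
qed

text \<open>Compatibility with gluing in both factors at once. It makes the sorting homotopy and the
  cone contraction well defined on classes.\<close>

lemma tuple_join_point_act:
  assumes \<theta>: "\<theta> \<in> monotone_maps m p" and \<iota>: "\<iota> \<in> monotone_maps n q"
    and gh: "g ` {..p} \<union> h ` {..q} \<in> K"
    and t: "t \<in> standard_simplex m" "t' \<in> standard_simplex n" "0 \<le> u" "u \<le> 1"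
  shows "realization_point (tuple_sset K) (Suc (m + n))
      (tuple_join m n (restrict (g \<circ> \<theta>) {..m}) (restrict (h \<circ> \<iota>) {..n})) (simplex_join m u t t')
    = realization_point (tuple_sset K) (Suc (p + q))
      (tuple_join p q g h) (simplex_join p u (simplex_push m \<theta> t) (simplex_push n \<iota> t'))"
proof -
  define \<kappa> where "\<kappa> = (\<lambda>i. if i \<le> m then \<theta> i else Suc (p + \<iota> (i - Suc m)))"
  have "\<kappa> \<in> monotone_maps (Suc (m + n)) (Suc (p + q))"
  proof (rule monotone_mapsI)
    fix i j assume "i \<le> j" "j \<le> Suc (m + n)"
    then show "\<kappa> i \<le> \<kappa> j"
      using monotone_maps_le[OF \<theta>, of i j] monotone_maps_bound[OF \<theta>, of i]
        monotone_maps_le[OF \<iota>, of "i - Suc m" "j - Suc m"]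
      by (auto simp: \<kappa>_def)
  next
    fix i assume "i \<le> Suc (m + n)"
    then show "\<kappa> i \<le> Suc (p + q)"
      using monotone_maps_bound[OF \<theta>, of i] monotone_maps_bound[OF \<iota>, of "i - Suc m"]
      by (auto simp: \<kappa>_def)
  qed
  note * = tuple_point_act[OF this simps_tuple_join[OF gh] simplex_join_in_simplex[OF t]]
  have "restrict (tuple_join p q g h \<circ> \<kappa>) {..Suc (m + n)}
     = tuple_join m n (restrict (g \<circ> \<theta>) {..m}) (restrict (h \<circ> \<iota>) {..n})"
    using monotone_maps_bound[OF \<theta>] monotone_maps_bound[OF \<iota>]
    by (auto simp: tuple_join_def \<kappa>_def fun_eq_iff restrict_def le_SucI trans_le_add1)
  with * show ?thesis
    using simplex_push_join[OF monotone_maps_image[OF \<theta>], of n \<iota> u t t'] by (simp add: \<kappa>_def)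
qed

lemma simplex_push_inj:
  assumes "inj_on \<theta> {..m}" "i \<le> m"
  shows "simplex_push m \<theta> t (\<theta> i) = t i"
proof -
  have "{k. k \<le> m \<and> \<theta> k = \<theta> i} = {i}" using assms by (auto dest: inj_onD)
  then show ?thesis unfolding simplex_push_def by (simp only: sum.insert) simp
qed

lemma simplex_push_outside:
  assumes "j \<notin> \<theta> ` {..m}"
  shows "simplex_push m \<theta> t j = 0"
  unfolding simplex_push_alt using assms by (intro sum.neutral) auto

text \<open>At \<open>u = 0\<close> the second block carries no weight, so the point lies on the
  front face, included by \<open>id\<close>.\<close>

lemma tuple_join_point_0:
  assumes gh: "g ` {..m} \<union> h ` {..n} \<in> K" and g: "g \<in> extensional {..m}" and t: "t \<in> standard_simplex m"
  shows "realization_point (tuple_sset K) (Suc (m + n)) (tuple_join m n g h) (simplex_join m 0 t t')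
    = realization_point (tuple_sset K) m g t"
proof -
  have "id \<in> monotone_maps m (Suc (m + n))" by (rule monotone_mapsI) auto
  note * = tuple_point_act[OF this simps_tuple_join[OF gh] t]
  have 1: "restrict (tuple_join m n g h \<circ> id) {..m} = g"
    using g by (auto simp: tuple_join_def extensional_def fun_eq_iff)
  have 2: "simplex_push m id t = simplex_join m 0 t t'"
  proof
    fix j show "simplex_push m id t j = simplex_join m 0 t t' j"
      using simplex_push_inj[of id m j t] simplex_push_outside[of j id m t]
      by (auto simp: simplex_join_def)
  qed
  show ?thesis using * by (simp only: 1 2)
qed

text \<open>Here all weight lies on the back face, included by the shift by
  \<open>Suc m\<close>.\<close>

lemma tuple_join_point_1:
  assumes gh: "g ` {..m} \<union> h ` {..n} \<in> K" and h: "h \<in> extensional {..n}" and t: "t' \<in> standard_simplex n"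
  shows "realization_point (tuple_sset K) (Suc (m + n)) (tuple_join m n g h) (simplex_join m 1 t t')
    = realization_point (tuple_sset K) n h t'"
proof -
  let ?\<theta> = "\<lambda>i. Suc (m + i)"
  have "?\<theta> \<in> monotone_maps n (Suc (m + n))" by (rule monotone_mapsI) auto
  note * = tuple_point_act[OF this simps_tuple_join[OF gh] t]
  have 1: "restrict (tuple_join m n g h \<circ> ?\<theta>) {..n} = h"
    using h by (auto simp: tuple_join_def extensional_def fun_eq_iff)
  have 2: "simplex_push n ?\<theta> t' = simplex_join m 1 t t'"
  proof
    fix j
    consider "j \<le> m" | i where "j = Suc (m + i)" "i \<le> n" | i where "j = Suc (m + i)" "i > n"
      by (metis less_imp_Suc_add not_le_imp_less)
    then show "simplex_push n ?\<theta> t' j = simplex_join m 1 t t' j"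
    proof cases
      case 1
      then have "j \<notin> ?\<theta> ` {..n}" by force
      then show ?thesis using 1 simplex_push_outside[of j ?\<theta> n t'] by (simp add: simplex_join_def)
    next
      case (2 i)
      moreover have "inj_on ?\<theta> {..n}" by (simp add: inj_on_def)
      ultimately show ?thesis using simplex_push_inj[of ?\<theta> n i t'] by (simp add: simplex_join_def)
    next
      case (3 i)
      then have "t' i = 0" using t by (simp add: standard_simplex_def)
      moreover have "j \<notin> ?\<theta> ` {..n}" using 3 by auto
      ultimately show ?thesis using 3 simplex_push_outside[of j ?\<theta> n t'] by (simp add: simplex_join_def)
    qed
  qed
  show ?thesis using * by (simp only: 1 2)
qed

lemma continuous_map_simplex_join:
  assumes u: "continuous_map W euclideanreal u" "\<And>x. x \<in> topspace W \<Longrightarrow> 0 \<le> u x \<and> u x \<le> 1"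
    and f: "continuous_map W (simplex_topology m) f" and f': "continuous_map W (simplex_topology n) f'"
  shows "continuous_map W (simplex_topology (Suc (m + n))) (\<lambda>x. simplex_join m (u x) (f x) (f' x))"
proof (rule continuous_map_into_simplex)
  fix x i
  assume "x \<in> topspace W"
  then show "simplex_join m (u x) (f x) (f' x) \<in> standard_simplex (Suc (m + n))"
    using u(2) f f' by (intro simplex_join_in_simplex) (auto simp: continuous_map_in_subtopology)
next
  fix i
  have c: "continuous_map W euclideanreal (\<lambda>x. f x i)" "continuous_map W euclideanreal (\<lambda>x. f' x i)" for i
    using continuous_map_compose[OF f continuous_map_simplex_coordinate]
      continuous_map_compose[OF f' continuous_map_simplex_coordinate] by (auto simp: o_def)
  show "continuous_map W euclideanreal (\<lambda>x. simplex_join m (u x) (f x) (f' x) i)"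
    unfolding simplex_join_def using c u(1)
    by (cases "i \<le> m") (auto intro!: continuous_map_real_mult continuous_map_diff)
qed

subsection \<open>Ordered tuples versus simplicial complexes\<close>

text \<open>The barycentric coordinates of the image of \<open>[g, t]\<close> in \<open>|K|\<close>;
  a vertex that occurs several times in \<open>g\<close> collects all its weights.\<close>

definition vertex_weight :: "nat \<Rightarrow> (nat \<Rightarrow> 'a) \<Rightarrow> (nat \<Rightarrow> real) \<Rightarrow> 'a \<Rightarrow> real" where
  "vertex_weight n g t = (\<lambda>v. \<Sum>i | i \<le> n \<and> g i = v. t i)"

lemma vertex_weight_act:
  assumes "\<theta> ` {..m} \<subseteq> {..n}"
  shows "vertex_weight m (restrict (g \<circ> \<theta>) {..m}) t = vertex_weight n g (simplex_push m \<theta> t)"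
proof
  fix v
  have "vertex_weight n g (simplex_push m \<theta> t) v = (\<Sum>i | i \<le> m \<and> \<theta> i \<in> {j. j \<le> n \<and> g j = v}. t i)"
    unfolding vertex_weight_def by (rule sum_simplex_push[OF assms]) auto
  also have "{i. i \<le> m \<and> \<theta> i \<in> {j. j \<le> n \<and> g j = v}} = {i. i \<le> m \<and> restrict (g \<circ> \<theta>) {..m} i = v}"
    using assms by auto
  finally show "vertex_weight m (restrict (g \<circ> \<theta>) {..m}) t v = vertex_weight n g (simplex_push m \<theta> t) v"
    by (simp add: vertex_weight_def)
qed

lemma vertex_weight_in:
  assumes "t \<in> standard_simplex n"
  shows "vertex_weight n g t \<in> geometric_simplex (g ` {..n})"
proof -
  have "0 \<le> vertex_weight n g t v" for v
    using assms unfolding vertex_weight_def standard_simplex_def by (auto intro: sum_nonneg)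
  moreover have "vertex_weight n g t v = 0" if "v \<notin> g ` {..n}" for v
    unfolding vertex_weight_def using that by (intro sum.neutral) auto
  moreover have "sum (vertex_weight n g t) (g ` {..n}) = sum t {..n}"
    unfolding vertex_weight_def using sum.group[of "{..n}" "g ` {..n}" g t] by simp
  ultimately show ?thesis using assms by (simp add: geometric_simplex_def standard_simplex_def)
qed

text \<open>On a closed simplex the weak topology is no finer than the product topology, so
  coordinatewise continuity suffices as long as the values stay in a single
  \<open>S\<close>.\<close>

lemma continuous_map_into_complex:
  assumes "S \<in> K" "\<And>x. x \<in> topspace W \<Longrightarrow> f x \<in> geometric_simplex S"
    "\<And>v. continuous_map W euclideanreal (\<lambda>x. f x v)"
  shows "continuous_map W (complex_realization K) f"
proof -
  have "continuous_map (subtopology (powertop_real UNIV) (geometric_simplex S)) (complex_realization K) id"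
    unfolding continuous_map_def
  proof (intro conjI allI impI)
    fix U assume "openin (complex_realization K) U"
    then have "openin (subtopology (powertop_real UNIV) (geometric_simplex S)) (U \<inter> geometric_simplex S)"
      using assms(1) unfolding openin_complex_realization by blast
    moreover have "{x \<in> topspace (subtopology (powertop_real UNIV) (geometric_simplex S)). id x \<in> U}
       = U \<inter> geometric_simplex S" by auto
    ultimately show "openin (subtopology (powertop_real UNIV) (geometric_simplex S))
       {x \<in> topspace (subtopology (powertop_real UNIV) (geometric_simplex S)). id x \<in> U}" by simp
  qed (use assms(1) in auto)
  moreover have "continuous_map W (subtopology (powertop_real UNIV) (geometric_simplex S)) f"
    using assms by (auto simp: continuous_map_in_subtopology continuous_map_componentwise_UNIV)
  ultimately show ?thesis using continuous_map_compose[of W _ f _ id] by simp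
qed

lemma continuous_map_complex_realization:
  assumes "\<And>S. S \<in> K \<Longrightarrow> continuous_map (subtopology (powertop_real UNIV) (geometric_simplex S)) Y F"
  shows "continuous_map (complex_realization K) Y F"
  unfolding continuous_map_def
proof (intro conjI allI impI)
  show "F \<in> topspace (complex_realization K) \<rightarrow> topspace Y"
    using assms unfolding continuous_map_def by auto
  fix U assume "openin Y U"
  then have "openin (subtopology (powertop_real UNIV) (geometric_simplex S)) {x \<in> geometric_simplex S. F x \<in> U}"
    if "S \<in> K" for S
    using assms[OF that] by (simp add: continuous_map_def)
  moreover have "{x \<in> topspace (complex_realization K). F x \<in> U} \<inter> geometric_simplex S = {x \<in> geometric_simplex S. F x \<in> U}"
    if "S \<in> K" for S using that by auto
  ultimately show "openin (complex_realization K) {x \<in> topspace (complex_realization K). F x \<in> U}"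
    unfolding openin_complex_realization by auto
qed

text \<open>The second clause makes the list of a subset a face of the list of any larger finite
  set; this is the only property of a vertex order that is used later. The bound
  \<open>card S - 1\<close> appears because \<open>{..n}\<close> has \<open>n + 1\<close>
  elements.\<close>

definition coherent_enumeration :: "('a set \<Rightarrow> nat \<Rightarrow> 'a) \<Rightarrow> bool" where
  "coherent_enumeration e \<longleftrightarrow> (\<forall>S. finite S \<longrightarrow> S \<noteq> {} \<longrightarrow> bij_betw (e S) {..card S - 1} S \<and> e S \<in> extensional {..card S - 1}) \<and>
     (\<forall>S T. finite T \<longrightarrow> S \<subseteq> T \<longrightarrow> S \<noteq> {} \<longrightarrow>
        (\<exists>\<iota>\<in>monotone_maps (card S - 1) (card T - 1). e S = restrict (e T \<circ> \<iota>) {..card S - 1}))"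

text \<open>List the elements of each finite set in increasing order for a fixed well-order.\<close>

lemma coherent_enumeration_exists: "\<exists>e :: 'a set \<Rightarrow> nat \<Rightarrow> 'a. coherent_enumeration e"
proof -
  obtain r :: "('a \<times> 'a) set" where "well_order_on UNIV r" using well_order_on by blast
  then have r: "total r" "refl r" "antisym r" "trans r"
    unfolding well_order_on_def linear_order_on_def partial_order_on_def preorder_on_def by auto
  have tot: "(x, y) \<in> r \<or> (y, x) \<in> r" for x y
    using r(1) refl_onD[OF r(2), of x] unfolding total_on_def by (cases "x = y") auto
  note anti = antisymD[OF r(3)] and trans = transD[OF r(4)]
  \<comment> \<open>The rank counts the strict predecessors inside \<open>S\<close>, so ranks start
    at 0; the enumeration will be the inverse of the rank.\<close>
  define rk where "rk S v = card {w \<in> S. w \<noteq> v \<and> (w, v) \<in> r}" for S v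
  have less: "rk S v < rk S w" if "finite S" "v \<in> S" "(v, w) \<in> r" "v \<noteq> w" for S v w
  proof -
    have "{x \<in> S. x \<noteq> v \<and> (x, v) \<in> r} \<subseteq> {x \<in> S. x \<noteq> w \<and> (x, w) \<in> r}"
      using that(3,4) trans[OF _ that(3)] anti by blast
    moreover have "v \<in> {x \<in> S. x \<noteq> w \<and> (x, w) \<in> r} - {x \<in> S. x \<noteq> v \<and> (x, v) \<in> r}"
      using that by simp
    ultimately have "{x \<in> S. x \<noteq> v \<and> (x, v) \<in> r} \<subset> {x \<in> S. x \<noteq> w \<and> (x, w) \<in> r}" by blast
    then show ?thesis unfolding rk_def using that(1) by (intro psubset_card_mono) simp_all
  qed
  have inj: "inj_on (rk S) S" if "finite S" for S
  proof (rule inj_onI, rule ccontr)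
    fix x y assume "x \<in> S" "y \<in> S" "rk S x = rk S y" "x \<noteq> y"
    then show False using tot[of x y] less[OF that, of x y] less[OF that, of y x] by auto
  qed
  have bij: "bij_betw (rk S) S {..card S - 1}" if S: "finite S" "S \<noteq> {}" for S
  proof -
    have "rk S v \<le> card S - 1" if "v \<in> S" for v
    proof -
      have "rk S v \<le> card (S - {v})" unfolding rk_def using S by (intro card_mono) auto
      then show ?thesis using that S by simp
    qed
    moreover have "card {..card S - 1} = card S" using S by (simp add: Suc_leI card_gt_0_iff)
    ultimately have "rk S ` S = {..card S - 1}"
      using card_image[OF inj[OF S(1)]] by (intro card_subset_eq) auto
    then show ?thesis using inj[OF S(1)] by (simp add: bij_betw_def)
  qed
  define e where "e S = restrict (the_inv_into S (rk S)) {..card S - 1}" for S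
  have bij_e: "bij_betw (e S) {..card S - 1} S" if "finite S" "S \<noteq> {}" for S
    using bij_betw_the_inv_into[OF bij[OF that]] unfolding e_def
    by (rule bij_betw_cong[THEN iffD1, rotated]) auto
  have rk_e: "rk S (e S i) = i" if "finite S" "S \<noteq> {}" "i \<le> card S - 1" for S i
    using f_the_inv_into_f_bij_betw[OF bij[OF that(1,2)]] that by (simp add: e_def)
  have e_rk: "e S (rk S v) = v" if "finite S" "v \<in> S" for S v
  proof -
    have "S \<noteq> {}" using that by auto
    then have "rk S v \<in> {..card S - 1}" using bij[of S] that by (metis bij_betw_apply)
    then show ?thesis using the_inv_into_f_f[OF inj[OF that(1)] that(2)] by (simp add: e_def)
  qed
  have "\<exists>\<iota>\<in>monotone_maps (card S - 1) (card T - 1). e S = restrict (e T \<circ> \<iota>) {..card S - 1}"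
    if T: "finite T" "S \<subseteq> T" and S: "S \<noteq> {}" for S T
  proof (rule bexI)
    have fin: "finite S" and "T \<noteq> {}" using that finite_subset by auto
    have eS: "e S i \<in> S" if "i \<le> card S - 1" for i
      using bij_e[OF fin S] that by (auto dest: bij_betw_apply)
    \<comment> \<open>The witness sends the position of an element in \<open>S\<close> to its
      position in \<open>T\<close>.\<close>
    show "e S = restrict (e T \<circ> (\<lambda>i. rk T (e S i))) {..card S - 1}"
    proof
      fix i show "e S i = restrict (e T \<circ> (\<lambda>i. rk T (e S i))) {..card S - 1} i"
      proof (cases "i \<le> card S - 1")
        case True
        then show ?thesis using e_rk[OF T(1) subsetD[OF T(2) eS]] by simp
      qed (simp add: e_def)
    qed
    show "(\<lambda>i. rk T (e S i)) \<in> monotone_maps (card S - 1) (card T - 1)"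
    proof (rule monotone_mapsI)
      fix i j assume ij: "i \<le> j" "j \<le> card S - 1"
      show "rk T (e S i) \<le> rk T (e S j)"
      proof (cases "(e S i, e S j) \<in> r")
        case True
        then show ?thesis using less[OF T(1), of "e S i" "e S j"] eS[of i] ij T(2)
          by (cases "e S i = e S j") (auto intro: less_imp_le)
      next
        case False
        then have "e S i \<noteq> e S j" "(e S j, e S i) \<in> r" using tot[of "e S i" "e S j"] tot[of "e S j" "e S j"] by auto
        then have "rk S (e S j) < rk S (e S i)" using less[OF fin eS[OF ij(2)]] by simp
        then show ?thesis using rk_e[OF fin S] ij by simp
      qed
    next
      fix i assume "i \<le> card S - 1"
      then show "rk T (e S i) \<le> card T - 1"
        using bij_betw_apply[OF bij[OF T(1) \<open>T \<noteq> {}\<close>]] eS T(2) by blast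
    qed
  qed
  then have "coherent_enumeration e"
    unfolding coherent_enumeration_def using bij_e by (auto simp: e_def)
  then show ?thesis by blast
qed

section \<open>The equivalence between ordered tuples and the complex\<close>

locale enumerated_complex =
  fixes K :: "'a set set" and e :: "'a set \<Rightarrow> nat \<Rightarrow> 'a"
  assumes complex: "abstract_simplicial_complex K" and enum: "coherent_enumeration e"
begin

definition coords :: "'a set \<Rightarrow> ('a \<Rightarrow> real) \<Rightarrow> nat \<Rightarrow> real" where
  "coords S \<tau> = (\<lambda>i. if i \<le> card S - 1 then \<tau> (e S i) else 0)"

lemma simplexD: "S \<in> K \<Longrightarrow> finite S" "S \<in> K \<Longrightarrow> S \<noteq> {}" "S \<in> K \<Longrightarrow> T \<subseteq> S \<Longrightarrow> T \<noteq> {} \<Longrightarrow> T \<in> K"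
  using complex unfolding abstract_simplicial_complex_def by blast+

lemma bij_enum: "S \<in> K \<Longrightarrow> bij_betw (e S) {..card S - 1} S"
  using enum simplexD unfolding coherent_enumeration_def by blast

lemma enum_in: "S \<in> K \<Longrightarrow> e S \<in> simps (tuple_sset K) (card S - 1)"
  using bij_enum[of S] enum simplexD unfolding coherent_enumeration_def simps_tuple
  by (auto simp: bij_betw_def)

lemma coords_in:
  assumes "S \<in> K" "\<tau> \<in> geometric_simplex S"
  shows "coords S \<tau> \<in> standard_simplex (card S - 1)"
proof (rule standard_simplexI)
  have "sum (coords S \<tau>) {..card S - 1} = (\<Sum>i\<le>card S - 1. \<tau> (e S i))"
    by (simp add: coords_def)
  also have "\<dots> = sum \<tau> S" by (rule sum.reindex_bij_betw[OF bij_enum[OF assms(1)]])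
  finally show "sum (coords S \<tau>) {..card S - 1} = 1" using assms by (simp add: geometric_simplex_def)
qed (use assms in \<open>auto simp: coords_def geometric_simplex_def\<close>)

text \<open>As \<open>\<tau>\<close> vanishes off \<open>S\<close>, its coordinates with respect to
  \<open>T\<close> arise from those for \<open>S\<close> by inserting zeros. Injectivity of
  \<open>e S\<close> forces that of \<open>\<iota>\<close>, so no two coordinates are
  merged.\<close>

lemma enum_subset:
  assumes T: "T \<in> K" and ST: "S \<subseteq> T" "S \<noteq> {}" and \<tau>: "\<And>v. v \<notin> S \<Longrightarrow> \<tau> v = 0"
  obtains \<iota> where "\<iota> \<in> monotone_maps (card S - 1) (card T - 1)" "e S = restrict (e T \<circ> \<iota>) {..card S - 1}"
    "simplex_push (card S - 1) \<iota> (coords S \<tau>) = coords T \<tau>"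
proof -
  obtain \<iota> where \<iota>: "\<iota> \<in> monotone_maps (card S - 1) (card T - 1)" "e S = restrict (e T \<circ> \<iota>) {..card S - 1}"
    using enum simplexD[OF T] ST unfolding coherent_enumeration_def by meson
  have S: "S \<in> K" using simplexD(3)[OF T ST] .
  have eS: "e T (\<iota> i) = e S i" if "i \<le> card S - 1" for i
    using that by (subst \<iota>(2)) simp
  have inj: "inj_on \<iota> {..card S - 1}"
    using eS bij_betw_imp_inj_on[OF bij_enum[OF S]] by (metis atMost_iff inj_on_def)
  have "simplex_push (card S - 1) \<iota> (coords S \<tau>) j = coords T \<tau> j" for j
  proof (cases "j \<in> \<iota> ` {..card S - 1}")
    case True
    then obtain i where "i \<le> card S - 1" "j = \<iota> i" by auto
    then show ?thesis
      using simplex_push_inj[OF inj, of i] eS monotone_maps_bound[OF \<iota>(1)] by (simp add: coords_def)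
  next
    case False
    have "coords T \<tau> j = 0"
    proof (cases "j \<le> card T - 1")
      case True
      have "e T j \<notin> S"
      proof
        assume "e T j \<in> S"
        then obtain i where i: "i \<le> card S - 1" "e S i = e T j"
          using bij_enum[OF S] unfolding bij_betw_def by (metis atMost_iff imageE)
        then have "\<iota> i = j"
          using eS[OF i(1)] True monotone_maps_bound[OF \<iota>(1) i(1)] bij_betw_imp_inj_on[OF bij_enum[OF T]]
          by (metis atMost_iff inj_onD)
        then show False using False i by auto
      qed
      then show ?thesis using \<tau> by (simp add: coords_def)
    qed (simp add: coords_def)
    then show ?thesis using simplex_push_outside[OF False] by simp
  qed
  then show ?thesis using \<iota> that by blast
qed

text \<open>The support is a canonical choice of a simplex carrying \<open>\<tau>\<close>. Any
  larger simplex gives the same point by \<open>sorted_point_eq\<close>, which is what continuity on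
  a whole closed simplex requires.\<close>

definition sorted_point :: "('a \<Rightarrow> real) \<Rightarrow> (nat \<Rightarrow> 'a) realization_point" where
  "sorted_point \<tau> = (let S = {v. \<tau> v \<noteq> 0} in realization_point (tuple_sset K) (card S - 1) (e S) (coords S \<tau>))"

lemma sorted_point_eq:
  assumes T: "T \<in> K" and \<tau>: "\<tau> \<in> geometric_simplex T"
  shows "sorted_point \<tau> = realization_point (tuple_sset K) (card T - 1) (e T) (coords T \<tau>)"
proof -
  define S where "S = {v. \<tau> v \<noteq> 0}"
  have "S \<noteq> {}"
  proof
    assume "S = {}"
    then have "sum \<tau> T = 0" by (simp add: S_def)
    then show False using \<tau> by (simp add: geometric_simplex_def)
  qed
  moreover have "S \<subseteq> T" using \<tau> by (auto simp: S_def geometric_simplex_def)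
  ultimately have ST: "S \<subseteq> T" "S \<noteq> {}" by auto
  then have S: "S \<in> K" using simplexD(3)[OF T] by blast
  have "sum \<tau> S = sum \<tau> T"
    by (rule sum.mono_neutral_left) (use ST simplexD[OF T] in \<open>auto simp: S_def\<close>)
  then have \<tau>S: "\<tau> \<in> geometric_simplex S" using \<tau> by (auto simp: geometric_simplex_def S_def)
  obtain \<iota> where \<iota>: "\<iota> \<in> monotone_maps (card S - 1) (card T - 1)" "e S = restrict (e T \<circ> \<iota>) {..card S - 1}"
    "simplex_push (card S - 1) \<iota> (coords S \<tau>) = coords T \<tau>"
    by (rule enum_subset[OF T ST, of \<tau>]) (auto simp: S_def)
  show ?thesis
    using tuple_point_act[OF \<iota>(1) enum_in[OF T] coords_in[OF S \<tau>S]]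
    unfolding sorted_point_def Let_def S_def[symmetric] by (simp only: \<iota>(2)[symmetric] \<iota>(3))
qed

lemma vertex_weight_coords:
  assumes S: "S \<in> K" and \<tau>: "\<tau> \<in> geometric_simplex S"
  shows "vertex_weight (card S - 1) (e S) (coords S \<tau>) = \<tau>"
proof
  fix v
  show "vertex_weight (card S - 1) (e S) (coords S \<tau>) v = \<tau> v"
  proof (cases "v \<in> S")
    case True
    then obtain i where i: "i \<le> card S - 1" "e S i = v"
      using bij_enum[OF S] unfolding bij_betw_def by (metis atMost_iff imageE)
    then have "{k. k \<le> card S - 1 \<and> e S k = v} = {i}"
      using bij_betw_imp_inj_on[OF bij_enum[OF S]] by (auto dest: inj_onD)
    then show ?thesis using i unfolding vertex_weight_def by (simp only: coords_def) simp
  next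
    case False
    then have "{k. k \<le> card S - 1 \<and> e S k = v} = {}"
      using bij_enum[OF S] by (auto dest: bij_betw_apply)
    then have "vertex_weight (card S - 1) (e S) (coords S \<tau>) v = 0"
      unfolding vertex_weight_def by (simp only: sum.empty)
    then show ?thesis using False \<tau> by (simp add: geometric_simplex_def)
  qed
qed

definition weight_point :: "(nat \<Rightarrow> 'a) realization_point \<Rightarrow> 'a \<Rightarrow> real" where
  "weight_point = realization_rec (tuple_sset K) vertex_weight"

lemma weight_point_eq:
  assumes "g \<in> simps (tuple_sset K) n" "t \<in> standard_simplex n"
  shows "weight_point (realization_point (tuple_sset K) n g t) = vertex_weight n g t"
proof -
  have "glue_invariant (tuple_sset K) vertex_weight"
    by (rule glue_invariantI) (simp add: vertex_weight_act monotone_maps_image)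
  then show ?thesis unfolding weight_point_def using assms by (rule realization_rec_point)
qed

text \<open>Appending the sorted list to \<open>g\<close> does not change the set of entries, so the
  joined tuple is still a simplex of \<open>T K\<close> and contains both ends of the segment as
  faces.\<close>

definition sorting_homotopy :: "real \<Rightarrow> (nat \<Rightarrow> 'a) realization_point \<Rightarrow> (nat \<Rightarrow> 'a) realization_point" where
  "sorting_homotopy u = realization_rec (tuple_sset K)
     (\<lambda>n g t. let S = g ` {..n} in realization_point (tuple_sset K) (Suc (n + (card S - 1)))
        (tuple_join n (card S - 1) g (e S)) (simplex_join n u t (coords S (vertex_weight n g t))))"

lemma sorting_homotopy_eq:
  assumes u: "0 \<le> u" "u \<le> 1" and g: "g \<in> simps (tuple_sset K) n" and t: "t \<in> standard_simplex n"
  defines "S \<equiv> g ` {..n}"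
  shows "sorting_homotopy u (realization_point (tuple_sset K) n g t)
    = realization_point (tuple_sset K) (Suc (n + (card S - 1)))
        (tuple_join n (card S - 1) g (e S)) (simplex_join n u t (coords S (vertex_weight n g t)))"
proof -
  have "glue_invariant (tuple_sset K)
     (\<lambda>n g t. let S = g ` {..n} in realization_point (tuple_sset K) (Suc (n + (card S - 1)))
        (tuple_join n (card S - 1) g (e S)) (simplex_join n u t (coords S (vertex_weight n g t))))"
  proof (rule glue_invariantI, unfold act_tuple)
    fix m n \<theta> g and t :: "nat \<Rightarrow> real"
    assume \<theta>: "\<theta> \<in> monotone_maps m n" and g: "g \<in> simps (tuple_sset K) n" and t: "t \<in> standard_simplex m"
    let ?g = "restrict (g \<circ> \<theta>) {..m}"
    let ?S = "?g ` {..m}" and ?T = "g ` {..n}"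
    let ?\<tau> = "vertex_weight m ?g t"
    have T: "?T \<in> K" and S: "?S \<in> K" "?g \<in> simps (tuple_sset K) m"
      using g act_tuple_in[OF complex monotone_maps_image[OF \<theta>] g] by (auto simp: simps_tuple)
    have ST: "?S \<subseteq> ?T" "?S \<noteq> {}" using monotone_maps_image[OF \<theta>] by auto
    have \<tau>: "?\<tau> \<in> geometric_simplex ?S" by (rule vertex_weight_in[OF t])
    then have \<tau>0: "?\<tau> v = 0" if "v \<notin> ?S" for v using that by (auto simp: geometric_simplex_def)
    \<comment> \<open>Restricting \<open>g\<close> along \<open>\<theta>\<close> may lose entries,
      which shortens the sorted list as well. The map \<open>\<iota>\<close> restores the missing
      vertices with weight zero, so that both blocks of the join can be glued
      simultaneously.\<close>
    obtain \<iota> where \<iota>: "\<iota> \<in> monotone_maps (card ?S - 1) (card ?T - 1)"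
      "e ?S = restrict (e ?T \<circ> \<iota>) {..card ?S - 1}"
      "simplex_push (card ?S - 1) \<iota> (coords ?S ?\<tau>) = coords ?T ?\<tau>"
      by (rule enum_subset[OF T ST, of ?\<tau>]) (use \<tau>0 in auto)
    have un: "g ` {..n} \<union> e ?T ` {..card ?T - 1} \<in> K"
      using bij_enum[OF T] T by (simp add: bij_betw_def)
    have "realization_point (tuple_sset K) (Suc (m + (card ?S - 1)))
        (tuple_join m (card ?S - 1) ?g (e ?S)) (simplex_join m u t (coords ?S ?\<tau>)) =
      realization_point (tuple_sset K) (Suc (n + (card ?T - 1)))
        (tuple_join n (card ?T - 1) g (e ?T)) (simplex_join n u (simplex_push m \<theta> t) (coords ?T ?\<tau>))"
      unfolding \<iota>(3)[symmetric] by (subst \<iota>(2), rule tuple_join_point_act[OF \<theta> \<iota>(1) un t coords_in[OF S(1) \<tau>] u])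
    then show "(let S = ?S in realization_point (tuple_sset K) (Suc (m + (card S - 1)))
        (tuple_join m (card S - 1) ?g (e S)) (simplex_join m u t (coords S (vertex_weight m ?g t)))) =
      (let S = ?T in realization_point (tuple_sset K) (Suc (n + (card S - 1)))
        (tuple_join n (card S - 1) g (e S))
        (simplex_join n u (simplex_push m \<theta> t) (coords S (vertex_weight n g (simplex_push m \<theta> t)))))"
      using vertex_weight_act[OF monotone_maps_image[OF \<theta>], of g t] by (simp only: Let_def)
  qed
  then show ?thesis
    unfolding sorting_homotopy_def S_def using realization_rec_point[OF _ g t] by (auto simp: Let_def)
qed

lemma continuous_map_vertex_weight:
  "continuous_map (simplex_topology n) euclideanreal (\<lambda>t. vertex_weight n g t v)"
  unfolding vertex_weight_def
  by (intro continuous_map_sum continuous_map_simplex_coordinate) auto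

lemma continuous_map_coords:
  assumes "S \<in> K" "\<And>x. x \<in> topspace W \<Longrightarrow> f x \<in> geometric_simplex S"
    "\<And>v. continuous_map W euclideanreal (\<lambda>x. f x v)"
  shows "continuous_map W (simplex_topology (card S - 1)) (\<lambda>x. coords S (f x))"
proof (rule continuous_map_into_simplex)
  fix i show "continuous_map W euclideanreal (\<lambda>x. coords S (f x) i)"
    unfolding coords_def using assms(3) by (cases "i \<le> card S - 1") auto
qed (use assms coords_in in auto)

text \<open>Sorting and then adding up weights is the identity by
  \<open>vertex_weight_coords\<close>; the opposite composite is the end of
  \<open>sorting_homotopy\<close>.\<close>

theorem tuple_realization_homotopy_equivalent:
  "sset_realization (tuple_sset K) homotopy_equivalent_space complex_realization K"
  unfolding homotopy_equivalent_space_def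
proof (intro exI conjI)
  show wcont: "continuous_map (sset_realization (tuple_sset K)) (complex_realization K) weight_point"
  proof (rule continuous_map_realization)
    fix n and g :: "nat \<Rightarrow> 'a" assume g: "g \<in> simps (tuple_sset K) n"
    have "continuous_map (simplex_topology n) (complex_realization K) (vertex_weight n g)"
      by (rule continuous_map_into_complex[of "g ` {..n}"])
        (use g vertex_weight_in continuous_map_vertex_weight in \<open>auto simp: simps_tuple\<close>)
    then show "continuous_map (simplex_topology n) (complex_realization K)
       (\<lambda>t. weight_point (realization_point (tuple_sset K) n g t))"
      by (rule continuous_map_eq) (simp add: weight_point_eq[OF g])
  qed
  show scont: "continuous_map (complex_realization K) (sset_realization (tuple_sset K)) sorted_point"
  proof (rule continuous_map_complex_realization)
    fix S assume S: "S \<in> K"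
    let ?D = "subtopology (powertop_real UNIV) (geometric_simplex S)"
    have "continuous_map ?D (simplex_topology (card S - 1)) (coords S)"
      by (rule continuous_map_coords[OF S])
        (auto intro!: continuous_map_from_subtopology continuous_map_product_projection)
    then have "continuous_map ?D (sset_realization (tuple_sset K))
       (realization_point (tuple_sset K) (card S - 1) (e S) \<circ> coords S)"
      using continuous_map_realization_point[OF enum_in[OF S]] by (rule continuous_map_compose)
    then show "continuous_map ?D (sset_realization (tuple_sset K)) sorted_point"
      by (rule continuous_map_eq) (simp add: sorted_point_eq[OF S])
  qed
  have "continuous_map (prod_topology unit_interval (sset_realization (tuple_sset K)))
      (sset_realization (tuple_sset K)) (\<lambda>(u, c). sorting_homotopy u c)"
  proof (rule continuous_map_unit_interval_prod_realization)
    fix n and g :: "nat \<Rightarrow> 'a" assume g: "g \<in> simps (tuple_sset K) n"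
    let ?W = "prod_topology unit_interval (simplex_topology n)"
    define S where "S = g ` {..n}"
    have S: "S \<in> K" using g by (simp add: S_def simps_tuple)
    have un: "g ` {..n} \<union> e S ` {..card S - 1} \<in> K"
      using bij_enum[OF S] S by (simp add: bij_betw_def S_def)
    have "continuous_map ?W (simplex_topology (Suc (n + (card S - 1))))
       (\<lambda>x. simplex_join n (fst x) (snd x) (coords S (vertex_weight n g (snd x))))"
    proof (rule continuous_map_simplex_join)
      show "continuous_map ?W euclideanreal fst"
        using continuous_map_fst continuous_map_in_subtopology by blast
      show "continuous_map ?W (simplex_topology (card S - 1)) (\<lambda>x. coords S (vertex_weight n g (snd x)))"
      proof (rule continuous_map_coords[OF S])
        fix v show "continuous_map ?W euclideanreal (\<lambda>x. vertex_weight n g (snd x) v)"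
          using continuous_map_compose[OF continuous_map_snd continuous_map_vertex_weight[of n g v]]
          by (simp add: o_def)
      qed (auto simp: S_def intro: vertex_weight_in)
    qed (auto intro: continuous_map_snd)
    note continuous_map_compose[OF this continuous_map_realization_point[OF simps_tuple_join[OF un]]]
    then show "continuous_map ?W (sset_realization (tuple_sset K))
      (\<lambda>(u, t). (case (u, realization_point (tuple_sset K) n g t) of (u, c) \<Rightarrow> sorting_homotopy u c))"
      by (rule continuous_map_eq) (auto simp: sorting_homotopy_eq g S_def)
  qed
  moreover have "sorting_homotopy 0 c = id c \<and> sorting_homotopy 1 c = (sorted_point \<circ> weight_point) c"
    if c: "c \<in> topspace (sset_realization (tuple_sset K))" for c
  proof -
    obtain n g t where g: "g \<in> simps (tuple_sset K) n" and t: "t \<in> standard_simplex n"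
      and c_eq: "c = realization_point (tuple_sset K) n g t"
      using c unfolding in_topspace_realization by blast
    define S where "S = g ` {..n}"
    have S: "S \<in> K" "g \<in> extensional {..n}" using g by (auto simp: S_def simps_tuple)
    have un: "g ` {..n} \<union> e S ` {..card S - 1} \<in> K"
      using bij_enum[OF S(1)] S by (simp add: bij_betw_def S_def)
    have \<tau>: "vertex_weight n g t \<in> geometric_simplex S" unfolding S_def by (rule vertex_weight_in[OF t])
    show ?thesis
      using tuple_join_point_0[OF un S(2) t] tuple_join_point_1[OF un _ coords_in[OF S(1) \<tau>]]
        enum_in[OF S(1)] sorting_homotopy_eq[OF _ _ g t] sorted_point_eq[OF S(1) \<tau>] weight_point_eq[OF g t]
      unfolding c_eq by (simp add: simps_tuple S_def)
  qed
  ultimately have "homotopic_with (\<lambda>x. True) (sset_realization (tuple_sset K)) (sset_realization (tuple_sset K))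
      id (sorted_point \<circ> weight_point)"
    by (subst homotopic_with) (auto intro!: exI[of _ "\<lambda>(u, c). sorting_homotopy u c"])
  then show "homotopic_with (\<lambda>x. True) (sset_realization (tuple_sset K)) (sset_realization (tuple_sset K))
      (sorted_point \<circ> weight_point) id"
    by (rule homotopic_with_symD)
  show "homotopic_with (\<lambda>x. True) (complex_realization K) (complex_realization K) (weight_point \<circ> sorted_point) id"
  proof (rule homotopic_with_equal)
    fix \<tau> assume "\<tau> \<in> topspace (complex_realization K)"
    then obtain S where S: "S \<in> K" "\<tau> \<in> geometric_simplex S" by auto
    show "(weight_point \<circ> sorted_point) \<tau> = id \<tau>"
      by (simp only: o_apply id_apply sorted_point_eq[OF S] weight_point_eq[OF enum_in[OF S(1)] coords_in[OF S]]
          vertex_weight_coords[OF S])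
  qed (auto intro: continuous_map_compose wcont scont)
qed

end

subsection \<open>Translation-invariant complexes and their quotients\<close>

text \<open>Both \<open>AfCom G\<close> and the complex of all finite subsets are instances, so each
  fact about the two coverings is proved once.\<close>

locale translation_complex = group G for G (structure) +
  fixes K :: "'a set set"
  assumes complex: "abstract_simplicial_complex K"
    and carrier: "S \<in> K \<Longrightarrow> S \<subseteq> carrier G"
    and translate: "h \<in> carrier G \<Longrightarrow> S \<in> K \<Longrightarrow> (\<lambda>g. h \<otimes> g) ` S \<in> K"

definition quotients :: "('a, 'b) monoid_scheme \<Rightarrow> nat \<Rightarrow> (nat \<Rightarrow> 'a) \<Rightarrow> 'a list" where
  "quotients G n g = map (\<lambda>i. inv\<^bsub>G\<^esub> (g i) \<otimes>\<^bsub>G\<^esub> g (Suc i)) [0..<n]"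

text \<open>The quotient of the tuples by \<open>G\<close>, with an orbit coded by its list of
  consecutive quotients instead of a set of tuples. In this form it can be literally equal to
  \<open>nerve G\<close> or \<open>commuting_nerve G\<close>.\<close>

definition quotient_sset :: "('a, 'b) monoid_scheme \<Rightarrow> 'a set set \<Rightarrow> 'a list sset" where
  "quotient_sset G K = \<lparr>simps = (\<lambda>n. quotients G n ` simps (tuple_sset K) n), act = (\<lambda>m n. nerve_act G m)\<rparr>"

lemma act_quotient_sset [simp]: "act (quotient_sset G K) m n = nerve_act G m"
  by (simp add: quotient_sset_def)

lemma simps_quotient_sset: "simps (quotient_sset G K) n = quotients G n ` simps (tuple_sset K) n"
  by (simp add: quotient_sset_def)

definition shift_tuple :: "('a, 'b) monoid_scheme \<Rightarrow> 'a \<Rightarrow> nat \<Rightarrow> (nat \<Rightarrow> 'a) \<Rightarrow> nat \<Rightarrow> 'a" where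
  "shift_tuple G h n g = restrict (\<lambda>i. h \<otimes>\<^bsub>G\<^esub> g i) {..n}"

context group
begin

lemma mult_inv_mult: "x \<in> carrier G \<Longrightarrow> y \<in> carrier G \<Longrightarrow> x \<otimes> (inv x \<otimes> y) = y"
  using m_assoc[of x "inv x" y] by simp

lemma inv_mult_mult: "x \<in> carrier G \<Longrightarrow> y \<in> carrier G \<Longrightarrow> inv x \<otimes> (x \<otimes> y) = y"
  using m_assoc[of "inv x" x y] by simp

text \<open>The product telescopes. This yields compatibility of \<open>quotients\<close> with every
  simplicial operator in \<open>nerve_act_quotients\<close>.\<close>

lemma quotients_foldr:
  assumes "g ` {..n} \<subseteq> carrier G" "a \<le> b" "b \<le> n"
  shows "foldr (\<otimes>) (map ((!) (quotients G n g)) [a..<b]) \<one> = inv (g a) \<otimes> g b"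
  using assms(2,1,3)
proof (induction b rule: dec_induct)
  case base
  then show ?case by auto
next
  case (step b)
  have car: "g i \<in> carrier G" if "i \<le> n" for i using step.prems(1) that by auto
  have in_car: "set (map ((!) (quotients G n g)) [a..<b]) \<subseteq> carrier G"
    using step.prems car by (auto simp: quotients_def)
  have q: "quotients G n g ! b = inv (g b) \<otimes> g (Suc b)" using step.prems by (simp add: quotients_def)
  have "map ((!) (quotients G n g)) [a..<Suc b] = map ((!) (quotients G n g)) [a..<b] @ [quotients G n g ! b]"
    using step.hyps by simp
  then have "foldr (\<otimes>) (map ((!) (quotients G n g)) [a..<Suc b]) \<one>
     = foldr (\<otimes>) (map ((!) (quotients G n g)) [a..<b]) \<one> \<otimes> foldr (\<otimes>) [quotients G n g ! b] \<one>"
    using car[of b] car[of "Suc b"] step.prems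
    by (metis (no_types) foldr_mult_append[OF in_car] q inv_closed m_closed Suc_leD empty_subsetI
        insert_subset list.set(1,2))
  also have "\<dots> = inv (g a) \<otimes> g b \<otimes> (inv (g b) \<otimes> g (Suc b))"
    using step.IH step.prems car[of b] car[of "Suc b"] by (simp add: q)
  also have "\<dots> = inv (g a) \<otimes> g (Suc b)"
  proof -
    have "g a \<in> carrier G" "g b \<in> carrier G" "g (Suc b) \<in> carrier G"
      using car step.prems(2) step.hyps by simp_all
    then show ?thesis by (simp add: m_assoc mult_inv_mult)
  qed
  finally show ?case .
qed

lemma nerve_act_quotients:
  assumes "\<theta> \<in> monotone_maps m n" "g ` {..n} \<subseteq> carrier G"
  shows "nerve_act G m \<theta> (quotients G n g) = quotients G m (restrict (g \<circ> \<theta>) {..m})"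
  unfolding nerve_act_def quotients_def[of G m]
proof (rule map_cong[OF refl])
  fix i assume "i \<in> set [0..<m]"
  then have i: "i < m" by simp
  then have "\<theta> i \<le> \<theta> (Suc i)" "\<theta> (Suc i) \<le> n"
    using assms(1) by (auto intro: monotone_maps_le monotone_maps_bound)
  then show "foldr (\<otimes>) (map ((!) (quotients G n g)) [\<theta> i..<\<theta> (Suc i)]) \<one>
    = inv (restrict (g \<circ> \<theta>) {..m} i) \<otimes> restrict (g \<circ> \<theta>) {..m} (Suc i)"
    using i quotients_foldr[OF assms(2)] by simp
qed

text \<open>A tuple is recovered from its first entry and its consecutive quotients, so the
  translation matching the first entries matches all of them.\<close>

lemma quotients_eq_imp_shift:
  assumes g: "g ` {..n} \<subseteq> carrier G" "g \<in> extensional {..n}"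
    and g': "g' ` {..n} \<subseteq> carrier G" "g' \<in> extensional {..n}"
    and eq: "quotients G n g = quotients G n g'"
  shows "g' = shift_tuple G (g' 0 \<otimes> inv (g 0)) n g"
proof -
  have car: "g i \<in> carrier G" "g' i \<in> carrier G" if "i \<le> n" for i using g g' that by auto
  have *: "g' i = g' 0 \<otimes> inv (g 0) \<otimes> g i" if "i \<le> n" for i
    using that
  proof (induction i)
    case 0
    then show ?case using car[of 0] by (simp add: m_assoc)
  next
    case (Suc i)
    then have IH: "g' i = g' 0 \<otimes> inv (g 0) \<otimes> g i" by simp
    have "quotients G n g ! i = quotients G n g' ! i" using eq by simp
    then have q: "inv (g i) \<otimes> g (Suc i) = inv (g' i) \<otimes> g' (Suc i)"
      using Suc.prems by (simp add: quotients_def)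
    have "g' (Suc i) = g' i \<otimes> (inv (g' i) \<otimes> g' (Suc i))"
      using car[of i] car[of "Suc i"] Suc.prems by (simp add: mult_inv_mult)
    also have "\<dots> = g' 0 \<otimes> inv (g 0) \<otimes> g i \<otimes> (inv (g i) \<otimes> g (Suc i))" by (simp only: q[symmetric] IH[symmetric])
    also have "\<dots> = g' 0 \<otimes> inv (g 0) \<otimes> (g i \<otimes> (inv (g i) \<otimes> g (Suc i)))"
      using car[of i] car[of "Suc i"] car[of 0] Suc.prems by (simp add: m_assoc)
    also have "g i \<otimes> (inv (g i) \<otimes> g (Suc i)) = g (Suc i)"
      using car[of i] car[of "Suc i"] Suc.prems by (simp add: mult_inv_mult)
    finally show ?case .
  qed
  have "g' i = shift_tuple G (g' 0 \<otimes> inv (g 0)) n g i" for i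
  proof (cases "i \<le> n")
    case True
    show ?thesis by (subst *[OF True]) (simp add: True shift_tuple_def)
  next
    case False
    then show ?thesis using g'(2) by (simp add: shift_tuple_def extensional_def)
  qed
  then show ?thesis by (rule ext)
qed

lemma quotients_shift:
  assumes "h \<in> carrier G" "g ` {..n} \<subseteq> carrier G"
  shows "quotients G n (shift_tuple G h n g) = quotients G n g"
  unfolding quotients_def
proof (rule map_cong[OF refl])
  fix i assume i: "i \<in> set [0..<n]"
  then have car: "g i \<in> carrier G" "g (Suc i) \<in> carrier G" using assms(2) by auto
  have "inv (h \<otimes> g i) \<otimes> (h \<otimes> g (Suc i)) = inv (g i) \<otimes> (inv h \<otimes> (h \<otimes> g (Suc i)))"
    using assms(1) car by (simp add: inv_mult_group m_assoc)
  also have "inv h \<otimes> (h \<otimes> g (Suc i)) = g (Suc i)"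
    using assms(1) car by (simp add: inv_mult_mult)
  finally show "inv (shift_tuple G h n g i) \<otimes> shift_tuple G h n g (Suc i) = inv (g i) \<otimes> g (Suc i)"
    using i by (simp add: shift_tuple_def)
qed

end

context translation_complex
begin

abbreviation "T \<equiv> tuple_sset K"
abbreviation "N \<equiv> quotient_sset G K"

lemma tuple_carrier: "g \<in> simps T n \<Longrightarrow> g ` {..n} \<subseteq> carrier G"
  using carrier[of "g ` {..n}"] by (simp add: simps_tuple)

lemma shift_in: "h \<in> carrier G \<Longrightarrow> g \<in> simps T n \<Longrightarrow> shift_tuple G h n g \<in> simps T n"
  using translate[of h "g ` {..n}"] by (simp add: simps_tuple shift_tuple_def image_image)

lemma quotients_in: "g \<in> simps T n \<Longrightarrow> quotients G n g \<in> simps N n"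
  by (simp add: simps_quotient_sset)

section \<open>The projection and the translation action\<close>

definition proj :: "(nat \<Rightarrow> 'a) realization_point \<Rightarrow> 'a list realization_point" where
  "proj = realization_rec T (\<lambda>n g. realization_point N n (quotients G n g))"

definition shift :: "'a \<Rightarrow> (nat \<Rightarrow> 'a) realization_point \<Rightarrow> (nat \<Rightarrow> 'a) realization_point" where
  "shift h = realization_rec T (\<lambda>n g. realization_point T n (shift_tuple G h n g))"

lemma proj_point:
  assumes "g \<in> simps T n" "t \<in> standard_simplex n"
  shows "proj (realization_point T n g t) = realization_point N n (quotients G n g) t"
proof -
  have "glue_invariant T (\<lambda>n g. realization_point N n (quotients G n g))"
  proof (rule glue_invariantI)
    fix m n \<theta> g and t :: "nat \<Rightarrow> real"
    assume "\<theta> \<in> monotone_maps m n" "g \<in> simps T n" "t \<in> standard_simplex m"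
    then show "realization_point N m (quotients G m (act T m n \<theta> g)) t
       = realization_point N n (quotients G n g) (simplex_push m \<theta> t)"
      using realization_point_act[of \<theta> m n "quotients G n g" N t] quotients_in
      by (simp add: nerve_act_quotients tuple_carrier)
  qed
  then show ?thesis unfolding proj_def using assms by (rule realization_rec_point)
qed

lemma shift_point:
  assumes "h \<in> carrier G" "g \<in> simps T n" "t \<in> standard_simplex n"
  shows "shift h (realization_point T n g t) = realization_point T n (shift_tuple G h n g) t"
proof -
  have "glue_invariant T (\<lambda>n g. realization_point T n (shift_tuple G h n g))"
  proof (rule glue_invariantI)
    fix m n \<theta> g and t :: "nat \<Rightarrow> real"
    assume *: "\<theta> \<in> monotone_maps m n" "g \<in> simps T n" "t \<in> standard_simplex m"
    have "shift_tuple G h m (restrict (g \<circ> \<theta>) {..m}) = restrict (shift_tuple G h n g \<circ> \<theta>) {..m}"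
      using monotone_maps_bound[OF *(1)] by (auto simp: shift_tuple_def fun_eq_iff restrict_def)
    then show "realization_point T m (shift_tuple G h m (act T m n \<theta> g)) t
       = realization_point T n (shift_tuple G h n g) (simplex_push m \<theta> t)"
      using tuple_point_act[OF *(1) shift_in[OF assms(1) *(2)] *(3)] by simp
  qed
  then show ?thesis unfolding shift_def using assms(2,3) by (rule realization_rec_point)
qed

lemma shift_in_topspace:
  assumes "h \<in> carrier G" "c \<in> topspace (sset_realization T)"
  shows "shift h c \<in> topspace (sset_realization T)"
proof -
  obtain n g t where "g \<in> simps T n" "t \<in> standard_simplex n" "c = realization_point T n g t"
    using assms(2) unfolding in_topspace_realization by blast
  then show ?thesis
    using realization_point_in[OF shift_in[OF assms(1)]] shift_point[OF assms(1)] by simp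
qed

lemma continuous_map_shift:
  assumes h: "h \<in> carrier G"
  shows "continuous_map (sset_realization T) (sset_realization T) (shift h)"
proof (rule continuous_map_realization)
  fix n g assume g: "g \<in> simps T n"
  show "continuous_map (simplex_topology n) (sset_realization T) (\<lambda>t. shift h (realization_point T n g t))"
    using continuous_map_realization_point[OF shift_in[OF h g]]
    by (rule continuous_map_eq) (simp only: topspace_standard_simplex shift_point[OF h g])
qed

lemma continuous_map_proj: "continuous_map (sset_realization T) (sset_realization N) proj"
proof (rule continuous_map_realization)
  fix n g assume g: "g \<in> simps T n"
  show "continuous_map (simplex_topology n) (sset_realization N) (\<lambda>t. proj (realization_point T n g t))"
    using continuous_map_realization_point[OF quotients_in[OF g]]
    by (rule continuous_map_eq) (simp only: topspace_standard_simplex proj_point[OF g])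
qed

lemma proj_shift:
  assumes h: "h \<in> carrier G" and c: "c \<in> topspace (sset_realization T)"
  shows "proj (shift h c) = proj c"
proof -
  obtain n g t where g: "g \<in> simps T n" "t \<in> standard_simplex n" "c = realization_point T n g t"
    using c unfolding in_topspace_realization by blast
  then show ?thesis
    by (simp only: shift_point[OF h] proj_point shift_in[OF h] quotients_shift[OF h tuple_carrier])
qed

lemma proj_surj:
  assumes x: "x \<in> topspace (sset_realization N)"
  obtains c where "c \<in> topspace (sset_realization T)" "proj c = x"
proof -
  obtain n g t where g: "g \<in> simps T n" "t \<in> standard_simplex n" "x = realization_point N n (quotients G n g) t"
    using x unfolding in_topspace_realization simps_quotient_sset by blast
  show ?thesis
    by (rule that[OF realization_point_in[OF g(1,2)]]) (simp add: g proj_point)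
qed

text \<open>A zigzag of gluings between the images is lifted step by step to representatives of the
  fixed point \<open>c\<close>. At its end \<open>c\<close> and \<open>c'\<close> have
  representatives with the same coordinates and the same quotients, hence differ by a
  translation.\<close>

lemma proj_eq_imp_shift:
  assumes c: "c \<in> topspace (sset_realization T)" and c': "c' \<in> topspace (sset_realization T)"
    and eq: "proj c = proj c'"
  obtains h where "h \<in> carrier G" "c' = shift h c"
proof -
  obtain n g t where g: "g \<in> simps T n" "t \<in> standard_simplex n" "c = realization_point T n g t"
    using c unfolding in_topspace_realization by blast
  obtain n' g' t' where g': "g' \<in> simps T n'" "t' \<in> standard_simplex n'" "c' = realization_point T n' g' t'"
    using c' unfolding in_topspace_realization by blast
  have "(((n, quotients G n g), t), ((n', quotients G n' g'), t')) \<in> (glue N \<union> (glue N)\<inverse>)\<^sup>*"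
    using eq g g' by (simp add: proj_point realization_point_eq_iff glue_equiv_def)
  \<comment> \<open>The induction invariant: \<open>c\<close> has a representative with the current
    coordinates whose quotients are the current list.\<close>
  then have "case ((n', quotients G n' g'), t') of ((n, x), t) \<Rightarrow>
     t \<in> standard_simplex n \<and> (\<exists>f\<in>simps T n. quotients G n f = x \<and> realization_point T n f t = c)"
  proof (induction rule: rtrancl_induct)
    case base
    then show ?case using g by auto
  next
    case (step y z)
    from step.hyps(2) show ?case
    proof
      assume "(y, z) \<in> glue N"
      then obtain m p \<theta> f t where y: "y = ((m, nerve_act G m \<theta> (quotients G p f)), t)"
        and z: "z = ((p, quotients G p f), simplex_push m \<theta> t)"
        and \<theta>: "\<theta> \<in> monotone_maps m p" and f: "f \<in> simps T p" and t: "t \<in> standard_simplex m"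
        unfolding glue_def by (auto simp: simps_quotient_sset)
      let ?f = "restrict (f \<circ> \<theta>) {..m}"
      have f': "?f \<in> simps T m" by (rule act_tuple_in[OF complex monotone_maps_image[OF \<theta>] f])
      obtain k where k: "k \<in> simps T m" "quotients G m k = quotients G m ?f" "realization_point T m k t = c"
        using step.IH y nerve_act_quotients[OF \<theta> tuple_carrier[OF f]] by auto
      \<comment> \<open>The lift \<open>k\<close> has the same quotients as the face
        \<open>?f\<close> but need not equal it. It is the corresponding face of the translate of
        \<open>f\<close> by \<open>h\<close>.\<close>
      define h where "h = k 0 \<otimes> inv (?f 0)"
      have "k = shift_tuple G h m ?f"
        unfolding h_def by (rule quotients_eq_imp_shift[OF tuple_carrier[OF f'] _ tuple_carrier[OF k(1)] _ k(2)[symmetric]])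
          (use f' k(1) in \<open>simp_all add: simps_tuple\<close>)
      also have "\<dots> = restrict (shift_tuple G h p f \<circ> \<theta>) {..m}"
        using monotone_maps_bound[OF \<theta>] by (auto simp: shift_tuple_def fun_eq_iff restrict_def)
      finally have ke: "k = restrict (shift_tuple G h p f \<circ> \<theta>) {..m}" .
      have h: "h \<in> carrier G"
        using tuple_carrier[OF k(1)] tuple_carrier[OF f'] unfolding h_def by (intro m_closed inv_closed) auto
      have "realization_point T p (shift_tuple G h p f) (simplex_push m \<theta> t) = c"
        using tuple_point_act[OF \<theta> shift_in[OF h f] t] k(3) by (simp flip: ke)
      then show ?thesis
        using shift_in[OF h f] quotients_shift[OF h tuple_carrier[OF f]]
          simplex_push_in_simplex[OF monotone_maps_image[OF \<theta>] t] by (auto simp: z)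
    next
      assume "(y, z) \<in> (glue N)\<inverse>"
      then obtain m p \<theta> x t where z: "z = ((m, nerve_act G m \<theta> x), t)"
        and y: "y = ((p, x), simplex_push m \<theta> t)"
        and \<theta>: "\<theta> \<in> monotone_maps m p" and t: "t \<in> standard_simplex m"
        unfolding glue_def by auto
      obtain f where f: "f \<in> simps T p" "quotients G p f = x" "realization_point T p f (simplex_push m \<theta> t) = c"
        using step.IH y by auto
      then show ?thesis
        using t z act_tuple_in[OF complex monotone_maps_image[OF \<theta>] f(1)] tuple_point_act[OF \<theta> f(1) t]
          nerve_act_quotients[OF \<theta> tuple_carrier[OF f(1)]]
        by (auto intro!: bexI[of _ "restrict (f \<circ> \<theta>) {..m}"])
    qed
  qed
  then obtain f where f: "f \<in> simps T n'" "quotients G n' f = quotients G n' g'" "realization_point T n' f t' = c"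
    by auto
  define h where "h = g' 0 \<otimes> inv (f 0)"
  have "g' = shift_tuple G h n' f"
    unfolding h_def by (rule quotients_eq_imp_shift[OF tuple_carrier[OF f(1)] _ tuple_carrier[OF g'(1)] _ f(2)])
      (use f(1) g'(1) in \<open>simp_all add: simps_tuple\<close>)
  moreover have h: "h \<in> carrier G"
    using tuple_carrier[OF g'(1)] tuple_carrier[OF f(1)] unfolding h_def by (intro m_closed inv_closed) auto
  ultimately have "c' = shift h c"
    using f g' by (auto simp: shift_point)
  then show ?thesis using that h by blast
qed

lemma open_map_proj:
  assumes U: "openin (sset_realization T) U"
  shows "openin (sset_realization N) (proj ` U)"
  unfolding openin_realization[of N]
proof (intro conjI allI ballI)
  have Usub: "U \<subseteq> topspace (sset_realization T)" using U by (rule openin_subset)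
  then show "proj ` U \<subseteq> topspace (sset_realization N)"
    using continuous_map_proj by (auto simp: continuous_map_def)
  fix n x assume "x \<in> simps N n"
  then obtain g where g: "g \<in> simps T n" "x = quotients G n g" by (auto simp: simps_quotient_sset)
  have "{t \<in> standard_simplex n. realization_point N n x t \<in> proj ` U} =
     (\<Union>h\<in>carrier G. {t \<in> standard_simplex n. realization_point T n (shift_tuple G h n g) t \<in> U})"
  proof (intro equalityI subsetI)
    fix t assume "t \<in> {t \<in> standard_simplex n. realization_point N n x t \<in> proj ` U}"
    then obtain c where t: "t \<in> standard_simplex n" and c: "c \<in> U" "realization_point N n x t = proj c" by auto
    have in1: "realization_point T n g t \<in> topspace (sset_realization T)" and in2: "c \<in> topspace (sset_realization T)"
      using realization_point_in[OF g(1) t] c(1) Usub by blast+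
    have "proj (realization_point T n g t) = proj c" unfolding proj_point[OF g(1) t] using c(2) g(2) by simp
    then obtain h where h: "h \<in> carrier G" "c = shift h (realization_point T n g t)"
      by (rule proj_eq_imp_shift[OF in1 in2])
    then have "realization_point T n (shift_tuple G h n g) t \<in> U"
      using c(1) shift_point[OF h(1) g(1) t] by simp
    then show "t \<in> (\<Union>h\<in>carrier G. {t \<in> standard_simplex n. realization_point T n (shift_tuple G h n g) t \<in> U})"
      using t h(1) by blast
  next
    fix t assume "t \<in> (\<Union>h\<in>carrier G. {t \<in> standard_simplex n. realization_point T n (shift_tuple G h n g) t \<in> U})"
    then obtain h where h: "h \<in> carrier G" "t \<in> standard_simplex n" "realization_point T n (shift_tuple G h n g) t \<in> U"
      by auto
    have "proj (realization_point T n (shift_tuple G h n g) t) = realization_point N n x t"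
      unfolding proj_point[OF shift_in[OF h(1) g(1)] h(2)] quotients_shift[OF h(1) tuple_carrier[OF g(1)]] g(2) ..
    then have "realization_point N n x t \<in> proj ` U" using h(3) by (metis image_eqI)
    then show "t \<in> {t \<in> standard_simplex n. realization_point N n x t \<in> proj ` U}" using h(2) by simp
  qed
  moreover have "openin (simplex_topology n) {t \<in> standard_simplex n. realization_point T n (shift_tuple G h n g) t \<in> U}"
    if "h \<in> carrier G" for h
    using U shift_in[OF that g(1)] unfolding openin_realization by blast
  ultimately show "openin (simplex_topology n) {t \<in> standard_simplex n. realization_point N n x t \<in> proj ` U}"
    by (simp only:) (rule openin_Union, blast)
qed

end

subsection \<open>Step functions\<close>

text \<open>A point \<open>[g, t]\<close> determines the step function on \<open>[0, 1)\<close> that takes the value \<open>g i\<close> on an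
  interval of length \<open>t i\<close>, for \<open>i = 0, \<dots>, n\<close> in this order; gluing does not change it. The measure of
  the set where two step functions differ serves as a distance. Distinct points with the same image in
  the quotient by \<open>G\<close> have distance 1, so the quotient map is injective on open balls of radius 1/2.\<close>

definition step_index :: "(nat \<Rightarrow> real) \<Rightarrow> real \<Rightarrow> nat" where
  "step_index t r = (LEAST i. r < sum t {..i})"

lemma step_index_works:
  assumes "t \<in> standard_simplex n" "r < 1"
  shows "r < sum t {..step_index t r}" "step_index t r \<le> n"
proof -
  have *: "r < sum t {..n}" using assms by (simp add: standard_simplex_def)
  then show "r < sum t {..step_index t r}" unfolding step_index_def
    by (rule LeastI[of "\<lambda>i. r < sum t {..i}" n])
  show "step_index t r \<le> n" unfolding step_index_def using * by (rule Least_le[of "\<lambda>i. r < sum t {..i}" n])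
qed

lemma step_index_less: "i < step_index t r \<Longrightarrow> sum t {..i} \<le> r"
  unfolding step_index_def using not_less_Least[of i "\<lambda>i. r < sum t {..i}"] by simp

text \<open>Monotonicity of \<open>\<theta>\<close> is decisive: a partial sum of the pushed weights
  is the sum of \<open>t\<close> over an initial segment of indices. The strict inequality in
  \<open>step_index\<close> skips entries of weight zero.\<close>

lemma step_index_push:
  assumes \<theta>: "\<theta> \<in> monotone_maps m n" and t: "t \<in> standard_simplex m" and r: "0 \<le> r" "r < 1"
  shows "step_index (simplex_push m \<theta> t) r = \<theta> (step_index t r)"
proof -
  let ?i = "step_index t r"
  have nn: "0 \<le> t i" for i using t by (simp add: standard_simplex_def)
  have i: "r < sum t {..?i}" "?i \<le> m" using step_index_works[OF t r(2)] by auto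
  have cum: "sum (simplex_push m \<theta> t) {..j} = (\<Sum>i | i \<le> m \<and> \<theta> i \<le> j. t i)" if "j \<le> n" for j
    using sum_simplex_push[OF monotone_maps_image[OF \<theta>], of "{..j}" t] that by simp
  show ?thesis
    unfolding step_index_def[of "simplex_push m \<theta> t"]
  proof (rule Least_equality)
    have "sum t {..?i} \<le> (\<Sum>i | i \<le> m \<and> \<theta> i \<le> \<theta> ?i. t i)"
      by (rule sum_mono2) (use nn i(2) monotone_maps_le[OF \<theta>] in auto)
    then show "r < sum (simplex_push m \<theta> t) {..\<theta> ?i}"
      using i cum[OF monotone_maps_bound[OF \<theta> i(2)]] by simp
  next
    fix j assume j: "r < sum (simplex_push m \<theta> t) {..j}"
    show "\<theta> ?i \<le> j"
    proof (rule ccontr)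
      assume "\<not> \<theta> ?i \<le> j"
      then have "j < \<theta> ?i" by simp
      then have "sum (simplex_push m \<theta> t) {..j} = (\<Sum>i | i \<le> m \<and> \<theta> i \<le> j. t i)"
        using cum monotone_maps_bound[OF \<theta> i(2)] by simp
      \<comment> \<open>An index \<open>i\<close> with \<open>\<theta> i \<le> j\<close> lies below
        \<open>?i\<close>, because \<open>j < \<theta> ?i\<close> and \<open>\<theta>\<close> is
        monotone.\<close>
      also have "\<dots> \<le> sum t {..<?i}"
      proof (rule sum_mono2)
        show "{i. i \<le> m \<and> \<theta> i \<le> j} \<subseteq> {..<?i}"
        proof
          fix i assume "i \<in> {i. i \<le> m \<and> \<theta> i \<le> j}"
          then show "i \<in> {..<?i}"
            using monotone_maps_le[OF \<theta>, of ?i i] \<open>j < \<theta> ?i\<close> by (cases "?i \<le> i") auto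
        qed
      qed (use nn in auto)
      also have "\<dots> \<le> r"
      proof (cases ?i)
        case (Suc k)
        then have "sum t {..k} \<le> r" using step_index_less[of k t r] by simp
        then show ?thesis unfolding Suc by (simp add: lessThan_Suc_atMost)
      qed (use r in simp)
      finally show False using j by simp
    qed
  qed
qed

definition step_value :: "'a set set \<Rightarrow> (nat \<Rightarrow> 'a) realization_point \<Rightarrow> real \<Rightarrow> 'a" where
  "step_value K c r = realization_rec (tuple_sset K) (\<lambda>n g t. g (step_index t r)) c"

lemma step_value_point:
  assumes r: "0 \<le> r" "r < 1" and g: "g \<in> simps (tuple_sset K) n" and t: "t \<in> standard_simplex n"
  shows "step_value K (realization_point (tuple_sset K) n g t) r = g (step_index t r)"
proof -
  have "glue_invariant (tuple_sset K) (\<lambda>n g t. g (step_index t r))"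
  proof (rule glue_invariantI)
    fix m n \<theta> g and t :: "nat \<Rightarrow> real"
    assume "\<theta> \<in> monotone_maps m n" "g \<in> simps (tuple_sset K) n" "t \<in> standard_simplex m"
    then show "act (tuple_sset K) m n \<theta> g (step_index t r) = g (step_index (simplex_push m \<theta> t) r)"
      using step_index_works[of t m r] r by (simp add: step_index_push)
  qed
  then show ?thesis unfolding step_value_def using g t by (rule realization_rec_point)
qed

definition step_differ :: "'a set set \<Rightarrow> (nat \<Rightarrow> 'a) realization_point \<Rightarrow> (nat \<Rightarrow> 'a) realization_point \<Rightarrow> real set" where
  "step_differ K c c' = {r \<in> {0..<1}. step_value K c r \<noteq> step_value K c' r}"

definition step_dist :: "'a set set \<Rightarrow> (nat \<Rightarrow> 'a) realization_point \<Rightarrow> (nat \<Rightarrow> 'a) realization_point \<Rightarrow> real" where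
  "step_dist K c c' = measure lborel (step_differ K c c')"

lemma measurable_step_index [measurable]: "step_index t \<in> borel \<rightarrow>\<^sub>M count_space UNIV"
  unfolding step_index_def
proof (rule measurable_Least)
  show "Measurable.pred borel (\<lambda>r. r < sum t {..i})" for i
  proof -
    have "{r \<in> space borel. r < sum t {..i}} = {..<sum t {..i}}" by auto
    then show ?thesis unfolding pred_def by simp
  qed
qed

lemma step_differ_point:
  assumes "g \<in> simps (tuple_sset K) n" "t \<in> standard_simplex n" "g' \<in> simps (tuple_sset K) n'" "t' \<in> standard_simplex n'"
  shows "step_differ K (realization_point (tuple_sset K) n g t) (realization_point (tuple_sset K) n' g' t')
    = {r \<in> {0..<1}. g (step_index t r) \<noteq> g' (step_index t' r)}"
  using assms by (auto simp: step_differ_def step_value_point)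

text \<open>Points of discrepancy are sorted by the pair of indices at which the two tuples are
  read; there are only countably many pairs.\<close>

lemma step_differ_sets:
  assumes "c \<in> topspace (sset_realization (tuple_sset K))" "c' \<in> topspace (sset_realization (tuple_sset K))"
  shows "step_differ K c c' \<in> sets lborel"
proof -
  obtain n g t where g: "g \<in> simps (tuple_sset K) n" "t \<in> standard_simplex n" "c = realization_point (tuple_sset K) n g t"
    using assms(1) unfolding in_topspace_realization by blast
  obtain n' g' t' where g': "g' \<in> simps (tuple_sset K) n'" "t' \<in> standard_simplex n'" "c' = realization_point (tuple_sset K) n' g' t'"
    using assms(2) unfolding in_topspace_realization by blast
  have "step_differ K c c' = {0..<1} \<inter> (\<Union>(i, j)\<in>{(i, j). g i \<noteq> g' j}. step_index t -` {i} \<inter> step_index t' -` {j})"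
    unfolding g(3) g'(3) step_differ_point[OF g(1,2) g'(1,2)] by auto
  moreover have "step_index s -` {i} \<in> sets borel" for s i
    using measurable_sets[OF measurable_step_index, of "{i}" s] by simp
  then have "(\<Union>(i, j)\<in>{(i, j). g i \<noteq> g' j}. step_index t -` {i} \<inter> step_index t' -` {j}) \<in> sets borel"
    by (intro sets.countable_UN'') auto
  ultimately show ?thesis by simp
qed

lemma step_dist_commute: "step_dist K c c' = step_dist K c' c"
  unfolding step_dist_def step_differ_def by (rule arg_cong[where f = "measure lborel"]) auto

lemma step_dist_triangle:
  assumes "c \<in> topspace (sset_realization (tuple_sset K))" "c' \<in> topspace (sset_realization (tuple_sset K))"
    "c'' \<in> topspace (sset_realization (tuple_sset K))"
  shows "step_dist K c c'' \<le> step_dist K c c' + step_dist K c' c''"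
proof -
  have "{0..<1::real} \<in> fmeasurable lborel" by (simp add: fmeasurable_def)
  moreover have sub: "step_differ K c c' \<union> step_differ K c' c'' \<subseteq> {0..<1}" by (auto simp: step_differ_def)
  moreover have sets: "step_differ K c c' \<in> sets lborel" "step_differ K c' c'' \<in> sets lborel"
    "step_differ K c c'' \<in> sets lborel"
    using assms step_differ_sets by auto
  ultimately have "step_differ K c c' \<union> step_differ K c' c'' \<in> fmeasurable lborel"
    by (metis fmeasurableI2 sets.Un)
  moreover have "step_differ K c c'' \<subseteq> step_differ K c c' \<union> step_differ K c' c''"
    by (auto simp: step_differ_def)
  ultimately have "step_dist K c c'' \<le> measure lborel (step_differ K c c' \<union> step_differ K c' c'')"
    unfolding step_dist_def using sets by (intro measure_mono_fmeasurable) auto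
  also have "\<dots> \<le> step_dist K c c' + step_dist K c' c''"
    unfolding step_dist_def using sets by (intro measure_Un_le)
  finally show ?thesis .
qed

text \<open>If the two indices at \<open>r\<close> differ, then \<open>r\<close> lies between the
  two partial sums taken at the smaller index. The discrepancy is covered by these finitely many
  intervals.\<close>

lemma step_dist_same_tuple:
  assumes g: "g \<in> simps (tuple_sset K) n" and t: "t \<in> standard_simplex n" and t': "t' \<in> standard_simplex n"
  shows "step_dist K (realization_point (tuple_sset K) n g t) (realization_point (tuple_sset K) n g t')
    \<le> (\<Sum>i\<le>n. \<bar>sum t {..i} - sum t' {..i}\<bar>)"
proof -
  let ?I = "\<lambda>i. {min (sum t {..i}) (sum t' {..i})..max (sum t {..i}) (sum t' {..i})}"
  let ?D = "step_differ K (realization_point (tuple_sset K) n g t) (realization_point (tuple_sset K) n g t')"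
  have "?D \<subseteq> (\<Union>i\<le>n. ?I i)"
  proof
    fix r assume "r \<in> ?D"
    then have r: "0 \<le> r" "r < 1" and "g (step_index t r) \<noteq> g (step_index t' r)"
      using step_differ_point[OF g t g t'] by auto
    then have "step_index t r \<noteq> step_index t' r" by auto
    then consider "step_index t r < step_index t' r" | "step_index t' r < step_index t r" by linarith
    then show "r \<in> (\<Union>i\<le>n. ?I i)"
    proof cases
      case 1
      then have "r \<in> ?I (step_index t r)" using step_index_less[OF 1] step_index_works(1)[OF t r(2)] by auto
      then show ?thesis using step_index_works(2)[OF t r(2)] by blast
    next
      case 2
      then have "r \<in> ?I (step_index t' r)" using step_index_less[OF 2] step_index_works(1)[OF t' r(2)] by auto
      then show ?thesis using step_index_works(2)[OF t' r(2)] by blast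
    qed
  qed
  moreover have "?D \<in> sets lborel" using g t t' by (intro step_differ_sets) auto
  moreover have "(\<Union>i\<le>n. ?I i) \<in> fmeasurable lborel"
    by (intro fmeasurable.finite_UN) (auto simp: fmeasurable_def)
  ultimately have "measure lborel ?D \<le> measure lborel (\<Union>i\<le>n. ?I i)" by (rule measure_mono_fmeasurable)
  also have "\<dots> \<le> (\<Sum>i\<le>n. measure lborel (?I i))" by (rule measure_UNION_le) auto
  also have "\<dots> = (\<Sum>i\<le>n. \<bar>sum t {..i} - sum t' {..i}\<bar>)" by (intro sum.cong) auto
  finally show ?thesis unfolding step_dist_def .
qed

lemma step_dist_self [simp]: "step_dist K c c = 0"
  by (simp add: step_dist_def step_differ_def)

text \<open>On each simplex the distance to a fixed point \<open>?p t0\<close> is bounded by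
  \<open>u\<close>, a continuous function of the coordinates that vanishes at \<open>t0\<close>; the
  triangle inequality does the rest.\<close>

lemma openin_step_ball:
  assumes c0: "c0 \<in> topspace (sset_realization (tuple_sset K))"
  shows "openin (sset_realization (tuple_sset K)) {c \<in> topspace (sset_realization (tuple_sset K)). step_dist K c c0 < \<epsilon>}"
  unfolding openin_realization
proof (intro conjI allI ballI)
  fix n g assume g: "g \<in> simps (tuple_sset K) n"
  let ?p = "realization_point (tuple_sset K) n g"
  have eq: "{t \<in> standard_simplex n. ?p t \<in> {c \<in> topspace (sset_realization (tuple_sset K)). step_dist K c c0 < \<epsilon>}}
     = {t \<in> standard_simplex n. step_dist K (?p t) c0 < \<epsilon>}" (is "_ = ?S") using g by auto
  have "openin (simplex_topology n) ?S"
  proof (subst openin_subopen, rule ballI)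
    fix t0 assume t0: "t0 \<in> ?S"
    define u where "u t = (\<Sum>i\<le>n. \<bar>sum t {..i} - sum t0 {..i}\<bar>)" for t :: "nat \<Rightarrow> real"
    have "continuous_map (simplex_topology n) euclideanreal u"
      unfolding u_def
      by (intro continuous_map_sum continuous_map_real_abs continuous_map_diff continuous_map_simplex_coordinate) auto
    then have "openin (simplex_topology n) {t \<in> topspace (simplex_topology n). u t \<in> {..<\<epsilon> - step_dist K (?p t0) c0}}"
      by (rule openin_continuous_map_preimage) simp
    moreover have "t \<in> ?S" if "t \<in> standard_simplex n" "u t < \<epsilon> - step_dist K (?p t0) c0" for t
      using step_dist_triangle[of "?p t" K "?p t0" c0] step_dist_same_tuple[OF g that(1), of t0] that c0 g t0
      by (auto simp: u_def)
    ultimately show "\<exists>V. openin (simplex_topology n) V \<and> t0 \<in> V \<and> V \<subseteq> ?S"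
      using t0 by (intro exI[of _ "{t \<in> topspace (simplex_topology n). u t \<in> {..<\<epsilon> - step_dist K (?p t0) c0}}"])
        (auto simp: u_def)
  qed
  then show "openin (simplex_topology n) {t \<in> standard_simplex n. ?p t \<in> {c \<in> topspace (sset_realization (tuple_sset K)). step_dist K c c0 < \<epsilon>}}"
    unfolding eq .
qed auto

subsection \<open>The compact-open topology on paths\<close>

lemma openin_mapping_space_subbasis:
  assumes "compactin X C" "openin Y U"
  shows "openin (mapping_space X Y) {f \<in> extensional (topspace X). continuous_map X Y f \<and> f ` C \<subseteq> U}"
  unfolding mapping_space_def by (rule topology_generated_by_Basis) (use assms in blast)

lemma unit_interval_neighbourhood:
  assumes "openin unit_interval U" "s \<in> U"
  obtains d where "d > 0" "\<And>s'. s' \<in> {0..1} \<Longrightarrow> \<bar>s' - s\<bar> < d \<Longrightarrow> s' \<in> U"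
  using assms that unfolding openin_euclidean_subtopology_iff dist_real_def by metis

lemma compactin_unit_interval: "compactin unit_interval ({a..b} \<inter> {0..1})"
  by (simp add: compactin_subtopology compact_Int_closed)

text \<open>Local compactness of the interval supplies a compact neighbourhood of \<open>s\<close>
  mapped into \<open>U\<close>, and this condition is subbasic.\<close>

lemma continuous_map_evaluation:
  "continuous_map (prod_topology (mapping_space unit_interval Y) unit_interval) Y (\<lambda>(\<gamma>, s). \<gamma> s)"
  unfolding continuous_map_def
proof (intro conjI allI impI)
  show "(\<lambda>(\<gamma>, s). \<gamma> s) \<in> topspace (prod_topology (mapping_space unit_interval Y) unit_interval) \<rightarrow> topspace Y"
    by (auto simp: continuous_map_def)
  fix U assume U: "openin Y U"
  show "openin (prod_topology (mapping_space unit_interval Y) unit_interval)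
     {x \<in> topspace (prod_topology (mapping_space unit_interval Y) unit_interval). (case x of (\<gamma>, s) \<Rightarrow> \<gamma> s) \<in> U}"
    (is "openin _ ?S")
    unfolding openin_prod_topology_alt
  proof (intro allI impI)
    fix \<gamma> s assume "(\<gamma>, s) \<in> ?S"
    then have \<gamma>: "\<gamma> \<in> extensional {0..1}" "continuous_map unit_interval Y \<gamma>" and s: "s \<in> {0..1}" "\<gamma> s \<in> U" by auto
    have "openin unit_interval {s \<in> topspace unit_interval. \<gamma> s \<in> U}"
      by (rule openin_continuous_map_preimage[OF \<gamma>(2) U])
    then obtain d where d: "d > 0" "\<And>s'. s' \<in> {0..1} \<Longrightarrow> \<bar>s' - s\<bar> < d \<Longrightarrow> \<gamma> s' \<in> U"
      using s by (rule_tac unit_interval_neighbourhood[of "{s \<in> topspace unit_interval. \<gamma> s \<in> U}" s]) auto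
    \<comment> \<open>Half the radius keeps the closed interval inside the region controlled by
      \<open>d\<close>, while its interior still contains \<open>s\<close>.\<close>
    let ?C = "{s - d/2..s + d/2} \<inter> {0..1}"
    let ?V = "{f \<in> extensional (topspace unit_interval). continuous_map unit_interval Y f \<and> f ` ?C \<subseteq> U}"
    have 1: "openin (mapping_space unit_interval Y) ?V"
      by (rule openin_mapping_space_subbasis[OF compactin_unit_interval U])
    have 2: "openin unit_interval ({s - d/2<..<s + d/2} \<inter> {0..1})"
      by (metis Int_commute open_greaterThanLessThan openin_open_Int)
    have "\<gamma> ` ?C \<subseteq> U"
    proof
      fix y assume "y \<in> \<gamma> ` ?C"
      then obtain s' where s': "y = \<gamma> s'" "s' \<in> {0..1}" "s - d/2 \<le> s'" "s' \<le> s + d/2" by auto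
      then have "\<bar>s' - s\<bar> < d" using d(1) by (simp add: abs_less_iff)
      then show "y \<in> U" using d(2) s' by blast
    qed
    then show "\<exists>V W. openin (mapping_space unit_interval Y) V \<and> openin unit_interval W \<and> \<gamma> \<in> V \<and> s \<in> W \<and> V \<times> W \<subseteq> ?S"
      using 1 2 \<gamma> s d(1)
      by (intro exI[of _ ?V] exI[of _ "{s - d/2<..<s + d/2} \<inter> {0..1}"]) (auto simp: image_subset_iff)
  qed
qed

text \<open>The tube lemma in closed form: projection along the compact set \<open>C\<close> is a
  closed map, so the parameters whose path leaves \<open>U\<close> somewhere on \<open>C\<close>
  form a closed set.\<close>

lemma continuous_map_curry:
  assumes F: "continuous_map (prod_topology Z unit_interval) Y F"
  shows "continuous_map Z (mapping_space unit_interval Y) (\<lambda>z. restrict (\<lambda>u. F (z, u)) {0..1})"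
proof -
  have cont: "continuous_map unit_interval Y (restrict (\<lambda>u. F (z, u)) {0..1})" if "z \<in> topspace Z" for z
  proof -
    have "continuous_map unit_interval (prod_topology Z unit_interval) (\<lambda>u. (z, u))"
      using that by (intro continuous_map_pairedI) (auto simp: continuous_map_const)
    then have "continuous_map unit_interval Y (F \<circ> (\<lambda>u. (z, u)))" using F by (rule continuous_map_compose)
    then show ?thesis by (rule continuous_map_eq) auto
  qed
  show ?thesis
    unfolding mapping_space_def
  proof (rule continuous_on_generated_topo)
    fix S assume "S \<in> {{f \<in> extensional (topspace unit_interval). continuous_map unit_interval Y f \<and> f ` C \<subseteq> U} |C U.
       compactin unit_interval C \<and> openin Y U}"
    then obtain C U where S: "S = {f \<in> extensional (topspace unit_interval). continuous_map unit_interval Y f \<and> f ` C \<subseteq> U}"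
      and C: "compactin unit_interval C" and U: "openin Y U" by blast
    have C01: "C \<subseteq> {0..1}" using compactin_subset_topspace[OF C] by simp
    let ?Q = "prod_topology Z (subtopology unit_interval C)"
    have "continuous_map ?Q Y F"
      using continuous_map_from_subtopology[OF F, of "topspace Z \<times> C"]
      by (metis prod_topology_subtopology(2) subtopology_topspace subtopology_Times)
    then have "closedin ?Q {x \<in> topspace ?Q. F x \<in> topspace Y - U}"
      by (rule closedin_continuous_map_preimage) (use U in auto)
    moreover have "closed_map ?Q Z fst"
      by (rule Abstract_Topological_Spaces.closed_map_fst) (use C in \<open>simp add: compact_space_subtopology\<close>)
    ultimately have "closedin Z (fst ` {x \<in> topspace ?Q. F x \<in> topspace Y - U})"
      unfolding closed_map_def by blast
    then have "openin Z (topspace Z - fst ` {x \<in> topspace ?Q. F x \<in> topspace Y - U})" by blast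
    moreover have "topspace Z - fst ` {x \<in> topspace ?Q. F x \<in> topspace Y - U}
       = (\<lambda>z. restrict (\<lambda>u. F (z, u)) {0..1}) -` S \<inter> topspace Z"
    proof -
      have inY: "F (z, u) \<in> topspace Y" if "z \<in> topspace Z" "u \<in> {0..1}" for z u
        using F that by (auto simp: continuous_map_def)
      have A: "z \<in> topspace Z - fst ` {x \<in> topspace ?Q. F x \<in> topspace Y - U} \<longleftrightarrow> (\<forall>u\<in>C. F (z, u) \<in> U)"
        if "z \<in> topspace Z" for z
        using that C01 inY by (force simp: image_iff)
      have B: "restrict (\<lambda>u. F (z, u)) {0..1} \<in> S \<longleftrightarrow> (\<forall>u\<in>C. F (z, u) \<in> U)" if "z \<in> topspace Z" for z
        using that C01 cont[OF that] unfolding S by (auto simp: subset_iff)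
      show ?thesis
      proof (rule Set.set_eqI)
        fix z show "z \<in> topspace Z - fst ` {x \<in> topspace ?Q. F x \<in> topspace Y - U} \<longleftrightarrow>
          z \<in> (\<lambda>z. restrict (\<lambda>u. F (z, u)) {0..1}) -` S \<inter> topspace Z"
        proof (cases "z \<in> topspace Z")
          case True
          then show ?thesis using A B by (simp only: vimage_eq Int_iff simp_thms)
        next
          case False
          then show ?thesis by (simp only: Diff_iff Int_iff simp_thms)
        qed
      qed
    qed
    ultimately show "openin Z ((\<lambda>z. restrict (\<lambda>u. F (z, u)) {0..1}) -` S \<inter> topspace Z)" by simp
  next
    have "\<Union> {{f \<in> extensional (topspace unit_interval). continuous_map unit_interval Y f \<and> f ` C \<subseteq> U} |C U.
       compactin unit_interval C \<and> openin Y U} = topspace (mapping_space unit_interval Y)"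
      unfolding mapping_space_def topology_generated_by_topspace ..
    then show "(\<lambda>z. restrict (\<lambda>u. F (z, u)) {0..1}) ` topspace Z
      \<subseteq> \<Union> {{f \<in> extensional (topspace unit_interval). continuous_map unit_interval Y f \<and> f ` C \<subseteq> U} |C U.
         compactin unit_interval C \<and> openin Y U}"
      using cont by auto
  qed
qed

subsection \<open>Lifting\<close>

context translation_complex
begin

abbreviation "X \<equiv> sset_realization T"
abbreviation "Y \<equiv> sset_realization N"
abbreviation "d \<equiv> step_dist K"

lemma step_value_shift:
  assumes h: "h \<in> carrier G" and c: "c \<in> topspace X" and r: "0 \<le> r" "r < 1"
  shows "step_value K (shift h c) r = h \<otimes> step_value K c r" "step_value K c r \<in> carrier G"
proof -
  obtain n g t where g: "g \<in> simps T n" "t \<in> standard_simplex n" "c = realization_point T n g t"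
    using c unfolding in_topspace_realization by blast
  have i: "step_index t r \<le> n" using step_index_works[OF g(2) r(2)] by simp
  show "step_value K (shift h c) r = h \<otimes> step_value K c r"
    unfolding g(3) shift_point[OF h g(1,2)] step_value_point[OF r g(1,2)] step_value_point[OF r shift_in[OF h g(1)] g(2)]
    using i by (simp add: shift_tuple_def)
  show "step_value K c r \<in> carrier G"
    unfolding g(3) step_value_point[OF r g(1,2)] using tuple_carrier[OF g(1)] i by auto
qed

lemma shift_one: "c \<in> topspace X \<Longrightarrow> shift \<one> c = c"
proof -
  assume "c \<in> topspace X"
  then obtain n g t where g: "g \<in> simps T n" "t \<in> standard_simplex n" "c = realization_point T n g t"
    unfolding in_topspace_realization by blast
  have "shift_tuple G \<one> n g = g"
    using g(1) tuple_carrier[OF g(1)] by (auto simp: shift_tuple_def simps_tuple fun_eq_iff extensional_def)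
  then show "shift \<one> c = c" unfolding g(3) shift_point[OF one_closed g(1,2)] by simp
qed

text \<open>Left multiplication by \<open>h \<noteq> \<one>\<close> changes the value of the step
  function at every parameter, so the discrepancy is all of \<open>[0, 1)\<close>.\<close>

lemma step_dist_shift:
  assumes h: "h \<in> carrier G" "h \<noteq> \<one>" and c: "c \<in> topspace X"
  shows "d c (shift h c) = 1"
proof -
  have "step_differ K c (shift h c) = {0..<1}"
  proof -
    have "step_value K c r \<noteq> step_value K (shift h c) r" if "0 \<le> r" "r < 1" for r
      using step_value_shift[OF h(1) c that] h by (metis r_cancel_one')
    then show ?thesis by (auto simp: step_differ_def)
  qed
  then show ?thesis by (simp add: step_dist_def)
qed

lemma proj_eq_cases:
  assumes "c \<in> topspace X" "c' \<in> topspace X" "proj c = proj c'"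
  shows "c = c' \<or> d c c' = 1"
proof -
  obtain h where h: "h \<in> carrier G" "c' = shift h c" using proj_eq_imp_shift[OF assms] .
  then show ?thesis using step_dist_shift[OF h(1) _ assms(1)] shift_one[OF assms(1)] by (cases "h = \<one>") auto
qed

text \<open>For \<open>c\<close> in the open set \<open>B\<close> around \<open>F w0\<close>, a
  point \<open>F w\<close> in the same fibre as \<open>c\<close> is less than 1 from it, hence
  equals it. Openness of \<open>proj\<close> shows that such a \<open>c\<close> exists for
  \<open>w\<close> near \<open>w0\<close>; closeness in \<open>d\<close> alone would not place
  \<open>F w\<close> in \<open>U\<close>.\<close>

lemma continuous_map_lift:
  assumes F: "F \<in> topspace W \<rightarrow> topspace X" and pF: "continuous_map W Y (\<lambda>w. proj (F w))"
    and close: "\<And>w0. w0 \<in> topspace W \<Longrightarrow> \<exists>V. openin W V \<and> w0 \<in> V \<and> (\<forall>w\<in>V. d (F w) (F w0) < 1/2)"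
  shows "continuous_map W X F"
  unfolding continuous_map_def
proof (intro conjI allI impI F)
  fix U assume U: "openin X U"
  show "openin W {w \<in> topspace W. F w \<in> U}"
  proof (subst openin_subopen, rule ballI)
    fix w0 assume "w0 \<in> {w \<in> topspace W. F w \<in> U}"
    then have w0: "w0 \<in> topspace W" "F w0 \<in> U" by auto
    then have Fw0: "F w0 \<in> topspace X" using F by auto
    obtain V where V: "openin W V" "w0 \<in> V" "\<And>w. w \<in> V \<Longrightarrow> d (F w) (F w0) < 1/2" using close[OF w0(1)] by blast
    define B where "B = U \<inter> {c \<in> topspace X. d c (F w0) < 1/2}"
    have B: "openin X B" unfolding B_def by (intro openin_Int U openin_step_ball Fw0)
    have "openin W {w \<in> topspace W. proj (F w) \<in> proj ` B}"
      by (rule openin_continuous_map_preimage[OF pF open_map_proj[OF B]])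
    then have "openin W (V \<inter> {w \<in> topspace W. proj (F w) \<in> proj ` B})" using V by blast
    moreover have "w0 \<in> V \<inter> {w \<in> topspace W. proj (F w) \<in> proj ` B}" using V w0 Fw0 by (auto simp: B_def)
    moreover have "F w \<in> U" if w: "w \<in> V" "w \<in> topspace W" "proj (F w) \<in> proj ` B" for w
    proof -
      obtain c where c: "c \<in> B" "proj (F w) = proj c" using w by auto
      have inX: "F w \<in> topspace X" "c \<in> topspace X" using F w c by (auto simp: B_def)
      have "d (F w) c \<le> d (F w) (F w0) + d (F w0) c" by (rule step_dist_triangle[OF inX(1) Fw0 inX(2)])
      also have "\<dots> < 1" using V(3)[OF w(1)] c step_dist_commute[of K c "F w0"] by (simp add: B_def)
      finally show ?thesis using proj_eq_cases[OF inX c(2)] c by (auto simp: B_def)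
    qed
    ultimately show "\<exists>S. openin W S \<and> w0 \<in> S \<and> S \<subseteq> {w \<in> topspace W. F w \<in> U}"
      by (intro exI[of _ "V \<inter> {w \<in> topspace W. proj (F w) \<in> proj ` B}"]) auto
  qed
qed

section \<open>Uniqueness and existence of path lifts\<close>

lemma continuous_on_step_dist:
  assumes \<delta>: "continuous_map unit_interval X \<delta>" and \<delta>': "continuous_map unit_interval X \<delta>'"
  shows "continuous_on {0..1} (\<lambda>s. d (\<delta> s) (\<delta>' s))"
  unfolding continuous_on_iff
proof (intro ballI allI impI)
  fix s0 and \<epsilon> :: real assume s0: "s0 \<in> {0..1::real}" and "\<epsilon> > 0"
  have inX: "\<delta> s \<in> topspace X" "\<delta>' s \<in> topspace X" if "s \<in> {0..1}" for s
    using \<delta> \<delta>' that by (auto simp: continuous_map_def)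
  have near: "\<exists>e>0. \<forall>s\<in>{0..1}. \<bar>s - s0\<bar> < e \<longrightarrow> d (\<delta> s) (\<delta> s0) < \<epsilon>/2"
    if "continuous_map unit_interval X \<delta>" for \<delta>
  proof -
    have in1: "\<delta> s0 \<in> topspace X" using that s0 by (auto simp: continuous_map_def)
    have "openin unit_interval {s \<in> topspace unit_interval. \<delta> s \<in> {c \<in> topspace X. d c (\<delta> s0) < \<epsilon>/2}}"
      by (rule openin_continuous_map_preimage[OF that openin_step_ball[OF in1]])
    then obtain e where "e > 0" "\<And>s. s \<in> {0..1} \<Longrightarrow> \<bar>s - s0\<bar> < e \<Longrightarrow>
       s \<in> {s \<in> topspace unit_interval. \<delta> s \<in> {c \<in> topspace X. d c (\<delta> s0) < \<epsilon>/2}}"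
      by (rule unit_interval_neighbourhood[of _ s0]) (use s0 in1 \<open>\<epsilon> > 0\<close> in auto)
    then show ?thesis by (intro exI[of _ e]) auto
  qed
  obtain e e' where e: "e > 0" "\<And>s. s \<in> {0..1} \<Longrightarrow> \<bar>s - s0\<bar> < e \<Longrightarrow> d (\<delta> s) (\<delta> s0) < \<epsilon>/2"
    "e' > 0" "\<And>s. s \<in> {0..1} \<Longrightarrow> \<bar>s - s0\<bar> < e' \<Longrightarrow> d (\<delta>' s) (\<delta>' s0) < \<epsilon>/2"
    using near[OF \<delta>] near[OF \<delta>'] by metis
  show "\<exists>e>0. \<forall>s\<in>{0..1}. dist s s0 < e \<longrightarrow> dist (d (\<delta> s) (\<delta>' s)) (d (\<delta> s0) (\<delta>' s0)) < \<epsilon>"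
  proof (intro exI[of _ "min e e'"] conjI ballI impI)
    fix s :: real assume s: "s \<in> {0..1}" "dist s s0 < min e e'"
    note in4 = inX[OF s(1)] inX[OF s0]
    have "d (\<delta> s) (\<delta> s0) < \<epsilon>/2" "d (\<delta>' s) (\<delta>' s0) < \<epsilon>/2" using e s by (auto simp: dist_real_def)
    moreover have "d (\<delta> s) (\<delta>' s) \<le> d (\<delta> s) (\<delta> s0) + (d (\<delta> s0) (\<delta>' s0) + d (\<delta>' s0) (\<delta>' s))"
      using step_dist_triangle[OF in4(1,3,2)] step_dist_triangle[OF in4(3,4,2)] by simp
    moreover have "d (\<delta> s0) (\<delta>' s0) \<le> d (\<delta> s0) (\<delta> s) + (d (\<delta> s) (\<delta>' s) + d (\<delta>' s) (\<delta>' s0))"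
      using step_dist_triangle[OF in4(3,1,4)] step_dist_triangle[OF in4(1,2,4)] by simp
    ultimately show "dist (d (\<delta> s) (\<delta>' s)) (d (\<delta> s0) (\<delta>' s0)) < \<epsilon>"
      using step_dist_commute[of K "\<delta> s" "\<delta> s0"] step_dist_commute[of K "\<delta>' s" "\<delta>' s0"]
      by (simp add: dist_real_def abs_less_iff)
  qed (use e in auto)
qed

text \<open>The distance is continuous, vanishes at parameter 1 and never takes the value 1/2, so by
  the intermediate value theorem it stays on the lower side of the gap.\<close>

lemma step_dist_paths_close:
  assumes \<delta>: "continuous_map unit_interval X \<delta>" and \<delta>': "continuous_map unit_interval X \<delta>'"
    and gap: "\<And>s. s \<in> {0..1} \<Longrightarrow> d (\<delta> s) (\<delta>' s) < 1/4 \<or> d (\<delta> s) (\<delta>' s) > 3/4"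
    and 1: "\<delta> 1 = \<delta>' 1" and s: "s \<in> {0..1}"
  shows "d (\<delta> s) (\<delta>' s) < 1/4"
proof (rule ccontr)
  assume "\<not> d (\<delta> s) (\<delta>' s) < 1/4"
  then have "1/2 \<le> d (\<delta> s) (\<delta>' s)" using gap[OF s] by auto
  moreover have "continuous_on {s..1} (\<lambda>s. d (\<delta> s) (\<delta>' s))"
    using continuous_on_step_dist[OF \<delta> \<delta>'] by (rule continuous_on_subset) (use s in auto)
  ultimately obtain x where "s \<le> x" "x \<le> 1" "d (\<delta> x) (\<delta>' x) = 1/2"
    using IVT2'[of "\<lambda>s. d (\<delta> s) (\<delta>' s)" 1 "1/2" s] 1 s by auto
  then show False using gap[of x] s by auto
qed

text \<open>Distances between two lifts are 0 or 1, so the gap condition holds and a common end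
  point forces the value 0 throughout.\<close>

lemma path_lift_unique:
  assumes \<delta>: "continuous_map unit_interval X \<delta>" and \<delta>': "continuous_map unit_interval X \<delta>'"
    and eq: "\<And>s. s \<in> {0..1} \<Longrightarrow> proj (\<delta> s) = proj (\<delta>' s)" and 1: "\<delta> 1 = \<delta>' 1" and s: "s \<in> {0..1}"
  shows "\<delta> s = \<delta>' s"
proof -
  have dich: "\<delta> s = \<delta>' s \<or> d (\<delta> s) (\<delta>' s) = 1" if "s \<in> {0..1}" for s
    by (rule proj_eq_cases) (use \<delta> \<delta>' eq that in \<open>auto simp: continuous_map_def\<close>)
  have "d (\<delta> s) (\<delta>' s) < 1/4"
    by (rule step_dist_paths_close[OF \<delta> \<delta>' _ 1 s]) (use dich in fastforce)
  then show ?thesis using dich[OF s] by auto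
qed

lemma path_lift_exists:
  assumes \<gamma>: "continuous_map unit_interval Y \<gamma>" and e: "e \<in> topspace X" "proj e = \<gamma> 1"
  shows "\<exists>\<delta>. continuous_map unit_interval X \<delta> \<and> (\<forall>s\<in>{0..1}. proj (\<delta> s) = \<gamma> s) \<and> \<delta> 1 = e"
proof -
  \<comment> \<open>Bisection needs a property that passes to adjacent intervals. The right end is
    prescribed arbitrarily: lifting the right-hand piece first determines the end prescribed for the
    left-hand piece.\<close>
  define P where "P a b \<longleftrightarrow> (0 \<le> a \<and> b \<le> 1 \<longrightarrow> (\<forall>y\<in>topspace X. proj y = \<gamma> b \<longrightarrow>
     (\<exists>\<delta>. continuous_map (top_of_set {a..b}) X \<delta> \<and> (\<forall>s\<in>{a..b}. proj (\<delta> s) = \<gamma> s) \<and> \<delta> b = y)))" for a b :: real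
  have "(0::real) \<le> 1" by simp
  then have "P 0 1"
  proof (induction rule: Bolzano[where P = P])
    case (trans a b c)
    show ?case
      unfolding P_def
    proof (intro impI ballI)
      fix y assume ac: "0 \<le> a \<and> c \<le> 1" and y: "y \<in> topspace X" "proj y = \<gamma> c"
      then obtain \<delta>2 where d2: "continuous_map (top_of_set {b..c}) X \<delta>2" "\<forall>s\<in>{b..c}. proj (\<delta>2 s) = \<gamma> s" "\<delta>2 c = y"
        using trans unfolding P_def by (meson order_trans)
      have "\<delta>2 b \<in> topspace X" "proj (\<delta>2 b) = \<gamma> b" using d2 trans by (auto simp: continuous_map_def)
      then obtain \<delta>1 where d1: "continuous_map (top_of_set {a..b}) X \<delta>1" "\<forall>s\<in>{a..b}. proj (\<delta>1 s) = \<gamma> s" "\<delta>1 b = \<delta>2 b"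
        using trans ac unfolding P_def by (meson order_trans)
      have "continuous_map (top_of_set {a..c}) X (\<lambda>s. if s \<le> b then \<delta>1 s else \<delta>2 s)"
      proof (rule continuous_map_cases_le)
        have "{x \<in> topspace (top_of_set {a..c}). x \<le> b} = {a..b}" using trans by auto
        then show "continuous_map (subtopology (top_of_set {a..c}) {x \<in> topspace (top_of_set {a..c}). x \<le> b}) X \<delta>1"
          using d1 trans by (simp add: subtopology_subtopology Int_absorb1)
        have "{x \<in> topspace (top_of_set {a..c}). b \<le> x} = {b..c}" using trans by auto
        then show "continuous_map (subtopology (top_of_set {a..c}) {x \<in> topspace (top_of_set {a..c}). b \<le> x}) X \<delta>2"
          using d2 trans by (simp add: subtopology_subtopology Int_absorb1)
      qed (use d1 in \<open>auto intro!: continuous_intros\<close>)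
      then show "\<exists>\<delta>. continuous_map (top_of_set {a..c}) X \<delta> \<and> (\<forall>s\<in>{a..c}. proj (\<delta> s) = \<gamma> s) \<and> \<delta> c = y"
        using d1 d2 trans by (intro exI[of _ "\<lambda>s. if s \<le> b then \<delta>1 s else \<delta>2 s"]) auto
    qed
  next
    case (local x)
    then have x: "x \<in> {0..1}" by auto
    then have "\<gamma> x \<in> topspace Y" using \<gamma> by (auto simp: continuous_map_def)
    then obtain y0 where y0: "y0 \<in> topspace X" "proj y0 = \<gamma> x" by (rule proj_surj)
    define B where "B = {c \<in> topspace X. d c y0 < 1/4}"
    have "openin Y (proj ` B)" unfolding B_def by (intro open_map_proj openin_step_ball y0)
    then have "openin unit_interval {s \<in> topspace unit_interval. \<gamma> s \<in> proj ` B}"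
      by (rule openin_continuous_map_preimage[OF \<gamma>])
    moreover have "x \<in> {s \<in> topspace unit_interval. \<gamma> s \<in> proj ` B}" using x y0 by (force simp: B_def)
    ultimately obtain e where e: "e > 0"
      "\<And>s. s \<in> {0..1} \<Longrightarrow> \<bar>s - x\<bar> < e \<Longrightarrow> s \<in> {s \<in> topspace unit_interval. \<gamma> s \<in> proj ` B}"
      by (rule unit_interval_neighbourhood) blast
    have "P a b" if ab: "a \<le> x" "x \<le> b" "b - a < e" for a b
      unfolding P_def
    proof (intro impI ballI)
      fix y assume ab01: "0 \<le> a \<and> b \<le> 1" and y: "y \<in> topspace X" "proj y = \<gamma> b"
      have "\<gamma> s \<in> proj ` B" if "s \<in> {a..b}" for s using e(2)[of s] that ab ab01 by auto
      then have "\<forall>s\<in>{a..b}. \<exists>c\<in>B. proj c = \<gamma> s" by force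
      \<comment> \<open>The preimages are chosen pointwise, without any continuity. Since all of
        them lie within 1/4 of \<open>y0\<close>, they are less than 1/2 apart and
        \<open>continuous_map_lift\<close> applies; a translation then adjusts the end
        point.\<close>
      then obtain \<sigma> where \<sigma>: "\<And>s. s \<in> {a..b} \<Longrightarrow> \<sigma> s \<in> B \<and> proj (\<sigma> s) = \<gamma> s" by metis
      have \<sigma>X: "\<sigma> s \<in> topspace X" "d (\<sigma> s) y0 < 1/4" if "s \<in> {a..b}" for s using \<sigma>[OF that] by (auto simp: B_def)
      have c\<sigma>: "continuous_map (top_of_set {a..b}) X \<sigma>"
      proof (rule continuous_map_lift)
        have "continuous_map (subtopology unit_interval {a..b}) Y \<gamma>" using \<gamma> by (rule continuous_map_from_subtopology)
        then have "continuous_map (top_of_set {a..b}) Y \<gamma>"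
          using ab01 by (simp add: subtopology_subtopology Int_absorb1)
        then show "continuous_map (top_of_set {a..b}) Y (\<lambda>s. proj (\<sigma> s))"
          by (rule continuous_map_eq) (use \<sigma> in auto)
        fix s0 assume s0: "s0 \<in> topspace (top_of_set {a..b})"
        have "d (\<sigma> s) (\<sigma> s0) < 1/2" if "s \<in> {a..b}" for s
          using step_dist_triangle[OF \<sigma>X(1)[OF that] y0(1) \<sigma>X(1)[of s0]] \<sigma>X(2)[OF that] \<sigma>X(2)[of s0] s0
            step_dist_commute[of K y0 "\<sigma> s0"] by auto
        then show "\<exists>V. openin (top_of_set {a..b}) V \<and> s0 \<in> V \<and> (\<forall>s\<in>V. d (\<sigma> s) (\<sigma> s0) < 1/2)"
          using s0 by (intro exI[of _ "{a..b}"]) auto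
      qed (use \<sigma>X in auto)
      have b: "b \<in> {a..b}" using ab by simp
      obtain h where h: "h \<in> carrier G" "y = shift h (\<sigma> b)"
        by (rule proj_eq_imp_shift[OF \<sigma>X(1)[OF b] y(1)]) (use \<sigma>[OF b] y in auto)
      have "continuous_map (top_of_set {a..b}) X (shift h \<circ> \<sigma>)"
        using c\<sigma> continuous_map_shift[OF h(1)] by (rule continuous_map_compose)
      then show "\<exists>\<delta>. continuous_map (top_of_set {a..b}) X \<delta> \<and> (\<forall>s\<in>{a..b}. proj (\<delta> s) = \<gamma> s) \<and> \<delta> b = y"
        using h \<sigma> \<sigma>X by (intro exI[of _ "shift h \<circ> \<sigma>"]) (auto simp: proj_shift)
    qed
    then show ?case using e(1) by blast
  qed
  then show ?thesis unfolding P_def using e by auto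
qed

definition path_lift :: "(nat \<Rightarrow> 'a) realization_point \<Rightarrow> (real \<Rightarrow> 'a list realization_point) \<Rightarrow> real \<Rightarrow> (nat \<Rightarrow> 'a) realization_point" where
  "path_lift e \<gamma> = (SOME \<delta>. continuous_map unit_interval X \<delta> \<and> (\<forall>s\<in>{0..1}. proj (\<delta> s) = \<gamma> s) \<and> \<delta> 1 = e)"

lemma path_lift:
  assumes "continuous_map unit_interval Y \<gamma>" "e \<in> topspace X" "proj e = \<gamma> 1"
  shows "continuous_map unit_interval X (path_lift e \<gamma>)" "\<And>s. s \<in> {0..1} \<Longrightarrow> proj (path_lift e \<gamma> s) = \<gamma> s"
    "path_lift e \<gamma> 1 = e"
  using someI_ex[OF path_lift_exists[OF assms]] unfolding path_lift_def by blast+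

section \<open>Continuous dependence of the lift on the path\<close>

abbreviation paths_to :: "'a list realization_point \<Rightarrow> (real \<Rightarrow> 'a list realization_point) topology" where
  "paths_to b \<equiv> subtopology (mapping_space unit_interval Y) {\<gamma>. \<gamma> 1 = b}"

text \<open>One compact-open neighbourhood works for all parameters. Bisection replaces a Lebesgue
  number argument: locally it suffices to map a compact interval into the open image of a
  ball.\<close>

lemma paths_close:
  assumes \<gamma>: "continuous_map unit_interval Y \<gamma>" "\<gamma> \<in> extensional {0..1}"
    and \<delta>: "continuous_map unit_interval X \<delta>" "\<And>s. s \<in> {0..1} \<Longrightarrow> proj (\<delta> s) = \<gamma> s"
  obtains V where "openin (mapping_space unit_interval Y) V" "\<gamma> \<in> V"
    "\<And>\<gamma>' s. \<gamma>' \<in> V \<Longrightarrow> s \<in> {0..1} \<Longrightarrow> \<exists>z\<in>topspace X. proj z = \<gamma>' s \<and> d z (\<delta> s) < 1/4"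
proof -
  define P where "P a b \<longleftrightarrow> (\<exists>V. openin (mapping_space unit_interval Y) V \<and> \<gamma> \<in> V \<and>
    (\<forall>\<gamma>'\<in>V. \<forall>s\<in>{a..b} \<inter> {0..1}. \<exists>z\<in>topspace X. proj z = \<gamma>' s \<and> d z (\<delta> s) < 1/4))" for a b :: real
  have \<delta>X: "\<delta> s \<in> topspace X" if "s \<in> {0..1}" for s using \<delta>(1) that by (auto simp: continuous_map_def)
  have "(0::real) \<le> 1" by simp
  then have "P 0 1"
  proof (induction rule: Bolzano[where P = P])
    case (trans a b c)
    obtain V where V: "openin (mapping_space unit_interval Y) V" "\<gamma> \<in> V"
      "\<forall>\<gamma>'\<in>V. \<forall>s\<in>{a..b} \<inter> {0..1}. \<exists>z\<in>topspace X. proj z = \<gamma>' s \<and> d z (\<delta> s) < 1/4"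
      using trans(1) unfolding P_def by (elim exE conjE)
    obtain V' where V': "openin (mapping_space unit_interval Y) V'" "\<gamma> \<in> V'"
      "\<forall>\<gamma>'\<in>V'. \<forall>s\<in>{b..c} \<inter> {0..1}. \<exists>z\<in>topspace X. proj z = \<gamma>' s \<and> d z (\<delta> s) < 1/4"
      using trans(2) unfolding P_def by (elim exE conjE)
    have "\<exists>z\<in>topspace X. proj z = \<gamma>' s \<and> d z (\<delta> s) < 1/4" if "\<gamma>' \<in> V \<inter> V'" "s \<in> {a..c} \<inter> {0..1}" for \<gamma>' s
    proof (cases "s \<le> b")
      case True
      then have "s \<in> {a..b} \<inter> {0..1}" "\<gamma>' \<in> V" using that by auto
      then show ?thesis using V(3) by blast
    next
      case False
      then have "s \<in> {b..c} \<inter> {0..1}" "\<gamma>' \<in> V'" using that by auto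
      then show ?thesis using V'(3) by blast
    qed
    then show ?case unfolding P_def using V(1,2) V'(1,2)
      by (intro exI[of _ "V \<inter> V'"] conjI ballI openin_Int IntI)
  next
    case (local x)
    then have x: "x \<in> {0..1}" by auto
    \<comment> \<open>Both \<open>z\<close> and \<open>\<delta> s\<close> will lie in this ball, and
      1/8 + 1/8 gives the required 1/4.\<close>
    define B where "B = {c \<in> topspace X. d c (\<delta> x) < 1/8}"
    have B: "openin X B" unfolding B_def by (intro openin_step_ball \<delta>X x)
    have "openin unit_interval {s \<in> topspace unit_interval. \<delta> s \<in> B}"
      by (rule openin_continuous_map_preimage[OF \<delta>(1) B])
    moreover have "x \<in> {s \<in> topspace unit_interval. \<delta> s \<in> B}" using x \<delta>X by (simp add: B_def)
    ultimately obtain e where e: "e > 0"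
      "\<And>s. s \<in> {0..1} \<Longrightarrow> \<bar>s - x\<bar> < e \<Longrightarrow> s \<in> {s \<in> topspace unit_interval. \<delta> s \<in> B}"
      by (rule unit_interval_neighbourhood) blast
    have "P a b" if ab: "a \<le> x" "x \<le> b" "b - a < e" for a b
    proof -
      let ?C = "{a..b} \<inter> {0..1::real}"
      let ?V = "{f \<in> extensional (topspace unit_interval). continuous_map unit_interval Y f \<and> f ` ?C \<subseteq> proj ` B}"
      have \<delta>B: "\<delta> s \<in> B" if "s \<in> ?C" for s using e(2)[of s] that ab by auto
      have 1: "openin (mapping_space unit_interval Y) ?V"
        by (rule openin_mapping_space_subbasis[OF compactin_unit_interval open_map_proj[OF B]])
      have "\<gamma> s \<in> proj ` B" if "s \<in> ?C" for s
        using \<delta>B[OF that] \<delta>(2)[of s] that by (metis IntD2 image_eqI)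
      then have 2: "\<gamma> \<in> ?V" using \<gamma> by auto
      have 3: "\<exists>z\<in>topspace X. proj z = \<gamma>' s \<and> d z (\<delta> s) < 1/4" if \<gamma>': "\<gamma>' \<in> ?V" and s: "s \<in> ?C" for \<gamma>' s
      proof -
        have "\<gamma>' s \<in> proj ` B" using \<gamma>' s by blast
        then obtain z where z: "z \<in> B" "\<gamma>' s = proj z" by blast
        have "d z (\<delta> s) \<le> d z (\<delta> x) + d (\<delta> x) (\<delta> s)"
          by (rule step_dist_triangle) (use z \<delta>X x s in \<open>auto simp: B_def\<close>)
        also have "\<dots> < 1/4" using z \<delta>B[OF s] step_dist_commute[of K "\<delta> x" "\<delta> s"] by (simp add: B_def)
        finally show ?thesis using z by (auto simp: B_def)
      qed
      show ?thesis
        unfolding P_def by (intro exI[of _ ?V] conjI ballI 1 2 3)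
    qed
    then show ?case using e(1) by blast
  qed
  then obtain V where V: "openin (mapping_space unit_interval Y) V" "\<gamma> \<in> V"
    "\<forall>\<gamma>'\<in>V. \<forall>s\<in>{0..1} \<inter> {0..1}. \<exists>z\<in>topspace X. proj z = \<gamma>' s \<and> d z (\<delta> s) < 1/4"
    unfolding P_def by (elim exE conjE)
  show ?thesis by (rule that[OF V(1,2)]) (use V(3) in blast)
qed

text \<open>Nearby paths have nearby lifts because the lifts share the end point \<open>e\<close>
  and cannot change sheets. A bound of 1/4 between the lifts and one of 1/4 along the fixed lift add
  up to the 1/2 that \<open>continuous_map_lift\<close> allows.\<close>

theorem continuous_map_path_lift:
  assumes e: "e \<in> topspace X"
  shows "continuous_map (prod_topology (paths_to (proj e)) unit_interval) X (\<lambda>(\<gamma>, s). path_lift e \<gamma> s)"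
proof (rule continuous_map_lift)
  let ?W = "prod_topology (paths_to (proj e)) unit_interval"
  have lift: "continuous_map unit_interval X (path_lift e \<gamma>)" "\<And>s. s \<in> {0..1} \<Longrightarrow> proj (path_lift e \<gamma> s) = \<gamma> s"
    "path_lift e \<gamma> 1 = e" "continuous_map unit_interval Y \<gamma>" "\<gamma> \<in> extensional {0..1}"
    if "\<gamma> \<in> topspace (paths_to (proj e))" for \<gamma>
    using path_lift[of \<gamma> e] that e by auto
  have inX: "path_lift e \<gamma> s \<in> topspace X" if "\<gamma> \<in> topspace (paths_to (proj e))" "s \<in> {0..1}" for \<gamma> s
    using lift(1)[OF that(1)] that(2) by (auto simp: continuous_map_def)
  then show "(\<lambda>(\<gamma>, s). path_lift e \<gamma> s) \<in> topspace ?W \<rightarrow> topspace X" by auto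
  have "continuous_map ?W Y (\<lambda>(\<gamma>, s). \<gamma> s)"
    unfolding prod_topology_subtopology(1) by (rule continuous_map_from_subtopology[OF continuous_map_evaluation])
  then show "continuous_map ?W Y (\<lambda>w. proj (case w of (\<gamma>, s) \<Rightarrow> path_lift e \<gamma> s))"
    by (rule continuous_map_eq) (use lift(2) in auto)
  fix w0 assume "w0 \<in> topspace ?W"
  then obtain \<gamma> s0 where w0: "w0 = (\<gamma>, s0)" "\<gamma> \<in> topspace (paths_to (proj e))" "s0 \<in> {0..1}" by auto
  let ?\<delta> = "path_lift e \<gamma>"
  obtain V where V: "openin (mapping_space unit_interval Y) V" "\<gamma> \<in> V"
    "\<And>\<gamma>' s. \<gamma>' \<in> V \<Longrightarrow> s \<in> {0..1} \<Longrightarrow> \<exists>z\<in>topspace X. proj z = \<gamma>' s \<and> d z (?\<delta> s) < 1/4"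
    using paths_close[OF lift(4,5)[OF w0(2)] lift(1,2)[OF w0(2)]] by metis
  define S where "S = {s \<in> topspace unit_interval. ?\<delta> s \<in> {c \<in> topspace X. d c (?\<delta> s0) < 1/4}}"
  have S: "openin unit_interval S" unfolding S_def
    by (rule openin_continuous_map_preimage[OF lift(1)[OF w0(2)] openin_step_ball[OF inX[OF w0(2,3)]]])
  have VW: "openin (paths_to (proj e)) (V \<inter> {\<gamma>. \<gamma> 1 = proj e})"
    using V(1) by (auto simp: openin_subtopology)
  have "d (path_lift e \<gamma>' s) (?\<delta> s0) < 1/2" if \<gamma>': "\<gamma>' \<in> V" "\<gamma>' 1 = proj e" and s: "s \<in> S" for \<gamma>' s
  proof -
    have \<gamma>'W: "\<gamma>' \<in> topspace (paths_to (proj e))" using \<gamma>' openin_subset[OF V(1)] by auto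
    have s01: "s \<in> {0..1}" using s by (simp add: S_def)
    have "d (path_lift e \<gamma>' s) (?\<delta> s) < 1/4"
    proof (rule step_dist_paths_close[OF lift(1)[OF \<gamma>'W] lift(1)[OF w0(2)] _ _ s01])
      show "path_lift e \<gamma>' 1 = ?\<delta> 1" using lift(3) \<gamma>'W w0 by simp
      fix r :: real assume r: "r \<in> {0..1}"
      obtain z where z: "z \<in> topspace X" "proj z = \<gamma>' r" "d z (?\<delta> r) < 1/4" using V(3)[OF \<gamma>'(1) r] by blast
      \<comment> \<open>The lift of \<open>\<gamma>'\<close> either passes through the nearby
        preimage \<open>z\<close> or is at distance 1 from it, whence the gap between 1/4 and
        3/4.\<close>
      have "path_lift e \<gamma>' r = z \<or> d (path_lift e \<gamma>' r) z = 1"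
        by (rule proj_eq_cases[OF inX[OF \<gamma>'W r] z(1)]) (use lift(2)[OF \<gamma>'W r] z in simp)
      moreover have "d (path_lift e \<gamma>' r) z \<le> d (path_lift e \<gamma>' r) (?\<delta> r) + d (?\<delta> r) z"
        by (rule step_dist_triangle[OF inX[OF \<gamma>'W r] inX[OF w0(2) r] z(1)])
      ultimately show "d (path_lift e \<gamma>' r) (?\<delta> r) < 1/4 \<or> 3/4 < d (path_lift e \<gamma>' r) (?\<delta> r)"
        using z(3) step_dist_commute[of K z "?\<delta> r"] by auto
    qed
    moreover have "d (?\<delta> s) (?\<delta> s0) < 1/4" using s by (simp add: S_def)
    moreover have "d (path_lift e \<gamma>' s) (?\<delta> s0) \<le> d (path_lift e \<gamma>' s) (?\<delta> s) + d (?\<delta> s) (?\<delta> s0)"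
      by (rule step_dist_triangle[OF inX[OF \<gamma>'W s01] inX[OF w0(2) s01] inX[OF w0(2,3)]])
    ultimately show ?thesis by simp
  qed
  moreover have "w0 \<in> (V \<inter> {\<gamma>. \<gamma> 1 = proj e}) \<times> S"
    using V(2) w0 inX[OF w0(2,3)] by (auto simp: S_def)
  moreover have "openin ?W ((V \<inter> {\<gamma>. \<gamma> 1 = proj e}) \<times> S)"
    using VW S by (simp add: openin_prod_Times_iff)
  ultimately show "\<exists>V. openin ?W V \<and> w0 \<in> V \<and>
      (\<forall>w\<in>V. d (case w of (\<gamma>, s) \<Rightarrow> path_lift e \<gamma> s) (case w0 of (\<gamma>, s) \<Rightarrow> path_lift e \<gamma> s) < 1/2)"
    by (intro exI[of _ "(V \<inter> {\<gamma>. \<gamma> 1 = proj e}) \<times> S"]) (auto simp: w0(1))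
qed

end

subsection \<open>Nerves as quotients of tuples\<close>

definition finite_subsets :: "'a set \<Rightarrow> 'a set set" where
  "finite_subsets C = {S. finite S \<and> S \<noteq> {} \<and> S \<subseteq> C}"

definition centralizer :: "('a, 'b) monoid_scheme \<Rightarrow> 'a set \<Rightarrow> 'a set" where
  "centralizer G S = {x \<in> carrier G. \<forall>s\<in>S. x \<otimes>\<^bsub>G\<^esub> s = s \<otimes>\<^bsub>G\<^esub> x}"

context group
begin

lemma translation_complex_finite_subsets: "translation_complex G (finite_subsets (carrier G))"
proof unfold_locales
  show "abstract_simplicial_complex (finite_subsets (carrier G))"
    unfolding abstract_simplicial_complex_def finite_subsets_def by (auto intro: finite_subset)
qed (auto simp: finite_subsets_def)

lemma translation_complex_AfCom: "translation_complex G (AfCom G)"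
proof unfold_locales
  show "abstract_simplicial_complex (AfCom G)" by (rule abstract_simplicial_complex_AfCom)
  show "S \<subseteq> carrier G" if "S \<in> AfCom G" for S
    using Union_AfCom[OF group_axioms] that by blast
  fix h S assume h: "h \<in> carrier G" and "S \<in> AfCom G"
  then obtain A g where S: "finite S" "S \<noteq> {}" "subgroup A G" "comm_group (G\<lparr>carrier := A\<rparr>)"
    "g \<in> carrier G" "S \<subseteq> g <# A"
    unfolding AfCom_def affinely_commutative_def by blast
  have "(\<lambda>g. h \<otimes> g) ` S \<subseteq> (h \<otimes> g) <# A"
  proof
    fix x assume "x \<in> (\<lambda>g. h \<otimes> g) ` S"
    then obtain a where "a \<in> A" "x = h \<otimes> (g \<otimes> a)" using S(6) unfolding l_coset_def by blast
    then show "x \<in> (h \<otimes> g) <# A"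
      using h S(5) subgroup.mem_carrier[OF S(3)] unfolding l_coset_def by (auto simp: m_assoc)
  qed
  then show "(\<lambda>g. h \<otimes> g) ` S \<in> AfCom G"
    unfolding AfCom_def affinely_commutative_def using S h by blast
qed

lemma subgroup_centralizer:
  assumes "S \<subseteq> carrier G"
  shows "subgroup (centralizer G S) G"
proof
  show "centralizer G S \<subseteq> carrier G" by (auto simp: centralizer_def)
  show "\<one> \<in> centralizer G S" using assms by (auto simp: centralizer_def)
next
  fix x y assume x: "x \<in> centralizer G S" and y: "y \<in> centralizer G S"
  have "x \<otimes> y \<otimes> s = s \<otimes> (x \<otimes> y)" if "s \<in> S" for s
  proof -
    have car: "x \<in> carrier G" "y \<in> carrier G" "s \<in> carrier G" "x \<otimes> s = s \<otimes> x" "y \<otimes> s = s \<otimes> y"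
      using x y that assms by (auto simp: centralizer_def)
    have "x \<otimes> y \<otimes> s = x \<otimes> (s \<otimes> y)" using car(1,2,3,5) m_assoc[of x y s] by simp
    also have "\<dots> = x \<otimes> s \<otimes> y" using car(1,2,3) m_assoc[of x s y] by simp
    also have "\<dots> = s \<otimes> (x \<otimes> y)" unfolding car(4) using car(1,2,3) m_assoc[of s x y] by simp
    finally show ?thesis .
  qed
  then show "x \<otimes> y \<in> centralizer G S" using x y by (simp add: centralizer_def)
next
  fix x assume x: "x \<in> centralizer G S"
  have "inv x \<otimes> s = s \<otimes> inv x" if "s \<in> S" for s
  proof -
    have car: "x \<in> carrier G" "s \<in> carrier G" "x \<otimes> s = s \<otimes> x"
      using x that assms by (auto simp: centralizer_def)
    have "inv x \<otimes> s = inv x \<otimes> (s \<otimes> x \<otimes> inv x)" using car(1,2) m_assoc[of s x "inv x"] by simp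
    also have "\<dots> = inv x \<otimes> (x \<otimes> s \<otimes> inv x)" by (simp only: car(3))
    also have "\<dots> = s \<otimes> inv x" using car(1,2) inv_mult_mult[of x "s \<otimes> inv x"] m_assoc[of x s "inv x"] by simp
    finally show ?thesis .
  qed
  then show "inv x \<in> centralizer G S" using x by (simp add: centralizer_def)
qed

text \<open>The double centralizer contains \<open>S\<close>. Since \<open>S\<close> commutes,
  \<open>S\<close> lies in its own centralizer, so the double centralizer lies in the centralizer of
  \<open>S\<close> and therefore commutes with itself.\<close>

lemma commuting_subset_abelian_subgroup:
  assumes S: "S \<subseteq> carrier G" and comm: "\<And>g h. g \<in> S \<Longrightarrow> h \<in> S \<Longrightarrow> g \<otimes> h = h \<otimes> g"
  obtains A where "subgroup A G" "comm_group (G\<lparr>carrier := A\<rparr>)" "S \<subseteq> A"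
proof
  let ?A = "centralizer G (centralizer G S)"
  show sub: "subgroup ?A G" by (rule subgroup_centralizer) (auto simp: centralizer_def)
  show "S \<subseteq> ?A" using S by (auto simp: centralizer_def)
  have "S \<subseteq> centralizer G S" using S comm by (auto simp: centralizer_def)
  then have "?A \<subseteq> centralizer G S" by (auto simp: centralizer_def)
  then have "x \<otimes> y = y \<otimes> x" if "x \<in> ?A" "y \<in> ?A" for x y
    using that by (auto simp: centralizer_def)
  then show "comm_group (G\<lparr>carrier := ?A\<rparr>)"
    using subgroup_imp_group[OF sub] by (intro group.group_comm_groupI) auto
qed

text \<open>A section of \<open>quotients\<close>: the representative of the orbit whose first entry
  is \<open>\<one>\<close>.\<close>

definition prefix_products :: "'a list \<Rightarrow> nat \<Rightarrow> 'a" where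
  "prefix_products gs = restrict (\<lambda>i. foldr (\<otimes>) (take i gs) \<one>) {..length gs}"

lemma quotients_prefix_products:
  assumes gs: "set gs \<subseteq> carrier G"
  shows "quotients G (length gs) (prefix_products gs) = gs"
proof (rule nth_equalityI)
  fix i assume "i < length (quotients G (length gs) (prefix_products gs))"
  then have i: "i < length gs" by (simp add: quotients_def)
  have car: "set (take i gs) \<subseteq> carrier G" "gs ! i \<in> carrier G"
    using gs set_take_subset[of i gs] nth_mem[OF i] by blast+
  have "foldr (\<otimes>) (take (Suc i) gs) \<one> = foldr (\<otimes>) (take i gs) \<one> \<otimes> foldr (\<otimes>) [gs ! i] \<one>"
    using foldr_mult_append[OF car(1), of "[gs ! i]"] car(2) take_Suc_conv_app_nth[OF i] by simp
  then have "prefix_products gs (Suc i) = prefix_products gs i \<otimes> gs ! i" "prefix_products gs i \<in> carrier G"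
    using i car(2) foldr_mult_closed[OF car(1)] by (simp_all add: prefix_products_def)
  then show "quotients G (length gs) (prefix_products gs) ! i = gs ! i"
    using i car(2) by (simp add: quotients_def inv_mult_mult)
qed (simp add: quotients_def)

lemma prefix_products_in:
  assumes "subgroup A G" "set gs \<subseteq> A"
  shows "prefix_products gs ` {..length gs} \<subseteq> A"
proof -
  have "foldr (\<otimes>) xs \<one> \<in> A" if "set xs \<subseteq> A" for xs
    using that by (induction xs) (auto intro: subgroup.m_closed[OF assms(1)] subgroup.one_closed[OF assms(1)])
  moreover have "set (take i gs) \<subseteq> A" for i using assms(2) set_take_subset[of i gs] by blast
  ultimately show ?thesis by (auto simp: prefix_products_def)
qed

lemma quotients_carrier:
  assumes "g ` {..n} \<subseteq> carrier G"
  shows "length (quotients G n g) = n" "set (quotients G n g) \<subseteq> carrier G"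
proof -
  have "inv (g i) \<otimes> g (Suc i) \<in> carrier G" if "i < n" for i
    by (rule m_closed[OF inv_closed]) (use assms that in auto)
  then show "set (quotients G n g) \<subseteq> carrier G" by (auto simp: quotients_def)
qed (simp add: quotients_def)

lemma quotient_sset_finite_subsets: "quotient_sset G (finite_subsets (carrier G)) = nerve G"
proof -
  have "quotients G n ` simps (tuple_sset (finite_subsets (carrier G))) n = {gs. length gs = n \<and> set gs \<subseteq> carrier G}" for n
  proof (intro equalityI subsetI)
    fix gs assume "gs \<in> quotients G n ` simps (tuple_sset (finite_subsets (carrier G))) n"
    then obtain g where "g ` {..n} \<subseteq> carrier G" "gs = quotients G n g"
      by (auto simp: simps_tuple finite_subsets_def)
    then show "gs \<in> {gs. length gs = n \<and> set gs \<subseteq> carrier G}" using quotients_carrier by simp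
  next
    fix gs assume "gs \<in> {gs. length gs = n \<and> set gs \<subseteq> carrier G}"
    then have gs: "length gs = n" "set gs \<subseteq> carrier G" by auto
    have "prefix_products gs ` {..n} \<subseteq> carrier G"
      using prefix_products_in[OF subgroup_self gs(2)] gs(1) by simp
    then have "prefix_products gs \<in> simps (tuple_sset (finite_subsets (carrier G))) n"
      using gs(1) by (simp add: simps_tuple finite_subsets_def prefix_products_def)
    then show "gs \<in> quotients G n ` simps (tuple_sset (finite_subsets (carrier G))) n"
      using quotients_prefix_products[OF gs(2)] gs(1) by (metis image_eqI)
  qed
  then show ?thesis by (simp add: quotient_sset_def nerve_def)
qed

text \<open>Quotients of elements of one coset \<open>a <# A\<close> lie in \<open>A\<close> and so
  commute. Conversely, commuting entries lie in an abelian subgroup, which then contains all their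
  prefix products.\<close>

lemma quotient_sset_AfCom: "quotient_sset G (AfCom G) = commuting_nerve G"
proof -
  have "quotients G n ` simps (tuple_sset (AfCom G)) n = simps (commuting_nerve G) n" for n
  proof (intro equalityI subsetI)
    fix gs assume "gs \<in> quotients G n ` simps (tuple_sset (AfCom G)) n"
    then obtain g where g: "affinely_commutative G (g ` {..n})" "gs = quotients G n g"
      by (auto simp: simps_tuple AfCom_def)
    then obtain A a where A: "subgroup A G" "comm_group (G\<lparr>carrier := A\<rparr>)" "a \<in> carrier G" "g ` {..n} \<subseteq> a <# A"
      unfolding affinely_commutative_def by blast
    have sub: "g ` {..n} \<subseteq> carrier G" using A(4) l_coset_subset_G[OF subgroup.subset[OF A(1)] A(3)] by blast
    have "inv (g i) \<otimes> g (Suc i) \<in> A" if "i < n" for i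
    proof -
      have "g i \<in> a <# A" "g (Suc i) \<in> a <# A" using A(4) that by auto
      then obtain x y where xy: "x \<in> A" "y \<in> A" "g i = a \<otimes> x" "g (Suc i) = a \<otimes> y" unfolding l_coset_def by blast
      have car: "x \<in> carrier G" "y \<in> carrier G" using xy subgroup.mem_carrier[OF A(1)] by auto
      have "inv (g i) \<otimes> g (Suc i) = inv x \<otimes> (inv a \<otimes> (a \<otimes> y))"
        unfolding xy(3,4) using car A(3) by (simp add: inv_mult_group m_assoc)
      also have "\<dots> = inv x \<otimes> y" using car A(3) by (simp add: inv_mult_mult)
      finally show ?thesis
        using xy subgroup.m_closed[OF A(1)] subgroup.m_inv_closed[OF A(1)] by simp
    qed
    then have gsA: "set gs \<subseteq> A" by (auto simp: g(2) quotients_def)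
    have "x \<otimes> y = y \<otimes> x" if "x \<in> A" "y \<in> A" for x y
      using comm_groupE(4)[OF A(2), of x y] that by simp
    then have "\<forall>x\<in>set gs. \<forall>y\<in>set gs. x \<otimes> y = y \<otimes> x" using gsA by blast
    then show "gs \<in> simps (commuting_nerve G) n"
      using quotients_carrier[OF sub] g(2) by (simp add: commuting_nerve_def nerve_def)
  next
    fix gs assume "gs \<in> simps (commuting_nerve G) n"
    then have gs: "length gs = n" "set gs \<subseteq> carrier G" "\<And>g h. g \<in> set gs \<Longrightarrow> h \<in> set gs \<Longrightarrow> g \<otimes> h = h \<otimes> g"
      by (auto simp: commuting_nerve_def nerve_def)
    obtain A where A: "subgroup A G" "comm_group (G\<lparr>carrier := A\<rparr>)" "set gs \<subseteq> A"
      using commuting_subset_abelian_subgroup[OF gs(2,3)] .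
    have "prefix_products gs ` {..n} \<subseteq> \<one> <# A"
      using prefix_products_in[OF A(1,3)] gs(1) subgroup.subset[OF A(1)] by (simp add: lcos_mult_one)
    then have "affinely_commutative G (prefix_products gs ` {..n})"
      unfolding affinely_commutative_def using A one_closed by blast
    then have "prefix_products gs \<in> simps (tuple_sset (AfCom G)) n"
      using gs(1) by (simp add: simps_tuple AfCom_def prefix_products_def)
    then show "gs \<in> quotients G n ` simps (tuple_sset (AfCom G)) n"
      using quotients_prefix_products[OF gs(2)] gs(1) by (metis image_eqI)
  qed
  then show ?thesis
    by (simp add: quotient_sset_def commuting_nerve_def nerve_def)
qed

lemma AfCom_subset_finite_subsets: "AfCom G \<subseteq> finite_subsets (carrier G)"
  using Union_AfCom[OF group_axioms] by (auto simp: AfCom_def affinely_commutative_def finite_subsets_def)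

end

subsection \<open>Inclusions\<close>

text \<open>Gluings in \<open>X\<close> are gluings in \<open>Z\<close>, so the union defining the
  inclusion ranges over copies of one and the same class.\<close>

lemma realization_inclusion_point:
  assumes "\<And>n. simps X n \<subseteq> simps Z n" "act X = act Z"
  shows "realization_inclusion Z (realization_point X n x t) = realization_point Z n x t"
proof -
  have "glue X \<subseteq> glue Z" unfolding glue_def assms(2) using assms(1) by blast
  then have "glue_equiv X \<subseteq> glue_equiv Z" unfolding glue_equiv_def by (intro rtrancl_mono) blast
  then have *: "realization_point Z n' x' t' = realization_point Z n x t"
    if "((n', x'), t') \<in> realization_point X n x t" for n' x' t'
  proof -
    have "(((n, x), t), ((n', x'), t')) \<in> glue_equiv X" using that by (simp add: realization_point_def)
    then have "realization_point Z n x t = realization_point Z n' x' t'"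
      unfolding realization_point_eq_iff using \<open>glue_equiv X \<subseteq> glue_equiv Z\<close> by blast
    then show ?thesis by (rule sym)
  qed
  have "((n, x), t) \<in> realization_point X n x t"
    by (simp add: realization_point_def glue_equiv_def)
  then show ?thesis
    unfolding realization_inclusion_def by (rule UN_constant_eq) (use * in \<open>simp add: split_paired_all\<close>)
qed

definition tuple_inclusion :: "'a set set \<Rightarrow> 'a set set \<Rightarrow> (nat \<Rightarrow> 'a) realization_point \<Rightarrow> (nat \<Rightarrow> 'a) realization_point" where
  "tuple_inclusion K L = realization_rec (tuple_sset K) (realization_point (tuple_sset L))"

context
  fixes K L :: "'a set set"
  assumes KL: "K \<subseteq> L"
begin

lemma simps_tuple_mono: "g \<in> simps (tuple_sset K) n \<Longrightarrow> g \<in> simps (tuple_sset L) n"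
  using KL by (auto simp: simps_tuple)

lemma tuple_inclusion_point:
  assumes "g \<in> simps (tuple_sset K) n" "t \<in> standard_simplex n"
  shows "tuple_inclusion K L (realization_point (tuple_sset K) n g t) = realization_point (tuple_sset L) n g t"
proof -
  have "glue_invariant (tuple_sset K) (realization_point (tuple_sset L))"
    by (rule glue_invariantI) (simp add: tuple_point_act simps_tuple_mono)
  then show ?thesis unfolding tuple_inclusion_def using assms by (rule realization_rec_point)
qed

lemma continuous_map_tuple_inclusion:
  "continuous_map (sset_realization (tuple_sset K)) (sset_realization (tuple_sset L)) (tuple_inclusion K L)"
proof (rule continuous_map_realization)
  fix n g assume g: "g \<in> simps (tuple_sset K) n"
  show "continuous_map (simplex_topology n) (sset_realization (tuple_sset L))
     (\<lambda>t. tuple_inclusion K L (realization_point (tuple_sset K) n g t))"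
    using continuous_map_realization_point[OF simps_tuple_mono[OF g]]
    by (rule continuous_map_eq) (simp only: topspace_standard_simplex tuple_inclusion_point[OF g])
qed

text \<open>Enlarging the complex does not alter step functions. This transfers information about
  sheets from \<open>EG\<close> back to \<open>|T AfCom(G)|\<close>.\<close>

lemma step_dist_tuple_inclusion:
  assumes "c \<in> topspace (sset_realization (tuple_sset K))" "c' \<in> topspace (sset_realization (tuple_sset K))"
  shows "step_dist L (tuple_inclusion K L c) (tuple_inclusion K L c') = step_dist K c c'"
proof -
  have val: "step_value L (tuple_inclusion K L c) r = step_value K c r"
    if c: "c \<in> topspace (sset_realization (tuple_sset K))" and r: "r \<in> {0..<1}" for c r
  proof -
    obtain n g t where g: "g \<in> simps (tuple_sset K) n" "t \<in> standard_simplex n" "c = realization_point (tuple_sset K) n g t"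
      using c unfolding in_topspace_realization by blast
    have r: "0 \<le> r" "r < 1" using r by auto
    show ?thesis
      unfolding g(3) tuple_inclusion_point[OF g(1,2)] step_value_point[OF r g(1,2)]
        step_value_point[OF r simps_tuple_mono[OF g(1)] g(2)] ..
  qed
  have "step_differ L (tuple_inclusion K L c) (tuple_inclusion K L c') = step_differ K c c'"
    unfolding step_differ_def using val assms by auto
  then show ?thesis by (simp add: step_dist_def)
qed

end

subsection \<open>The cone contraction\<close>

definition constant_tuple :: "'a \<Rightarrow> nat \<Rightarrow> 'a" where
  "constant_tuple a = restrict (\<lambda>i. a) {..0}"

definition vertex_zero :: "nat \<Rightarrow> real" where
  "vertex_zero = (\<lambda>i. if i = 0 then 1 else 0)"

definition tuple_vertex :: "'a set set \<Rightarrow> 'a \<Rightarrow> (nat \<Rightarrow> 'a) realization_point" where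
  "tuple_vertex K a = realization_point (tuple_sset K) 0 (constant_tuple a) vertex_zero"

text \<open>The join with the vertex \<open>a\<close>. Adding a vertex keeps a set finite but can
  destroy affine commutativity, so the contraction is carried out only for all finite
  subsets.\<close>

definition cone_contraction :: "'a set set \<Rightarrow> 'a \<Rightarrow> real \<Rightarrow> (nat \<Rightarrow> 'a) realization_point \<Rightarrow> (nat \<Rightarrow> 'a) realization_point" where
  "cone_contraction K a u = realization_rec (tuple_sset K)
     (\<lambda>n g t. realization_point (tuple_sset K) (Suc (n + 0)) (tuple_join n 0 g (constant_tuple a)) (simplex_join n u t vertex_zero))"

lemma vertex_zero_in: "vertex_zero \<in> standard_simplex 0"
  by (simp add: vertex_zero_def standard_simplex_0)

context
  fixes C :: "'a set" and a :: 'a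
  assumes a: "a \<in> C"
begin

abbreviation "TC \<equiv> tuple_sset (finite_subsets C)"

lemma constant_tuple_in: "constant_tuple a \<in> simps TC 0"
  using a by (simp add: simps_tuple constant_tuple_def finite_subsets_def)

lemma tuple_vertex_in: "tuple_vertex (finite_subsets C) a \<in> topspace (sset_realization TC)"
  unfolding tuple_vertex_def by (intro realization_point_in constant_tuple_in vertex_zero_in)

lemma cone_simplex: "g \<in> simps TC n \<Longrightarrow> g ` {..n} \<union> constant_tuple a ` {..0} \<in> finite_subsets C"
  using constant_tuple_in by (auto simp: simps_tuple finite_subsets_def)

lemma cone_contraction_point:
  assumes u: "0 \<le> u" "u \<le> 1" and g: "g \<in> simps TC n" and t: "t \<in> standard_simplex n"
  shows "cone_contraction (finite_subsets C) a u (realization_point TC n g t) =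
    realization_point TC (Suc (n + 0)) (tuple_join n 0 g (constant_tuple a)) (simplex_join n u t vertex_zero)"
proof -
  have "glue_invariant TC
     (\<lambda>n g t. realization_point TC (Suc (n + 0)) (tuple_join n 0 g (constant_tuple a)) (simplex_join n u t vertex_zero))"
  proof (rule glue_invariantI, unfold act_tuple)
    fix m n \<theta> g and t :: "nat \<Rightarrow> real"
    assume \<theta>: "\<theta> \<in> monotone_maps m n" and g: "g \<in> simps TC n" and t: "t \<in> standard_simplex m"
    have id: "id \<in> monotone_maps 0 0" by (rule monotone_mapsI) auto
    have "restrict (constant_tuple a \<circ> id) {..0} = constant_tuple a" by (simp add: constant_tuple_def)
    moreover have "simplex_push 0 id vertex_zero = vertex_zero"
      by (auto simp: simplex_push_alt vertex_zero_def)
    ultimately show "realization_point TC (Suc (m + 0)) (tuple_join m 0 (restrict (g \<circ> \<theta>) {..m}) (constant_tuple a))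
        (simplex_join m u t vertex_zero) =
      realization_point TC (Suc (n + 0)) (tuple_join n 0 g (constant_tuple a))
        (simplex_join n u (simplex_push m \<theta> t) vertex_zero)"
      using tuple_join_point_act[OF \<theta> id cone_simplex[OF g] t vertex_zero_in u] by simp
  qed
  then show ?thesis unfolding cone_contraction_def using g t by (rule realization_rec_point)
qed

lemma continuous_map_cone_contraction:
  "continuous_map (prod_topology unit_interval (sset_realization TC)) (sset_realization TC)
     (\<lambda>(u, c). cone_contraction (finite_subsets C) a u c)"
proof (rule continuous_map_unit_interval_prod_realization)
  fix n g assume g: "g \<in> simps TC n"
  let ?W = "prod_topology unit_interval (simplex_topology n)"
  have "continuous_map ?W (simplex_topology (Suc (n + 0))) (\<lambda>x. simplex_join n (fst x) (snd x) vertex_zero)"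
  proof (rule continuous_map_simplex_join)
    show "continuous_map ?W euclideanreal fst"
      using continuous_map_fst continuous_map_in_subtopology by blast
    show "continuous_map ?W (simplex_topology 0) (\<lambda>x. vertex_zero)"
      using vertex_zero_in by (simp add: continuous_map_const)
  qed (auto intro: continuous_map_snd)
  note continuous_map_compose[OF this continuous_map_realization_point[OF simps_tuple_join[OF cone_simplex[OF g]]]]
  then show "continuous_map ?W (sset_realization TC)
     (\<lambda>(u, t). (case (u, realization_point TC n g t) of (u, c) \<Rightarrow> cone_contraction (finite_subsets C) a u c))"
    by (rule continuous_map_eq) (auto simp: cone_contraction_point g)
qed

lemma cone_contraction_0:
  assumes "c \<in> topspace (sset_realization TC)"
  shows "cone_contraction (finite_subsets C) a 0 c = c"
proof -
  obtain n g t where g: "g \<in> simps TC n" "t \<in> standard_simplex n" "c = realization_point TC n g t"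
    using assms unfolding in_topspace_realization by blast
  show ?thesis
    unfolding g(3) cone_contraction_point[OF order_refl zero_le_one g(1,2)]
    by (rule tuple_join_point_0[OF cone_simplex[OF g(1)] _ g(2)]) (use g(1) in \<open>simp add: simps_tuple\<close>)
qed

lemma cone_contraction_1:
  assumes "c \<in> topspace (sset_realization TC)"
  shows "cone_contraction (finite_subsets C) a 1 c = tuple_vertex (finite_subsets C) a"
proof -
  obtain n g t where g: "g \<in> simps TC n" "t \<in> standard_simplex n" "c = realization_point TC n g t"
    using assms unfolding in_topspace_realization by blast
  show ?thesis
    unfolding g(3) cone_contraction_point[OF zero_le_one order_refl g(1,2)] tuple_vertex_def
    by (rule tuple_join_point_1[OF cone_simplex[OF g(1)] _ vertex_zero_in]) (simp add: constant_tuple_def)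
qed

text \<open>The segment lies in the degenerate simplex on the tuple \<open>(a, a)\<close>, which
  collapses to the vertex. That the base point stays fixed keeps path ends in place during the
  homotopy of the fibre.\<close>

lemma cone_contraction_vertex:
  assumes u: "0 \<le> u" "u \<le> 1"
  shows "cone_contraction (finite_subsets C) a u (tuple_vertex (finite_subsets C) a) = tuple_vertex (finite_subsets C) a"
proof -
  let ?t = "simplex_join 0 u vertex_zero vertex_zero"
  have mon: "(\<lambda>i. 0) \<in> monotone_maps (Suc (0 + 0)) 0" by (rule monotone_mapsI) auto
  have t: "?t \<in> standard_simplex (Suc (0 + 0))"
    by (rule simplex_join_in_simplex[OF vertex_zero_in vertex_zero_in u])
  have "restrict (constant_tuple a \<circ> (\<lambda>i. 0)) {..Suc (0 + 0)} = tuple_join 0 0 (constant_tuple a) (constant_tuple a)"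
    by (auto simp: tuple_join_def constant_tuple_def fun_eq_iff)
  moreover have "simplex_push (Suc (0 + 0)) (\<lambda>i. 0) ?t = vertex_zero"
    by (auto simp: simplex_push_alt simplex_join_def vertex_zero_def)
  ultimately show ?thesis
    using tuple_point_act[OF mon constant_tuple_in t] cone_contraction_point[OF u constant_tuple_in vertex_zero_in]
    by (simp add: tuple_vertex_def)
qed

end

subsection \<open>The homotopy fibre\<close>

context group
begin

interpretation A: translation_complex G "AfCom G"
  by (rule translation_complex_AfCom)

interpretation F: translation_complex G "finite_subsets (carrier G)"
  by (rule translation_complex_finite_subsets)

abbreviation "incl \<equiv> tuple_inclusion (AfCom G) (finite_subsets (carrier G))"
abbreviation "contr \<equiv> cone_contraction (finite_subsets (carrier G)) \<one>"
abbreviation "base \<equiv> tuple_vertex (finite_subsets (carrier G)) \<one>"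

lemma base_in: "base \<in> topspace F.X"
  by (rule tuple_vertex_in) simp

lemma incl_in: "y \<in> topspace A.X \<Longrightarrow> incl y \<in> topspace F.X"
  using continuous_map_tuple_inclusion[OF AfCom_subset_finite_subsets] by (auto simp: continuous_map_def)

lemma proj_base: "F.proj base = classifying_base G"
proof -
  have "F.proj base = realization_point F.N 0 (quotients G 0 (constant_tuple \<one>)) vertex_zero"
    unfolding tuple_vertex_def by (rule F.proj_point[OF constant_tuple_in[OF one_closed] vertex_zero_in])
  then show ?thesis
    by (simp add: quotients_def quotient_sset_finite_subsets classifying_base_def vertex_zero_def)
qed

lemma inclusion_proj:
  assumes "y \<in> topspace A.X"
  shows "B_com_inclusion G (A.proj y) = F.proj (incl y)"
proof -
  obtain n g t where g: "g \<in> simps A.T n" "t \<in> standard_simplex n" "y = realization_point A.T n g t"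
    using assms unfolding in_topspace_realization by blast
  have "simps A.N n \<subseteq> simps F.N n" for n
    using simps_tuple_mono[OF AfCom_subset_finite_subsets] by (auto simp: simps_quotient_sset)
  moreover have "act A.N = act F.N" by (simp add: quotient_sset_def)
  ultimately show ?thesis
    unfolding g(3) A.proj_point[OF g(1,2)] tuple_inclusion_point[OF AfCom_subset_finite_subsets g(1,2)]
      F.proj_point[OF simps_tuple_mono[OF AfCom_subset_finite_subsets g(1)] g(2)]
      B_com_inclusion_def quotient_sset_finite_subsets[symmetric]
    by (rule realization_inclusion_point)
qed

lemma incl_shift:
  assumes h: "h \<in> carrier G" and "y \<in> topspace A.X"
  shows "incl (A.shift h y) = F.shift h (incl y)"
proof -
  obtain n g t where g: "g \<in> simps A.T n" "t \<in> standard_simplex n" "y = realization_point A.T n g t"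
    using assms(2) unfolding in_topspace_realization by blast
  show ?thesis
    unfolding g(3) A.shift_point[OF h g(1,2)] tuple_inclusion_point[OF AfCom_subset_finite_subsets g(1,2)]
      tuple_inclusion_point[OF AfCom_subset_finite_subsets A.shift_in[OF h g(1)] g(2)]
      F.shift_point[OF h simps_tuple_mono[OF AfCom_subset_finite_subsets g(1)] g(2)] ..
qed

lemma E_com_eq:
  "E_com G = subtopology (prod_topology A.Y (mapping_space unit_interval F.Y))
     {(x, \<gamma>). \<gamma> 0 = B_com_inclusion G x \<and> \<gamma> 1 = F.proj base}"
  unfolding E_com_def homotopy_fiber_def B_com_def classifying_space_def proj_base
    quotient_sset_AfCom quotient_sset_finite_subsets ..

lemma in_E_com:
  "(x, \<gamma>) \<in> topspace (E_com G) \<longleftrightarrow> x \<in> topspace A.Y \<and> \<gamma> \<in> extensional {0..1} \<and>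
     continuous_map unit_interval F.Y \<gamma> \<and> \<gamma> 0 = B_com_inclusion G x \<and> \<gamma> 1 = F.proj base"
  unfolding E_com_eq by auto

lemma continuous_map_into_E_com:
  assumes f: "continuous_map W A.Y f" and F: "continuous_map (prod_topology W unit_interval) F.Y F"
    and ends: "\<And>w. w \<in> topspace W \<Longrightarrow> F (w, 0) = B_com_inclusion G (f w)"
      "\<And>w. w \<in> topspace W \<Longrightarrow> F (w, 1) = F.proj base"
  shows "continuous_map W (E_com G) (\<lambda>w. (f w, restrict (\<lambda>u. F (w, u)) {0..1}))"
  unfolding E_com_eq
  by (intro continuous_map_into_subtopology continuous_map_pairedI f continuous_map_curry F) (use ends in auto)

section \<open>The two maps between the homotopy fibre and the ordered tuples\<close>

definition fiber_lift :: "'a list realization_point \<times> (real \<Rightarrow> 'a list realization_point) \<Rightarrow> real \<Rightarrow> (nat \<Rightarrow> 'a) realization_point" where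
  "fiber_lift w = F.path_lift base (snd w)"

lemma continuous_map_fiber_lift:
  "continuous_map (prod_topology (E_com G) unit_interval) F.X (\<lambda>(w, s). fiber_lift w s)"
proof -
  have "continuous_map (E_com G) (mapping_space unit_interval F.Y) snd"
    unfolding E_com_eq by (intro continuous_map_from_subtopology continuous_map_snd)
  then have "continuous_map (E_com G) (F.paths_to (F.proj base)) snd"
    by (rule continuous_map_into_subtopology) (auto simp: E_com_eq)
  then have "continuous_map (prod_topology (E_com G) unit_interval) (F.paths_to (F.proj base)) (snd \<circ> fst)"
    by (rule continuous_map_compose[OF continuous_map_fst])
  then have "continuous_map (prod_topology (E_com G) unit_interval)
      (prod_topology (F.paths_to (F.proj base)) unit_interval) (\<lambda>x. (snd (fst x), snd x))"
    by (intro continuous_map_pairedI continuous_map_snd) (simp only: o_def)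
  note continuous_map_compose[OF this F.continuous_map_path_lift[OF base_in]]
  then show ?thesis by (rule continuous_map_eq) (auto simp: fiber_lift_def)
qed

lemma fiber_lift:
  assumes "(x, \<gamma>) \<in> topspace (E_com G)"
  shows "continuous_map unit_interval F.X (fiber_lift (x, \<gamma>))" "\<And>s. s \<in> {0..1} \<Longrightarrow> F.proj (fiber_lift (x, \<gamma>) s) = \<gamma> s"
    "fiber_lift (x, \<gamma>) 1 = base" "\<And>s. s \<in> {0..1} \<Longrightarrow> fiber_lift (x, \<gamma>) s \<in> topspace F.X"
proof -
  have *: "continuous_map unit_interval F.Y \<gamma>" "F.proj base = \<gamma> 1" using assms by (auto simp: in_E_com)
  note lift = F.path_lift[OF *(1) base_in *(2)]
  show "continuous_map unit_interval F.X (fiber_lift (x, \<gamma>))" "\<And>s. s \<in> {0..1} \<Longrightarrow> F.proj (fiber_lift (x, \<gamma>) s) = \<gamma> s"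
    "fiber_lift (x, \<gamma>) 1 = base" using lift by (simp_all add: fiber_lift_def)
  then show "fiber_lift (x, \<gamma>) s \<in> topspace F.X" if "s \<in> {0..1}" for s
    using that by (auto simp: continuous_map_def)
qed

definition to_fiber :: "(nat \<Rightarrow> 'a) realization_point \<Rightarrow> 'a list realization_point \<times> (real \<Rightarrow> 'a list realization_point)" where
  "to_fiber y = (A.proj y, restrict (\<lambda>u. F.proj (contr u (incl y))) {0..1})"

text \<open>The point of the pullback given by \<open>fst w\<close> and the start of the lifted
  path. The description determines it uniquely by \<open>from_fiber_unique\<close>.\<close>

definition from_fiber :: "'a list realization_point \<times> (real \<Rightarrow> 'a list realization_point) \<Rightarrow> (nat \<Rightarrow> 'a) realization_point" where
  "from_fiber w = (THE y. y \<in> topspace A.X \<and> A.proj y = fst w \<and> incl y = fiber_lift w 0)"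

text \<open>Two points of one fibre are equal or at distance 1, but their common image in
  \<open>EG\<close> forces distance 0.\<close>

lemma from_fiber_unique:
  assumes "y \<in> topspace A.X" "y' \<in> topspace A.X" "A.proj y = A.proj y'" "incl y = incl y'"
  shows "y = y'"
  using A.proj_eq_cases[OF assms(1-3)] step_dist_tuple_inclusion[OF AfCom_subset_finite_subsets assms(1,2)] assms(4)
  by auto

text \<open>Any \<open>y\<close> over \<open>fst w\<close> has its image in the same fibre of
  \<open>EG\<close> as the start of the lifted path. The translation relating these two points,
  applied to \<open>y\<close>, yields the required point.\<close>

lemma from_fiber:
  assumes w: "w \<in> topspace (E_com G)"
  shows "from_fiber w \<in> topspace A.X" "A.proj (from_fiber w) = fst w" "incl (from_fiber w) = fiber_lift w 0"
proof -
  obtain x \<gamma> where xg: "w = (x, \<gamma>)" by force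
  have x: "x \<in> topspace A.Y" "\<gamma> 0 = B_com_inclusion G x" using w unfolding xg in_E_com by auto
  obtain y where y: "y \<in> topspace A.X" "A.proj y = x" using A.proj_surj[OF x(1)] .
  have zero: "0 \<in> {0..1::real}" by simp
  have "F.proj (incl y) = F.proj (fiber_lift w 0)"
    using fiber_lift(2)[OF w[unfolded xg] zero] x inclusion_proj[OF y(1)] y(2) by (simp add: xg)
  then obtain h where h: "h \<in> carrier G" "fiber_lift w 0 = F.shift h (incl y)"
    using F.proj_eq_imp_shift[OF incl_in[OF y(1)] fiber_lift(4)[OF w[unfolded xg] zero]] xg by blast
  have "\<exists>!y. y \<in> topspace A.X \<and> A.proj y = fst w \<and> incl y = fiber_lift w 0"
  proof (rule ex1I)
    show "A.shift h y \<in> topspace A.X \<and> A.proj (A.shift h y) = fst w \<and> incl (A.shift h y) = fiber_lift w 0"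
      using A.shift_in_topspace[OF h(1) y(1)] A.proj_shift[OF h(1) y(1)] incl_shift[OF h(1) y(1)] h y xg by simp
  next
    fix y' assume "y' \<in> topspace A.X \<and> A.proj y' = fst w \<and> incl y' = fiber_lift w 0"
    then show "y' = A.shift h y"
      using from_fiber_unique[of y' "A.shift h y"] A.shift_in_topspace[OF h(1) y(1)] A.proj_shift[OF h(1) y(1)]
        incl_shift[OF h(1) y(1)] h y xg by simp
  qed
  from theI'[OF this] show "from_fiber w \<in> topspace A.X" "A.proj (from_fiber w) = fst w" "incl (from_fiber w) = fiber_lift w 0"
    unfolding from_fiber_def by blast+
qed

lemma continuous_map_cone_path:
  assumes "y \<in> topspace F.X"
  shows "continuous_map unit_interval F.X (\<lambda>u. contr u y)"
proof -
  have "continuous_map unit_interval (prod_topology unit_interval F.X) (\<lambda>u. (u, y))"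
    using assms by (intro continuous_map_pairedI) (auto simp: continuous_map_const)
  note continuous_map_compose[OF this continuous_map_cone_contraction[OF one_closed]]
  then show ?thesis by (simp add: o_def)
qed

lemma continuous_map_to_fiber: "continuous_map A.X (E_com G) to_fiber"
  unfolding to_fiber_def
proof -
  let ?W = "prod_topology A.X unit_interval"
  have "continuous_map ?W F.X (incl \<circ> fst)"
    by (rule continuous_map_compose[OF continuous_map_fst continuous_map_tuple_inclusion[OF AfCom_subset_finite_subsets]])
  then have "continuous_map ?W (prod_topology unit_interval F.X) (\<lambda>x. (snd x, incl (fst x)))"
    by (intro continuous_map_pairedI continuous_map_snd) (simp add: o_def)
  note continuous_map_compose[OF continuous_map_compose[OF this continuous_map_cone_contraction[OF one_closed]] F.continuous_map_proj]
  then have "continuous_map ?W F.Y (\<lambda>(y, u). F.proj (contr u (incl y)))"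
    by (simp add: o_def case_prod_unfold)
  from continuous_map_into_E_com[OF A.continuous_map_proj this]
  show "continuous_map A.X (E_com G) (\<lambda>y. (A.proj y, restrict (\<lambda>u. F.proj (contr u (incl y))) {0..1}))"
    using inclusion_proj cone_contraction_0[OF one_closed incl_in] cone_contraction_1[OF one_closed incl_in] by simp
qed

text \<open>The lifting criterion applies: the projection is \<open>fst\<close>, and the distances
  equal those of the starting points of the lifted paths, which depend continuously on
  \<open>w\<close>.\<close>

lemma continuous_map_from_fiber: "continuous_map (E_com G) A.X from_fiber"
proof (rule A.continuous_map_lift)
  show "from_fiber \<in> topspace (E_com G) \<rightarrow> topspace A.X" using from_fiber(1) by blast
  have "continuous_map (E_com G) A.Y fst"
    unfolding E_com_eq by (intro continuous_map_from_subtopology continuous_map_fst)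
  then show "continuous_map (E_com G) A.Y (\<lambda>w. A.proj (from_fiber w))"
    by (rule continuous_map_eq) (simp add: from_fiber(2))
  fix w0 assume w0: "w0 \<in> topspace (E_com G)"
  have "continuous_map (E_com G) (prod_topology (E_com G) unit_interval) (\<lambda>w. (w, 0))"
    by (intro continuous_map_pairedI) (auto simp: continuous_map_const)
  from continuous_map_compose[OF this continuous_map_fiber_lift]
  have cont: "continuous_map (E_com G) F.X (\<lambda>w. fiber_lift w 0)" by (simp add: o_def)
  let ?V = "{w \<in> topspace (E_com G). fiber_lift w 0 \<in> {c \<in> topspace F.X. F.d c (fiber_lift w0 0) < 1/2}}"
  have in0: "fiber_lift w0 0 \<in> topspace F.X" using cont w0 by (auto simp: continuous_map_def)
  have "openin (E_com G) ?V"
    by (rule openin_continuous_map_preimage[OF cont openin_step_ball[OF in0]])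
  moreover have "A.d (from_fiber w) (from_fiber w0) < 1/2" if "w \<in> ?V" for w
    using step_dist_tuple_inclusion[OF AfCom_subset_finite_subsets from_fiber(1) from_fiber(1), of w w0] that w0
    by (simp add: from_fiber(3))
  ultimately show "\<exists>V. openin (E_com G) V \<and> w0 \<in> V \<and> (\<forall>w\<in>V. A.d (from_fiber w) (from_fiber w0) < 1/2)"
    using w0 in0 by (intro exI[of _ ?V]) simp
qed

text \<open>The cone path is itself a lift of the path in \<open>to_fiber y\<close> ending at the
  base point, so by uniqueness the lifted path starts at \<open>incl y\<close>.\<close>

lemma from_to_fiber:
  assumes y: "y \<in> topspace A.X"
  shows "from_fiber (to_fiber y) = y"
proof -
  have w: "to_fiber y \<in> topspace (E_com G)" using continuous_map_to_fiber y by (auto simp: continuous_map_def)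
  obtain \<gamma> where \<gamma>: "to_fiber y = (A.proj y, \<gamma>)" "\<gamma> = restrict (\<lambda>u. F.proj (contr u (incl y))) {0..1}"
    by (simp add: to_fiber_def)
  note lift = fiber_lift[OF w[unfolded \<gamma>(1)]]
  have "fiber_lift (A.proj y, \<gamma>) 0 = contr 0 (incl y)"
  proof (rule F.path_lift_unique[OF lift(1) continuous_map_cone_path[OF incl_in[OF y]]])
    show "F.proj (fiber_lift (A.proj y, \<gamma>) s) = F.proj (contr s (incl y))" if "s \<in> {0..1}" for s
      using lift(2)[OF that] that by (simp add: \<gamma>(2))
    show "fiber_lift (A.proj y, \<gamma>) 1 = contr 1 (incl y)"
      using lift(3) cone_contraction_1[OF one_closed incl_in[OF y]] by simp
  qed simp
  also have "\<dots> = incl y" by (rule cone_contraction_0[OF one_closed incl_in[OF y]])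
  finally show ?thesis
    using from_fiber_unique[OF from_fiber(1)[OF w] y] from_fiber(2,3)[OF w] \<gamma>(1) by simp
qed

text \<open>At time \<open>s\<close> the path \<open>\<gamma>\<close> with lift \<open>\<delta>\<close> is replaced by \<open>r \<mapsto> [H (r b(s)) (\<delta> (r a(s)))]\<close>, where \<open>H\<close>
  is the cone contraction. As \<open>max a(s) b(s) = 1\<close>, this path still ends at the base point.\<close>

lemma homotopic_to_from_fiber:
  "homotopic_with (\<lambda>x. True) (E_com G) (E_com G) id (to_fiber \<circ> from_fiber)"
proof -
  \<comment> \<open>The pair \<open>(a s, b s)\<close> runs along two edges of a square, from
    \<open>(1, 0)\<close> through \<open>(1, 1)\<close> to \<open>(0, 1)\<close>: the homotopy
    starts with the given path and ends with the cone path of the starting point of its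
    lift.\<close>
  define a b :: "real \<Rightarrow> real" where "a s = min 1 (2 - 2 * s)" and "b s = min 1 (2 * s)" for s
  let ?W = "prod_topology unit_interval (E_com G)"
  let ?M = "\<lambda>((s, w), r). F.proj (contr (r * b s) (fiber_lift w (r * a s)))"
  let ?H = "\<lambda>sw. (fst (snd sw), restrict (\<lambda>r. ?M (sw, r)) {0..1})"
  have ab: "r * a s \<in> {0..1}" "r * b s \<in> {0..1}" if "s \<in> {0..1}" "r \<in> {0..1}" for r s
    using that by (auto simp: a_def b_def min_def mult_le_one)
  have "continuous_map ?W (E_com G) ?H"
  proof (rule continuous_map_into_E_com)
    show "continuous_map ?W A.Y (\<lambda>sw. fst (snd sw))"
      using continuous_map_compose[OF continuous_map_snd continuous_map_from_subtopology[OF continuous_map_fst]]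
      unfolding E_com_eq by (simp add: o_def)
    let ?P = "prod_topology ?W unit_interval"
    have coord: "continuous_map ?P euclideanreal (\<lambda>x. fst (fst x))" "continuous_map ?P euclideanreal snd"
      "continuous_map ?P (E_com G) (\<lambda>x. snd (fst x))"
      using continuous_map_compose[OF continuous_map_fst[of ?W unit_interval] continuous_map_fst[of unit_interval "E_com G"]]
        continuous_map_compose[OF continuous_map_fst[of ?W unit_interval] continuous_map_snd[of unit_interval "E_com G"]]
        continuous_map_snd[of ?W unit_interval]
      by (auto simp: o_def continuous_map_in_subtopology)
    have "continuous_map ?P unit_interval (\<lambda>x. snd x * a (fst (fst x)))"
      unfolding a_def by (intro continuous_map_into_subtopology continuous_map_real_mult continuous_map_real_min
          continuous_map_diff coord) (use ab in \<open>auto simp: a_def\<close>)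
    moreover have b: "continuous_map ?P unit_interval (\<lambda>x. snd x * b (fst (fst x)))"
      unfolding b_def by (intro continuous_map_into_subtopology continuous_map_real_mult continuous_map_real_min
          coord) (use ab in \<open>auto simp: b_def\<close>)
    ultimately have "continuous_map ?P (prod_topology (E_com G) unit_interval) (\<lambda>x. (snd (fst x), snd x * a (fst (fst x))))"
      using coord(3) by (intro continuous_map_pairedI)
    from continuous_map_compose[OF this continuous_map_fiber_lift]
    have "continuous_map ?P F.X (\<lambda>x. fiber_lift (snd (fst x)) (snd x * a (fst (fst x))))" by (simp add: o_def)
    then have "continuous_map ?P (prod_topology unit_interval F.X)
        (\<lambda>x. (snd x * b (fst (fst x)), fiber_lift (snd (fst x)) (snd x * a (fst (fst x)))))"
      using b by (intro continuous_map_pairedI)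
    from continuous_map_compose[OF continuous_map_compose[OF this continuous_map_cone_contraction[OF one_closed]] F.continuous_map_proj]
    show "continuous_map ?P F.Y ?M" by (simp add: o_def case_prod_unfold)
  next
    fix sw assume "sw \<in> topspace ?W"
    then obtain s x \<gamma> where sw: "sw = (s, (x, \<gamma>))" "s \<in> {0..1}" "(x, \<gamma>) \<in> topspace (E_com G)" by auto
    note lift = fiber_lift[OF sw(3)]
    have "F.proj (contr 0 (fiber_lift (x, \<gamma>) 0)) = B_com_inclusion G x"
      using cone_contraction_0[OF one_closed lift(4)[of 0]] lift(2)[of 0] sw(3) by (simp add: in_E_com)
    then show "?M (sw, 0) = B_com_inclusion G (fst (snd sw))" by (simp add: sw(1))
    \<comment> \<open>In the first half the lift has reached the base point, which the contraction
      fixes; in the second half the contraction is complete.\<close>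
    have "contr (b s) (fiber_lift (x, \<gamma>) (a s)) = base"
    proof (cases "s \<le> 1/2")
      case True
      then have "a s = 1" by (simp add: a_def)
      then show ?thesis
        using cone_contraction_vertex[OF one_closed, of "b s"] lift(3) ab(2)[OF sw(2), of 1] by simp
    next
      case False
      then have "b s = 1" by (simp add: b_def)
      then show ?thesis
        using cone_contraction_1[OF one_closed lift(4)[of "a s"]] ab(1)[OF sw(2), of 1] by simp
    qed
    then show "?M (sw, 1) = F.proj base" by (simp add: sw(1))
  qed
  moreover have "?H (0, w) = w" if "w \<in> topspace (E_com G)" for w
  proof -
    obtain x \<gamma> where w: "w = (x, \<gamma>)" by force
    note w' = that[unfolded w]
    have "restrict (\<lambda>r. ?M ((0, w), r)) {0..1} = \<gamma>"
    proof
      fix r show "restrict (\<lambda>r. ?M ((0, w), r)) {0..1} r = \<gamma> r"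
        using fiber_lift(2,4)[OF w', of r] cone_contraction_0[OF one_closed, of "fiber_lift (x, \<gamma>) r"] w'
        by (cases "r \<in> {0..1}") (auto simp: a_def b_def w in_E_com extensional_def)
    qed
    then show ?thesis by (simp add: w)
  qed
  moreover have "?H (1, w) = to_fiber (from_fiber w)" if "w \<in> topspace (E_com G)" for w
    using from_fiber[OF that] by (simp add: to_fiber_def a_def b_def)
  ultimately show ?thesis
    by (subst homotopic_with) (auto intro!: exI[of _ ?H])
qed

lemma E_com_homotopy_equivalent: "E_com G homotopy_equivalent_space A.X"
  unfolding homotopy_equivalent_space_def
proof (intro exI conjI)
  show "continuous_map (E_com G) A.X from_fiber" by (rule continuous_map_from_fiber)
  show "continuous_map A.X (E_com G) to_fiber" by (rule continuous_map_to_fiber)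
  show "homotopic_with (\<lambda>x. True) (E_com G) (E_com G) (to_fiber \<circ> from_fiber) id"
    by (rule homotopic_with_symD[OF homotopic_to_from_fiber])
  show "homotopic_with (\<lambda>x. True) A.X A.X (from_fiber \<circ> to_fiber) id"
    by (rule homotopic_with_equal)
      (auto simp: from_to_fiber intro: continuous_map_compose[OF continuous_map_to_fiber continuous_map_from_fiber])
qed

end

theorem proposition7:
  fixes G :: "('a, 'b) monoid_scheme"
  assumes "group G"
  shows "E_com G homotopy_equivalent_space complex_realization (AfCom G)"
proof -
  obtain e :: "'a set \<Rightarrow> nat \<Rightarrow> 'a" where "coherent_enumeration e"
    using coherent_enumeration_exists by blast
  then interpret enumerated_complex "AfCom G" e
    by unfold_locales (rule abstract_simplicial_complex_AfCom)
  show ?thesis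
    using group.E_com_homotopy_equivalent[OF assms] tuple_realization_homotopy_equivalent
    by (rule homotopy_eqv_trans)
qed

end
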